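(* Let $F:\mathcal D(F)\to\mathcal P(\mathbb R^{2N})$ be the set-valued map associated with the system of $N$ screw dislocations in $\Omega$ (see context), and let $\mathbf Z_0\in\mathcal D(F)$ be a given initial configuration of dislocations. Let $r_0$ be such that $0<r_0<\operatorname{dist}(\mathbf Z_0,\partial\mathcal D(F))$ and set $$m_0:=\max_{\mathbf Z\in\overline{B(\mathbf Z_0,r_0)}}\Big(\sum_{\ell=1}^N|\mathbf j_\ell(\mathbf Z)|^2\Big)^{1/2}.$$ Then there exists a solution $\mathbf Z:[-T,T]\to\mathcal D(F)$ of $$\dot{\mathbf Z}\in\operatorname{co}F(\mathbf Z),\qquad \mathbf Z(0)=\mathbf Z_0,$$ with $T\ge r_0/m_0$.
   Context: Setting. $\Omega\subset\mathbb R^2$ is a bounded simply connected open set with $C^{2,\gamma}$ boundary for some $\gamma\in(0,1)$, with outer unit normal $\mathbf n_\Omega$; $N\ge1$ is an integer, and $b_1,\dots,b_N\in\mathbb R$ are the Burgers moduli. Let $\mu>0$, $\lambda\neq0$ and $$\mathbf L=\begin{pmatrix}\mu&0\\0&\mu\lambda^2\end{pmatrix},\quad \mathbf J=\begin{pmatrix}0&1\\-1&0\end{pmatrix},\quad \boldsymbol\Lambda=\begin{pmatrix}\lambda&0\\0&1\end{pmatrix},\quad \mathbf k_i(\mathbf x;\mathbf y)=\frac{b_i}{2\pi}\frac{\lambda\mathbf J^T(\mathbf x-\mathbf y)}{|\boldsymbol\Lambda(\mathbf x-\mathbf y)|^2}\ (\mathbf x\ne\mathbf y).$$ Set $\mathcal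 D(F)=\{\mathbf Z=(\mathbf z_1,\dots,\mathbf z_N)\in\Omega^N:\ \mathbf z_j\neq\mathbf z_k\text{ for all }j\ne k\}\subset\mathbb R^{2N}$. For $\mathbf Z\in\mathcal D(F)$ let $u_0(\cdot;\mathbf z_1,\dots,\mathbf z_N)$ be the solution (unique up to an additive constant) of the Neumann problem $\operatorname{div}(\mathbf L\nabla_{\mathbf x}u_0)=0$ in $\Omega$, $\mathbf L(\nabla_{\mathbf x}u_0+\sum_{i=1}^N\mathbf k_i(\mathbf x;\mathbf z_i))\cdot\mathbf n_\Omega(\mathbf x)=0$ on $\partial\Omega$. The Peach-Köhler force on the $\ell$-th dislocation is $$\mathbf j_\ell(\mathbf Z)=b_\ell\,\mathbf J\mathbf L\Big[\sum_{i\ne\ell}\mathbf k_i(\mathbf z_\ell;\mathbf z_i)+\nabla_{\mathbf x}u_0(\mathbf z_\ell;\mathbf z_1,\dots,\mathbf z_N)\Big].$$ The set of glide directions $\mathcal G\subset S^1$ is a finite set of unit vectors of $\mathbb R^2$ with $-\mathbf g\in\mathcal G$ whenever $\mathbf g\in\mathcal G$ and $\operatorname{span}\mathcal G=\mathbb R^2$. Set $\mathcal G_\ell(\mathbf Z)=\arg\max_{\mathbf g\in\mathcal G}\{\mathbf j_\ell(\mathbf Z)\cdot\mathbf g\}$, $F_\ell(\mathbf Z)=\{(\mathbf j_\ell(\mathbf Z)\cdot\mathbf g)\mathbf g:\mathbf g\in\mathcal G_\ell(\mathbf Z)\}$, $F(\mathbf Z)=F_1(\mathbf Z)\times\cdots\times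 F_N(\mathbf Z)\subset\mathbb R^{2N}$. $\operatorname{co}$ denotes the convex hull. A solution of $\dot{\mathbf Z}\in\operatorname{co}F(\mathbf Z)$ on an interval $I$ is an absolutely continuous function $\mathbf Z$ on $I$ with $\mathbf Z(t)\in\mathcal D(F)$ for $t\in I$ and $\dot{\mathbf Z}(t)\in\operatorname{co}F(\mathbf Z(t))$ for a.e. $t\in I$. $B(\mathbf Z_0,r_0)$ is the open Euclidean ball in $\mathbb R^{2N}$. *)

theory Defs
  imports "HOL-Analysis.Analysis"
begin

section \<open>Planar domains with Hoelder regular boundary\<close>

definition holder_C2_on :: "real \<Rightarrow> (real \<Rightarrow> real) \<Rightarrow> real set \<Rightarrow> bool" where
  "holder_C2_on \<gamma> \<phi> S \<longleftrightarrow>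
     (\<exists>\<phi>' \<phi>''. (\<forall>s\<in>S. (\<phi> has_real_derivative \<phi>' s) (at s)) \<and>
              (\<forall>s\<in>S. (\<phi>' has_real_derivative \<phi>'' s) (at s)) \<and>
              (\<exists>C. \<forall>s\<in>S. \<forall>t\<in>S. \<bar>\<phi>'' s - \<phi>'' t\<bar> \<le> C * \<bar>s - t\<bar> powr \<gamma>))"

text \<open>In the orthonormal frame \<open>(\<tau>, \<nu>)\<close> centred at \<open>p\<close>, the set \<open>\<Omega>\<close> is, inside the box
  \<open>\<bar>s\<bar> < r\<close>, \<open>\<bar>t\<bar> < h\<close>, the strict epigraph of \<open>\<phi>\<close>; so \<open>\<nu>\<close> points into \<open>\<Omega>\<close>. The frame need not be
  tangent to the boundary at \<open>p\<close>.\<close>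

definition local_epigraph ::
  "(real^2) set \<Rightarrow> real^2 \<Rightarrow> real^2 \<Rightarrow> real^2 \<Rightarrow> (real \<Rightarrow> real) \<Rightarrow> real \<Rightarrow> real \<Rightarrow> bool" where
  "local_epigraph \<Omega> p \<tau> \<nu> \<phi> r h \<longleftrightarrow>
     norm \<tau> = 1 \<and> norm \<nu> = 1 \<and> \<tau> \<bullet> \<nu> = 0 \<and> 0 < r \<and> 0 < h \<and> \<phi> 0 = 0 \<and>
     (\<forall>s. \<bar>s\<bar> < r \<longrightarrow> \<bar>\<phi> s\<bar> < h) \<and>
     (\<forall>s t. \<bar>s\<bar> < r \<and> \<bar>t\<bar> < h \<longrightarrow> (p + s *\<^sub>R \<tau> + t *\<^sub>R \<nu> \<in> \<Omega> \<longleftrightarrow> \<phi> s < t))"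

definition C2_holder_boundary :: "real \<Rightarrow> (real^2) set \<Rightarrow> bool" where
  "C2_holder_boundary \<gamma> \<Omega> \<longleftrightarrow>
     (\<forall>p\<in>frontier \<Omega>. \<exists>\<tau> \<nu> \<phi> r h. local_epigraph \<Omega> p \<tau> \<nu> \<phi> r h \<and> holder_C2_on \<gamma> \<phi> {-r<..<r})"

text \<open>At a boundary point near which \<open>\<Omega>\<close> is an epigraph, the outer unit normal is the downward
  normal of the graph; it does not depend on the chart (\<open>outer_unit_normal_eq\<close> below).\<close>

definition outer_unit_normal :: "(real^2) set \<Rightarrow> real^2 \<Rightarrow> real^2" where
  "outer_unit_normal \<Omega> p =
     (THE n. \<exists>\<tau> \<nu> \<phi> r h d. local_epigraph \<Omega> p \<tau> \<nu> \<phi> r h \<and> (\<phi> has_real_derivative d) (at 0) \<and>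
                n = (1 / sqrt (1 + d\<^sup>2)) *\<^sub>R (d *\<^sub>R \<tau> - \<nu>))"

lemma local_epigraph_halfplane:
  fixes v :: "real^2"
  assumes e: "local_epigraph \<Omega> p \<tau> \<nu> \<phi> r h" and d: "(\<phi> has_real_derivative d) (at 0)"
    and n: "n = (1 / sqrt (1 + d\<^sup>2)) *\<^sub>R (d *\<^sub>R \<tau> - \<nu>)"
  shows "norm n = 1"
    and "v \<bullet> n < 0 \<Longrightarrow> \<forall>\<^sub>F t in at_right 0. p + t *\<^sub>R v \<in> \<Omega>"
    and "v \<bullet> n > 0 \<Longrightarrow> \<forall>\<^sub>F t in at_right 0. p + t *\<^sub>R v \<notin> \<Omega>"
proof -
  have on: "\<tau> \<bullet> \<tau> = 1" "\<nu> \<bullet> \<nu> = 1" "\<tau> \<bullet> \<nu> = 0" "0 < r" "0 < h" "\<phi> 0 = 0"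
    and box: "\<And>s t. \<bar>s\<bar> < r \<Longrightarrow> \<bar>t\<bar> < h \<Longrightarrow> p + s *\<^sub>R \<tau> + t *\<^sub>R \<nu> \<in> \<Omega> \<longleftrightarrow> \<phi> s < t"
    using e by (auto simp: local_epigraph_def dot_square_norm)
  have pos: "0 < 1 + d\<^sup>2" by (simp add: add_pos_nonneg)
  have "(norm n)\<^sup>2 = 1"
    unfolding n power2_norm_eq_inner
    using on pos by (simp add: inner_diff inner_commute field_simps power2_eq_square)
  then show "norm n = 1" using norm_ge_zero[of n] by (simp only: power2_eq_1_iff) linarith
  define a c where "a = v \<bullet> \<tau>" and "c = v \<bullet> \<nu>"
  have v: "v = a *\<^sub>R \<tau> + c *\<^sub>R \<nu>"
  proof -
    define k where "k = \<tau>$1 * \<nu>$2 - \<tau>$2 * \<nu>$1"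
    have 1: "\<tau>$1 * \<tau>$1 + \<tau>$2 * \<tau>$2 = 1" "\<nu>$1 * \<nu>$1 + \<nu>$2 * \<nu>$2 = 1" "\<tau>$1 * \<nu>$1 + \<tau>$2 * \<nu>$2 = 0"
      using on by (simp_all add: inner_vec_def sum_2)
    have 2: "\<nu>$1 = - k * \<tau>$2" "\<nu>$2 = k * \<tau>$1" unfolding k_def using 1 by algebra+
    have 3: "k * k = 1" using 1 unfolding k_def by algebra
    have "v$1 = a * \<tau>$1 + c * \<nu>$1" "v$2 = a * \<tau>$2 + c * \<nu>$2"
      unfolding a_def c_def inner_vec_def sum_2 inner_real_def 2 using 1(1) 3 by algebra+
    then show ?thesis by (simp add: vec_eq_iff forall_2)
  qed
  have vn: "v \<bullet> n = (d * a - c) / sqrt (1 + d\<^sup>2)"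
    unfolding n a_def c_def by (simp add: inner_diff_right)
  have "((\<lambda>t. \<phi> (t * a)) has_real_derivative d * a) (at 0)"
    by (rule DERIV_chain2) (use d in \<open>auto intro!: derivative_eq_intros\<close>)
  then have lim: "((\<lambda>t. \<phi> (t * a) / t) \<longlongrightarrow> d * a) (at_right 0)"
    using on by (simp add: has_field_derivative_iff filterlim_at_split)
  have small: "\<forall>\<^sub>F t in at_right 0. \<bar>t * q\<bar> < \<rho>" if "0 < \<rho>" for q \<rho> :: real
  proof -
    have "((\<lambda>t. \<bar>t * q\<bar>) \<longlongrightarrow> \<bar>0 * q\<bar>) (at_right 0)" by (intro tendsto_intros)
    then show ?thesis using that by (simp add: order_tendstoD(2))
  qed
  have iff: "\<forall>\<^sub>F t in at_right 0. p + t *\<^sub>R v \<in> \<Omega> \<longleftrightarrow> \<phi> (t * a) / t < c"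
    using small[OF on(4), of a] small[OF on(5), of c] eventually_at_right_less[of "0::real"]
  proof eventually_elim
    case (elim t)
    then show ?case
      using box[of "t * a" "t * c"] by (simp add: v scaleR_add_right add.assoc divide_less_eq mult.commute)
  qed
  show "\<forall>\<^sub>F t in at_right 0. p + t *\<^sub>R v \<in> \<Omega>" if "v \<bullet> n < 0"
  proof -
    have "d * a < c" using that pos by (simp add: vn divide_less_0_iff)
    from order_tendstoD(2)[OF lim this] iff show ?thesis by eventually_elim simp
  qed
  show "\<forall>\<^sub>F t in at_right 0. p + t *\<^sub>R v \<notin> \<Omega>" if "v \<bullet> n > 0"
  proof -
    have "c < d * a" using that pos by (simp add: vn zero_less_divide_iff)
    from order_tendstoD(1)[OF lim this] iff show ?thesis by eventually_elim simp
  qed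
qed

lemma outer_unit_normal_eq:
  assumes "local_epigraph \<Omega> p \<tau> \<nu> \<phi> r h" and "(\<phi> has_real_derivative d) (at 0)"
  shows "outer_unit_normal \<Omega> p = (1 / sqrt (1 + d\<^sup>2)) *\<^sub>R (d *\<^sub>R \<tau> - \<nu>)"
proof -
  have unique: "m = n"
    if m: "local_epigraph \<Omega> p \<tau>1 \<nu>1 \<phi>1 r1 h1" "(\<phi>1 has_real_derivative d1) (at 0)"
          "m = (1 / sqrt (1 + d1\<^sup>2)) *\<^sub>R (d1 *\<^sub>R \<tau>1 - \<nu>1)"
      and n: "local_epigraph \<Omega> p \<tau>2 \<nu>2 \<phi>2 r2 h2" "(\<phi>2 has_real_derivative d2) (at 0)"
          "n = (1 / sqrt (1 + d2\<^sup>2)) *\<^sub>R (d2 *\<^sub>R \<tau>2 - \<nu>2)"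
    for m n \<tau>1 \<nu>1 \<phi>1 r1 h1 d1 \<tau>2 \<nu>2 \<phi>2 r2 h2 d2
  proof (rule ccontr)
    assume "m \<noteq> n"
    have 1: "norm m = 1" "norm n = 1"
      using local_epigraph_halfplane(1)[OF m] local_epigraph_halfplane(1)[OF n] by auto
    have mm: "m \<bullet> m = 1" "n \<bullet> n = 1" using 1 by (simp_all add: dot_square_norm)
    have "0 < (n - m) \<bullet> (n - m)" using \<open>m \<noteq> n\<close> by simp
    then have *: "m \<bullet> n < 1" using mm by (simp add: inner_diff inner_commute)
    have "(n - m) \<bullet> m < 0" "(n - m) \<bullet> n > 0" using * mm by (simp_all add: inner_diff inner_commute)
    from local_epigraph_halfplane(2)[OF m this(1)] local_epigraph_halfplane(3)[OF n this(2)]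
    have "\<forall>\<^sub>F t in at_right (0::real). False" by eventually_elim simp
    then show False by (simp add: trivial_limit_at_right_real)
  qed
  show ?thesis
    unfolding outer_unit_normal_def
    by (rule the_equality) (use assms unique in blast)+
qed

section \<open>The Neumann problem\<close>

definition grad :: "('a::real_inner \<Rightarrow> real) \<Rightarrow> 'a \<Rightarrow> 'a" where
  "grad u x = (THE D. GDERIV u x :> D)"

definition divergence :: "(real^'n \<Rightarrow> real^'n) \<Rightarrow> real^'n \<Rightarrow> real" where
  "divergence V x = trace (jacobian V (at x))"

definition C2_on :: "(real^'n \<Rightarrow> real) \<Rightarrow> (real^'n) set \<Rightarrow> bool" where
  "C2_on u S \<longleftrightarrow> (\<forall>x\<in>S. u differentiable (at x)) \<and> (\<forall>x\<in>S. grad u differentiable (at x)) \<and>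
     continuous_on S (\<lambda>x. jacobian (grad u) (at x))"

text \<open>Classical solutions, of class C2 in \<open>\<Omega>\<close> and C1 up to the boundary; \<open>G\<close> is the continuous
  extension of the gradient to the closure, and \<open>K\<close> is the given field in the boundary condition.\<close>

definition neumann_solution ::
  "(real^2) set \<Rightarrow> real^2^2 \<Rightarrow> (real^2 \<Rightarrow> real^2) \<Rightarrow> (real^2 \<Rightarrow> real) \<Rightarrow> bool" where
  "neumann_solution \<Omega> L K u \<longleftrightarrow>
     C2_on u \<Omega> \<and> continuous_on (closure \<Omega>) u \<and>
     (\<forall>x\<in>\<Omega>. divergence (\<lambda>y. L *v grad u y) x = 0) \<and>
     (\<exists>G. continuous_on (closure \<Omega>) G \<and> (\<forall>x\<in>\<Omega>. G x = grad u x) \<and>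
          (\<forall>x\<in>frontier \<Omega>. (L *v (G x + K x)) \<bullet> outer_unit_normal \<Omega> x = 0))"

section \<open>Screw dislocations\<close>

definition L_mat :: "real \<Rightarrow> real \<Rightarrow> real^2^2" where
  "L_mat \<mu> lam = vector [vector [\<mu>, 0], vector [0, \<mu> * lam\<^sup>2]]"

definition J_mat :: "real^2^2" where
  "J_mat = vector [vector [0, 1], vector [-1, 0]]"

definition Lambda_mat :: "real \<Rightarrow> real^2^2" where
  "Lambda_mat lam = vector [vector [lam, 0], vector [0, 1]]"

text \<open>The singular strain at \<open>x\<close> of a dislocation at \<open>y\<close> with Burgers modulus \<open>\<beta>\<close>; only used for
  \<open>x \<noteq> y\<close>.\<close>

definition strain_kernel :: "real \<Rightarrow> real \<Rightarrow> real^2 \<Rightarrow> real^2 \<Rightarrow> real^2" where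
  "strain_kernel lam \<beta> x y =
     (\<beta> / (2 * pi)) *\<^sub>R
       ((1 / (norm (Lambda_mat lam *v (x - y)))\<^sup>2) *\<^sub>R (lam *\<^sub>R (transpose J_mat *v (x - y))))"

text \<open>Configurations of \<open>N = CARD('n)\<close> dislocations are elements of \<open>real^2^'n\<close>, whose norm is the
  Euclidean norm of the plane to the power \<open>N\<close>.\<close>

definition configurations :: "(real^2) set \<Rightarrow> (real^2^'n) set" where
  "configurations \<Omega> = {Z. (\<forall>i. Z $ i \<in> \<Omega>) \<and> (\<forall>j k. j \<noteq> k \<longrightarrow> Z $ j \<noteq> Z $ k)}"

text \<open>\<open>u0 Z\<close> is a solution of the Neumann problem for each configuration; the additive constant is
  irrelevant, as only its gradient enters the force.\<close>

definition is_boundary_response ::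
  "(real^2) set \<Rightarrow> real \<Rightarrow> real \<Rightarrow> real^'n \<Rightarrow> (real^2^'n \<Rightarrow> real^2 \<Rightarrow> real) \<Rightarrow> bool" where
  "is_boundary_response \<Omega> \<mu> lam b u0 \<longleftrightarrow>
     (\<forall>Z\<in>configurations \<Omega>.
        neumann_solution \<Omega> (L_mat \<mu> lam) (\<lambda>x. \<Sum>i\<in>UNIV. strain_kernel lam (b $ i) x (Z $ i)) (u0 Z))"

definition peach_koehler ::
  "real \<Rightarrow> real \<Rightarrow> real^'n \<Rightarrow> (real^2^'n \<Rightarrow> real^2 \<Rightarrow> real) \<Rightarrow> 'n \<Rightarrow> real^2^'n \<Rightarrow> real^2" where
  "peach_koehler \<mu> lam b u0 l Z =
     (b $ l) *\<^sub>R ((J_mat ** L_mat \<mu> lam) *v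
       ((\<Sum>i\<in>UNIV - {l}. strain_kernel lam (b $ i) (Z $ l) (Z $ i)) + grad (u0 Z) (Z $ l)))"

definition glide_directions :: "(real^2) set \<Rightarrow> bool" where
  "glide_directions G \<longleftrightarrow>
     finite G \<and> (\<forall>g\<in>G. norm g = 1) \<and> (\<forall>g\<in>G. - g \<in> G) \<and> span G = UNIV"

definition glide_velocities :: "(real^2) set \<Rightarrow> real^2 \<Rightarrow> (real^2) set" where
  "glide_velocities G f = {(f \<bullet> g) *\<^sub>R g | g. is_arg_max (\<lambda>g. f \<bullet> g) (\<lambda>g. g \<in> G) g}"

definition dislocation_map ::
  "real \<Rightarrow> real \<Rightarrow> real^'n \<Rightarrow> (real^2^'n \<Rightarrow> real^2 \<Rightarrow> real) \<Rightarrow> (real^2) set \<Rightarrow> real^2^'n \<Rightarrow> (real^2^'n) set"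
  where
  "dislocation_map \<mu> lam b u0 G Z = {V. \<forall>l. V $ l \<in> glide_velocities G (peach_koehler \<mu> lam b u0 l Z)}"

section \<open>Differential inclusions\<close>

text \<open>A division of the union of \<open>P\<close> is a finite family of compact intervals with disjoint
  interiors.\<close>

definition absolutely_continuous_fun_on :: "real set \<Rightarrow> (real \<Rightarrow> 'a::real_normed_vector) \<Rightarrow> bool" where
  "absolutely_continuous_fun_on I f \<longleftrightarrow>
     (\<forall>\<epsilon>>0. \<exists>\<delta>>0. \<forall>P. P division_of \<Union>P \<and> \<Union>P \<subseteq> I \<and> (\<Sum>K\<in>P. Sup K - Inf K) < \<delta> \<longrightarrow>
        (\<Sum>K\<in>P. norm (f (Sup K) - f (Inf K))) < \<epsilon>)"

definition inclusion_solution ::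
  "'a::real_normed_vector set \<Rightarrow> ('a \<Rightarrow> 'a set) \<Rightarrow> real set \<Rightarrow> (real \<Rightarrow> 'a) \<Rightarrow> bool" where
  "inclusion_solution D \<Phi> I Z \<longleftrightarrow>
     absolutely_continuous_fun_on I Z \<and> (\<forall>t\<in>I. Z t \<in> D) \<and>
     (AE t in lebesgue_on I. \<exists>v\<in>\<Phi> (Z t). (Z has_vector_derivative v) (at t within I))"

end

theory Submission
  imports Defs "HOL-Complex_Analysis.Riemann_Mapping"
begin

text \<open>The theorem rests on two facts: the Peach-Koehler force is continuous on the open set of
  configurations, and a differential inclusion with an upper semicontinuous, compact right-hand side
  has solutions for as long as the speed bound keeps them in a given ball.

  Continuity of the force. Its singular part is explicit, so the point is that the gradient of the
  boundary response at a dislocation depends continuously on the configuration. In the coordinate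
  \<open>lam * x1 + \<i> * x2\<close> the equation becomes the Laplace equation, so the gradient of the response,
  conjugated, is a holomorphic function. Since \<open>\<Omega>\<close> is simply connected it has a primitive \<open>F\<close>, and
  \<open>Im F\<close> is a stream function. The Neumann condition says that the field of the response plus the
  singular strains does not cross the boundary, that is, that \<open>Im F\<close> minus an explicit logarithmic
  potential \<open>vortex\<close> is locally constant along the boundary. The boundary of a bounded simply connected
  domain is connected, so there is a single constant, which can be normalised to \<open>0\<close>
  (\<open>stream_function\<close>). The Neumann problem has become a Dirichlet problem with explicit data. For two
  configurations the maximum principle bounds the difference of the stream functions by the difference
  of the data, and Cauchy's inequality turns this into a bound for the gradients (\<open>cgrad_stability\<close>).

  Existence. Euler polygons are equicontinuous, and by Arzela-Ascoli a subsequence converges to a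
  Lipschitz curve, which is differentiable almost everywhere (\<open>lipschitz_differentiable_ae\<close>). Each
  secant of a polygon is an average of velocities chosen at nearby states; by upper semicontinuity
  it lies in a small neighbourhood of the convex hull of the velocities at the limit state, and so
  does the derivative of the limit (\<open>differential_inclusion_exists\<close>). The velocities in the glide
  model are at most as long as the force, so \<open>m\<^sub>0\<close> bounds the speed on the ball, and the solution
  lives at least for the time \<open>r\<^sub>0 / m\<^sub>0\<close> in both time directions. If \<open>m\<^sub>0 = 0\<close>, then \<open>Z\<^sub>0\<close> is at rest.\<close>

section \<open>Lipschitz functions of one real variable\<close>

text \<open>By Vitali's covering theorem, almost all of \<open>E\<close> is covered by disjoint intervals on which \<open>g\<close> has
  slope below \<open>p\<close>, inside an open set barely larger than \<open>E\<close>; the exceptional null set has a null image,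
  as \<open>g\<close> is Lipschitz.\<close>

lemma measure_image_le_slope:
  fixes g :: "real \<Rightarrow> real"
  assumes mono: "strict_mono g"
    and lip: "\<And>x y. \<bar>g x - g y\<bar> \<le> B * \<bar>x - y\<bar>"
    and p: "0 < p" and E: "E \<in> lmeasurable"
    and slope: "\<And>x d. x \<in> E \<Longrightarrow> 0 < d \<Longrightarrow> \<exists>a b. a < x \<and> x < b \<and> b - a < d \<and> g b - g a < p * (b - a)"
  shows "emeasure lebesgue (g ` E) \<le> ennreal p * emeasure lebesgue E"
proof -
  have *: "emeasure lebesgue (g ` E) \<le> ennreal p * (emeasure lebesgue E + ennreal e)" if "0 < e" for e
  proof -
    obtain U where U: "open U" "E \<subseteq> U" "emeasure lebesgue (U - E) < ennreal e"
      using sets_lebesgue_outer_open[of E e] E \<open>0 < e\<close> by (metis fmeasurableD)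
    have Um: "U \<in> sets lebesgue" using U(1) by (simp add: borel_open)
    have "emeasure lebesgue U = emeasure lebesgue (E \<union> (U - E))"
      using U(2) by (simp add: Un_absorb1)
    also have "\<dots> \<le> emeasure lebesgue E + emeasure lebesgue (U - E)"
      using E Um by (intro emeasure_subadditive) auto
    finally have Ue: "emeasure lebesgue U \<le> emeasure lebesgue E + ennreal e"
      using U(3) by (meson add_left_mono less_imp_le order_trans)
    define K where "K = {(a, b). a < b \<and> {a..b} \<subseteq> U \<and> g b - g a < p * (b - a)}"
    define ce where "ce = (\<lambda>(a, b). (a + b) / 2 :: real)"
    define ra where "ra = (\<lambda>(a, b). (b - a) / 2 :: real)"
    have cb: "cball (ce i) (ra i) = {fst i..snd i}" for i
      by (auto simp: ce_def ra_def cball_eq_atLeastAtMost field_simps split: prod.splits)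
    obtain C where C: "countable C" "C \<subseteq> K"
      "pairwise (\<lambda>i j. disjnt (cball (ce i) (ra i)) (cball (ce j) (ra j))) C"
      "negligible (E - (\<Union>i\<in>C. cball (ce i) (ra i)))"
    proof (rule Vitali_covering_theorem_cballs[of K ra E ce])
      show "0 < ra i" if "i \<in> K" for i using that by (auto simp: K_def ra_def)
      fix x d :: real assume x: "x \<in> E" and d: "0 < d"
      obtain r where r: "0 < r" "ball x r \<subseteq> U" using U x by (meson open_contains_ball subsetD)
      obtain a b where ab: "a < x" "x < b" "b - a < min d r" "g b - g a < p * (b - a)"
        using slope[OF x, of "min d r"] d r by auto
      have "{a..b} \<subseteq> ball x r" using ab by (auto simp: dist_real_def)
      then have "(a, b) \<in> K" using ab r by (auto simp: K_def)
      moreover have "x \<in> cball (ce (a, b)) (ra (a, b))" unfolding cb using ab by auto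
      moreover have "ra (a, b) < d" using ab by (auto simp: ra_def)
      ultimately show "\<exists>i. i \<in> K \<and> x \<in> cball (ce i) (ra i) \<and> ra i < d" by blast
    qed
    let ?I = "\<lambda>i. {fst i..snd i}" and ?J = "\<lambda>i. {g (fst i)..g (snd i)}"
    have lt: "fst i < snd i" "?I i \<subseteq> U" "g (snd i) - g (fst i) \<le> p * (snd i - fst i)" if "i \<in> C" for i
      using that C(2) by (force simp: K_def)+
    have disjI: "disjoint_family_on ?I C"
      using C(3) unfolding cb by (auto simp: disjoint_family_on_def pairwise_def disjnt_def)
    have disjJ: "disjoint_family_on ?J C"
      unfolding disjoint_family_on_def
    proof (intro ballI impI)
      fix i j assume ij: "i \<in> C" "j \<in> C" "i \<noteq> j"
      then have "?I i \<inter> ?I j = {}" using disjI by (auto simp: disjoint_family_on_def)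
      then have "snd i < fst j \<or> snd j < fst i"
        using lt(1)[OF ij(1)] lt(1)[OF ij(2)] by (auto simp: disjoint_iff)
      then show "?J i \<inter> ?J j = {}"
        using strict_monoD[OF mono, of "snd i" "fst j"] strict_monoD[OF mono, of "snd j" "fst i"] by auto
    qed
    define N where "N = g ` (E - (\<Union>i\<in>C. ?I i))"
    have N: "negligible N" unfolding N_def
    proof (rule negligible_locally_Lipschitz_image)
      show "negligible (E - (\<Union>i\<in>C. ?I i))" using C(4) unfolding cb .
      show "\<exists>T B. open T \<and> x \<in> T \<and> (\<forall>y\<in>(E - (\<Union>i\<in>C. ?I i)) \<inter> T. norm (g y - g x) \<le> B * norm (y - x))" for x
        using lip by (intro exI[of _ UNIV] exI[of _ B]) auto
    qed auto
    have Ns: "N \<in> null_sets lebesgue" "N \<in> sets lebesgue" "(\<Union>i\<in>C. ?J i) \<in> sets lebesgue"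
      using N C(1) by (auto simp: negligible_iff_null_sets null_setsD2 intro!: sets.countable_UN')
    have "g ` E \<subseteq> N \<union> (\<Union>i\<in>C. ?J i)"
    proof
      fix y assume "y \<in> g ` E"
      then obtain x where x: "x \<in> E" "y = g x" by blast
      show "y \<in> N \<union> (\<Union>i\<in>C. ?J i)"
      proof (cases "x \<in> (\<Union>i\<in>C. ?I i)")
        case True
        then obtain i where "i \<in> C" "fst i \<le> x" "x \<le> snd i" by auto
        then have "y \<in> ?J i" using x(2) monoD[OF strict_mono_mono[OF mono]] by simp
        then show ?thesis using \<open>i \<in> C\<close> by blast
      qed (use x in \<open>auto simp: N_def\<close>)
    qed
    then have "emeasure lebesgue (g ` E) \<le> emeasure lebesgue (N \<union> (\<Union>i\<in>C. ?J i))"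
      using Ns by (intro emeasure_mono sets.Un)
    also have "\<dots> = emeasure lebesgue (\<Union>i\<in>C. ?J i)"
      using Ns by (simp add: Un_commute[of N] emeasure_Un_null_set)
    also have "\<dots> = (\<integral>\<^sup>+i. emeasure lebesgue (?J i) \<partial>count_space C)"
      using C(1) disjJ by (intro emeasure_UN_countable) auto
    also have "\<dots> \<le> (\<integral>\<^sup>+i. ennreal p * emeasure lebesgue (?I i) \<partial>count_space C)"
      using lt p strict_mono_mono[OF mono]
      by (intro nn_integral_mono) (auto simp: less_imp_le monoD ennreal_mult'[symmetric])
    also have "\<dots> = ennreal p * (\<integral>\<^sup>+i. emeasure lebesgue (?I i) \<partial>count_space C)"
      by (intro nn_integral_cmult) auto
    also have "(\<integral>\<^sup>+i. emeasure lebesgue (?I i) \<partial>count_space C) = emeasure lebesgue (\<Union>i\<in>C. ?I i)"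
      using C(1) disjI by (intro emeasure_UN_countable[symmetric]) auto
    also have "\<dots> \<le> emeasure lebesgue U"
      using lt(2) Um by (intro emeasure_mono UN_least)
    finally show ?thesis using Ue by (meson mult_left_mono order_trans zero_le)
  qed
  show ?thesis
  proof (rule ennreal_le_epsilon)
    fix e :: real assume "0 < e"
    then have "emeasure lebesgue (g ` E) \<le> ennreal p * (emeasure lebesgue E + ennreal (e / p))"
      using p by (intro *) auto
    also have "\<dots> = ennreal p * emeasure lebesgue E + ennreal e"
      using p \<open>0 < e\<close> by (simp add: distrib_left ennreal_mult'[symmetric])
    finally show "emeasure lebesgue (g ` E) \<le> ennreal p * emeasure lebesgue E + ennreal e" .
  qed
qed

text \<open>The points at which secants below slope \<open>p\<close> and secants above slope \<open>q\<close> both occur at all small scales.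
  The point lies strictly inside the intervals, which makes the set a countable intersection of open
  sets.\<close>

definition secant_gap :: "(real \<Rightarrow> real) \<Rightarrow> real \<Rightarrow> real \<Rightarrow> real set" where
  "secant_gap f p q = {x. \<forall>d>0.
     (\<exists>a b. a < x \<and> x < b \<and> b - a < d \<and> f b - f a < p * (b - a)) \<and>
     (\<exists>a b. a < x \<and> x < b \<and> b - a < d \<and> q * (b - a) < f b - f a)}"

lemma secant_gap_borel: "secant_gap f p q \<in> sets borel"
proof -
  define U where "U P n = (\<Union>(a, b)\<in>{(a, b). b - a < 1 / Suc n \<and> P a b}. {a<..<b})"
    for P :: "real \<Rightarrow> real \<Rightarrow> bool" and n :: nat
  have op: "open (U P n)" for P n unfolding U_def by auto
  have eq: "(\<forall>d>0. \<exists>a b. a < x \<and> x < b \<and> b - a < d \<and> P a b) \<longleftrightarrow> (\<forall>n. x \<in> U P n)" for P x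
  proof
    assume "\<forall>d>0. \<exists>a b. a < x \<and> x < b \<and> b - a < d \<and> P a b"
    show "\<forall>n. x \<in> U P n"
    proof
      fix n
      have "0 < 1 / real (Suc n)" by simp
      then obtain a b where "a < x \<and> x < b \<and> b - a < 1 / real (Suc n) \<and> P a b"
        using \<open>\<forall>d>0. _ d\<close> by blast
      then show "x \<in> U P n" unfolding U_def by force
    qed
  next
    assume *: "\<forall>n. x \<in> U P n"
    show "\<forall>d>0. \<exists>a b. a < x \<and> x < b \<and> b - a < d \<and> P a b"
    proof (intro allI impI)
      fix d :: real assume "0 < d"
      then obtain n where n: "1 / real (Suc n) < d" using nat_approx_posE by blast
      from * have "x \<in> U P n" by blast
      then show "\<exists>a b. a < x \<and> x < b \<and> b - a < d \<and> P a b" using n unfolding U_def by fastforce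
    qed
  qed
  have "secant_gap f p q = (\<Inter>n. U (\<lambda>a b. f b - f a < p * (b - a)) n) \<inter> (\<Inter>n. U (\<lambda>a b. q * (b - a) < f b - f a) n)"
  proof (rule set_eqI)
    fix x
    have "x \<in> secant_gap f p q \<longleftrightarrow> (\<forall>d>0. \<exists>a b. a < x \<and> x < b \<and> b - a < d \<and> f b - f a < p * (b - a)) \<and>
        (\<forall>d>0. \<exists>a b. a < x \<and> x < b \<and> b - a < d \<and> q * (b - a) < f b - f a)"
      unfolding secant_gap_def mem_Collect_eq by meson
    then show "x \<in> secant_gap f p q \<longleftrightarrow> x \<in> (\<Inter>n. U (\<lambda>a b. f b - f a < p * (b - a)) n) \<inter> (\<Inter>n. U (\<lambda>a b. q * (b - a) < f b - f a) n)"
      unfolding eq by simp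
  qed
  then show ?thesis using op by (auto intro!: sets.Int sets.countable_INT)
qed

text \<open>After adding a linear function, \<open>f\<close> becomes an increasing bijection \<open>g\<close> with Lipschitz inverse. On the
  gap set \<open>E\<close> the slope estimate for \<open>g\<close> gives \<open>\<bar>g ` E\<bar> \<le> p' * \<bar>E\<bar>\<close>, and the one for the inverse gives
  \<open>\<bar>E\<bar> \<le> \<bar>g ` E\<bar> / q'\<close>. As \<open>p' < q'\<close>, this forces \<open>\<bar>E\<bar> = 0\<close>.\<close>

lemma secant_gap_negligible:
  fixes f :: "real \<Rightarrow> real"
  assumes lip: "\<And>x y. \<bar>f x - f y\<bar> \<le> M * \<bar>x - y\<bar>" and pq: "p < q"
  shows "negligible (secant_gap f p q)"
proof -
  have M0: "0 \<le> M" using lip[of 1 0] by (simp add: order_trans[OF abs_ge_zero])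
  \<comment> \<open>large enough for \<open>g\<close> to have slope at least \<open>1\<close> and for \<open>p + c\<close> to be positive\<close>
  define c where "c = M + 1 + \<bar>p\<bar>"
  define g where "g x = f x + c * x" for x
  define p' q' where "p' = p + c" and "q' = q + c"
  have p'q': "0 < p'" "p' < q'" using M0 pq by (auto simp: p'_def q'_def c_def)
  have lower: "y - x \<le> g y - g x" if "x \<le> y" for x y
  proof -
    have "y - x \<le> (1 + \<bar>p\<bar>) * (y - x)" using that mult_right_mono[of 1 "1 + \<bar>p\<bar>" "y - x"] by simp
    moreover have "- (M * (y - x)) \<le> f y - f x" using lip[of y x] that by (simp add: abs_le_iff)
    moreover have "c * (y - x) = M * (y - x) + (1 + \<bar>p\<bar>) * (y - x)" by (simp add: c_def algebra_simps)
    ultimately show ?thesis by (simp add: g_def algebra_simps)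
  qed
  have gmono: "strict_mono g"
  proof (rule strict_monoI)
    fix x y :: real assume "x < y"
    then show "g x < g y" using lower[of x y] by simp
  qed
  have glip: "\<bar>g x - g y\<bar> \<le> (M + c) * \<bar>x - y\<bar>" for x y
  proof -
    have "g x - g y = (f x - f y) + c * (x - y)" by (simp add: g_def algebra_simps)
    also have "\<bar>\<dots>\<bar> \<le> M * \<bar>x - y\<bar> + c * \<bar>x - y\<bar>"
      using lip[of x y] M0 by (intro order_trans[OF abs_triangle_ineq] add_mono) (auto simp: abs_mult c_def)
    finally show ?thesis by (simp add: algebra_simps)
  qed
  have gcont: "continuous_on A g" for A
  proof (rule continuous_on_subset)
    show "continuous_on UNIV g"
      using glip M0 by (intro lipschitz_on_continuous_on[of "M + c"] lipschitz_onI) (auto simp: dist_real_def c_def)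
  qed auto
  have surj: "\<exists>x. g x = y" for y
  proof -
    define R where "R = \<bar>y - g 0\<bar>"
    have "g (- R) \<le> y" "y \<le> g R" using lower[of "-R" 0] lower[of 0 R] by (auto simp: R_def)
    then show ?thesis using IVT'[of g "-R" y R] gcont by (auto simp: R_def)
  qed
  define k where "k = inv g"
  have gk: "g (k y) = y" for y unfolding k_def using surj by (metis surj_f_inv_f surj_def)
  have kg: "k (g x) = x" for x unfolding k_def using gmono by (simp add: strict_mono_imp_inj_on)
  have klip: "\<bar>k x - k y\<bar> \<le> 1 * \<bar>x - y\<bar>" for x y
    using lower[of "k x" "k y"] lower[of "k y" "k x"] by (auto simp: gk abs_if)
  have kcont: "continuous_on UNIV k"
    using klip by (intro lipschitz_on_continuous_on[of 1] lipschitz_onI) (auto simp: dist_real_def)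
  have kmono: "strict_mono k"
    using gmono by (metis gk strict_mono_def strict_mono_less)
  have main: "negligible (secant_gap f p q \<inter> ball 0 (real n))" for n
  proof -
    define E where "E = secant_gap f p q \<inter> ball 0 (real n)"
    have Eb: "E \<in> sets borel" unfolding E_def using secant_gap_borel by auto
    then have Em: "E \<in> lmeasurable"
      by (intro bounded_set_imp_lmeasurable) (auto simp: E_def sets_completionI_sets intro: bounded_subset[OF bounded_ball])
    have img: "g ` E = k -` E"
    proof (intro set_eqI iffI)
      show "y \<in> k -` E" if "y \<in> g ` E" for y using that by (auto simp: kg)
      show "y \<in> g ` E" if "y \<in> k -` E" for y using that by (intro image_eqI[of y g "k y"]) (auto simp: gk)
    qed
    have "k -` E \<inter> space borel \<in> sets borel"
      using kcont Eb by (intro measurable_sets[OF borel_measurable_continuous_onI]) auto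
    then have gEb: "g ` E \<in> sets borel" by (simp add: img)
    have "bounded (g ` E)"
    proof (rule bounded_subset)
      show "bounded (g ` cball 0 (real n))"
        using gcont by (intro compact_imp_bounded compact_continuous_image) auto
      show "g ` E \<subseteq> g ` cball 0 (real n)" by (auto simp: E_def)
    qed
    then have gEm: "g ` E \<in> lmeasurable" using gEb by (intro bounded_set_imp_lmeasurable) (auto simp: sets_completionI_sets)
    have slope_below: "\<exists>a b. a < x \<and> x < b \<and> b - a < d \<and> f b - f a < p * (b - a)"
      and slope_above: "\<exists>a b. a < x \<and> x < b \<and> b - a < d \<and> q * (b - a) < f b - f a" if "x \<in> E" "0 < d" for x d
      using that by (simp_all add: E_def secant_gap_def)
    have 1: "emeasure lebesgue (g ` E) \<le> ennreal p' * emeasure lebesgue E"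
    proof (rule measure_image_le_slope[OF gmono glip p'q'(1) Em])
      fix x d :: real assume "x \<in> E" "0 < d"
      then obtain a b where "a < x" "x < b" "b - a < d" "f b - f a < p * (b - a)"
        using slope_below by blast
      then show "\<exists>a b. a < x \<and> x < b \<and> b - a < d \<and> g b - g a < p' * (b - a)"
        by (intro exI[of _ a] exI[of _ b]) (auto simp: g_def p'_def algebra_simps)
    qed
    have kgE: "k ` (g ` E) = E" by (auto simp: kg image_iff)
    have 2: "emeasure lebesgue (k ` (g ` E)) \<le> ennreal (1 / q') * emeasure lebesgue (g ` E)"
    proof (rule measure_image_le_slope[OF kmono klip _ gEm])
      show "0 < 1 / q'" using p'q' by auto
      fix y d :: real assume y: "y \<in> g ` E" and d: "0 < d"
      then obtain x where x: "x \<in> E" "y = g x" by blast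
      have pos: "0 < M + c" using M0 by (auto simp: c_def)
      then obtain a b where ab: "a < x" "x < b" "b - a < d / (M + c)" "q * (b - a) < f b - f a"
        using slope_above[OF x(1), of "d / (M + c)"] d by auto
      have "g b - g a \<le> (M + c) * (b - a)" using glip[of b a] ab by auto
      also have "\<dots> < d" using ab(3) pos by (simp add: field_simps)
      finally have "g b - g a < d" .
      moreover have "q' * (b - a) < g b - g a" using ab by (auto simp: g_def q'_def algebra_simps)
      then have "k (g b) - k (g a) < 1 / q' * (g b - g a)" unfolding kg using p'q' by (simp add: field_simps)
      ultimately show "\<exists>a b. a < y \<and> y < b \<and> b - a < d \<and> k b - k a < 1 / q' * (b - a)"
        using x(2) strict_monoD[OF gmono ab(1)] strict_monoD[OF gmono ab(2)] by blast
    qed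
    have m1: "measure lebesgue (g ` E) \<le> p' * measure lebesgue E"
      using 1 Em gEm p'q'(1) by (simp add: emeasure_eq_measure2 ennreal_mult'[symmetric])
    have m2: "measure lebesgue E \<le> 1 / q' * measure lebesgue (g ` E)"
      using 2 Em gEm p'q' unfolding kgE by (simp add: emeasure_eq_measure2 ennreal_mult'[symmetric])
    have "q' * measure lebesgue E \<le> p' * measure lebesgue E"
      using m1 m2 p'q' by (simp add: field_simps)
    then have "measure lebesgue E = 0"
      using p'q' measure_nonneg[of lebesgue E] by (smt (verit, best) mult_right_less_imp_less mult_le_cancel_right)
    then show ?thesis using Em unfolding E_def by (simp add: negligible_iff_measure)
  qed
  have "secant_gap f p q = (\<Union>n. secant_gap f p q \<inter> ball 0 (real n))"
    using reals_Archimedean2 by (auto simp: dist_real_def)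
  then show ?thesis using main negligible_Union_nat[of "\<lambda>n. secant_gap f p q \<inter> ball 0 (real n)"] by simp
qed

text \<open>If no rational gap exists at \<open>x\<close>, the slopes of the small intervals around \<open>x\<close> converge to the supremum
  of their eventual lower bounds. Letting one end point tend to \<open>x\<close> gives the derivative.\<close>

lemma real_differentiable_outside_gaps:
  fixes f :: "real \<Rightarrow> real"
  assumes lip: "\<And>x y. \<bar>f x - f y\<bar> \<le> M * \<bar>x - y\<bar>"
    and out: "\<And>p q. p \<in> \<rat> \<Longrightarrow> q \<in> \<rat> \<Longrightarrow> p < q \<Longrightarrow> x \<notin> secant_gap f p q"
  shows "f differentiable (at x)"
proof -
  have M0: "0 \<le> M" using lip[of 1 0] by (simp add: order_trans[OF abs_ge_zero])
  define S where "S = {p. \<exists>d>0. \<forall>a b. a < x \<and> x < b \<and> b - a < d \<longrightarrow> p * (b - a) \<le> f b - f a}"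
  have inS: "- M \<in> S" unfolding S_def
  proof (clarsimp, intro exI[of _ 1] conjI allI impI)
    fix a b assume "a < x \<and> x < b \<and> b - a < 1"
    then show "- (M * (b - a)) \<le> f b - f a" using lip[of b a] by auto
  qed simp
  have bdd: "p \<le> M" if "p \<in> S" for p
  proof -
    obtain d where d: "0 < d" "\<And>a b. a < x \<and> x < b \<and> b - a < d \<Longrightarrow> p * (b - a) \<le> f b - f a"
      using \<open>p \<in> S\<close> unfolding S_def by blast
    have "p * (d/2) \<le> f (x + d/4) - f (x - d/4)" using d(2)[of "x - d/4" "x + d/4"] d(1) by simp
    also have "\<dots> \<le> M * (d/2)"
    proof -
      have "\<bar>(x + d/4) - (x - d/4)\<bar> = d/2" using d(1) by simp
      then have "\<bar>f (x + d/4) - f (x - d/4)\<bar> \<le> M * (d/2)" using lip[of "x + d/4" "x - d/4"] by (simp only:)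
      then show ?thesis by (rule abs_le_D1)
    qed
    finally show ?thesis using d(1) by (simp add: field_simps)
  qed
  define L where "L = Sup S"
  have bddS: "bdd_above S" using bdd by (auto simp: bdd_above_def)
  have close: "\<exists>d>0. \<forall>a b. a < x \<and> x < b \<and> b - a < d \<longrightarrow> \<bar>f b - f a - L * (b - a)\<bar> \<le> e * (b - a)"
    if e: "0 < e" for e
  proof -
    obtain p where p: "p \<in> S" "L - e < p" using less_cSupD[of S "L - e"] inS e unfolding L_def by auto
    obtain d where d: "0 < d" "\<And>a b. a < x \<and> x < b \<and> b - a < d \<Longrightarrow> p * (b - a) \<le> f b - f a"
      using p(1) unfolding S_def by blast
    obtain q1 where q1: "q1 \<in> \<rat>" "L < q1" "q1 < L + e" using Rats_dense_in_real[of L "L + e"] e by auto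
    obtain q2 where q2: "q2 \<in> \<rat>" "q1 < q2" "q2 < L + e" using Rats_dense_in_real[of q1 "L + e"] q1 by auto
    have "q1 \<notin> S" using q1 cSup_upper[OF _ bddS] unfolding L_def by fastforce
    then have "\<exists>a b. a < x \<and> x < b \<and> b - a < d \<and> f b - f a < q1 * (b - a)" if "0 < d" for d
      unfolding S_def using that by fastforce
    moreover have "\<not> (\<forall>d>0. (\<exists>a b. a < x \<and> x < b \<and> b - a < d \<and> f b - f a < q1 * (b - a)) \<and>
        (\<exists>a b. a < x \<and> x < b \<and> b - a < d \<and> q2 * (b - a) < f b - f a))"
      using out[OF q1(1) q2(1,2)] unfolding secant_gap_def by simp
    ultimately obtain d' where d'0: "0 < d'" and nd': "\<not> (\<exists>a b. a < x \<and> x < b \<and> b - a < d' \<and> q2 * (b - a) < f b - f a)"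
      by meson
    have d': "f b - f a \<le> q2 * (b - a)" if "a < x" "x < b" "b - a < d'" for a b
      using nd' that not_less by blast
    show ?thesis
    proof (rule exI[of _ "min d d'"], intro conjI allI impI)
      fix a b assume ab: "a < x \<and> x < b \<and> b - a < min d d'"
      then have "p * (b - a) \<le> f b - f a" "f b - f a \<le> q2 * (b - a)" using d d' by auto
      moreover have "(L - e) * (b - a) \<le> p * (b - a)" "q2 * (b - a) \<le> (L + e) * (b - a)"
        using p q2 ab by (auto intro: mult_right_mono)
      ultimately show "\<bar>f b - f a - L * (b - a)\<bar> \<le> e * (b - a)" by (auto simp: abs_le_iff algebra_simps)
    qed (use d d'0 in auto)
  qed
  have fc: "continuous_on UNIV f"
    using lip M0 by (intro lipschitz_on_continuous_on[of M] lipschitz_onI) (auto simp: dist_real_def)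
  have lim: "(f \<longlongrightarrow> f x) (at_left x)" "(f \<longlongrightarrow> f x) (at_right x)"
    using fc by (auto simp: continuous_on_def filterlim_at_split)
  have "(f has_derivative (\<lambda>h. L * h)) (at x)"
    unfolding has_derivative_at_alt
  proof (intro conjI allI impI)
    fix e :: real assume "0 < e"
    then obtain d where d: "0 < d" "\<And>a b. a < x \<Longrightarrow> x < b \<Longrightarrow> b - a < d \<Longrightarrow> \<bar>f b - f a - L * (b - a)\<bar> \<le> e * (b - a)"
      using close by blast
    show "\<exists>d>0. \<forall>y. norm (y - x) < d \<longrightarrow> norm (f y - f x - L * (y - x)) \<le> e * norm (y - x)"
    proof (intro exI[of _ "d/2"] conjI allI impI)
      fix y assume y: "norm (y - x) < d/2"
      consider "y = x" | "x < y" | "y < x" by linarith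
      then show "norm (f y - f x - L * (y - x)) \<le> e * norm (y - x)"
      proof cases
        case 2
        have "((\<lambda>a. e * (y - a) - \<bar>f y - f a - L * (y - a)\<bar>) \<longlongrightarrow> e * (y - x) - \<bar>f y - f x - L * (y - x)\<bar>) (at_left x)"
          by (intro tendsto_intros lim)
        moreover have "\<forall>\<^sub>F a in at_left x. 0 \<le> e * (y - a) - \<bar>f y - f a - L * (y - a)\<bar>"
          by (rule eventually_mono[OF eventually_at_left_real[of "x - d/2" x]]) (use y 2 d in \<open>auto simp: abs_if\<close>)
        ultimately have "0 \<le> e * (y - x) - \<bar>f y - f x - L * (y - x)\<bar>"
          by (rule tendsto_lowerbound) auto
        then show ?thesis using 2 by simp
      next
        case 3
        have "((\<lambda>b. e * (b - y) - \<bar>f b - f y - L * (b - y)\<bar>) \<longlongrightarrow> e * (x - y) - \<bar>f x - f y - L * (x - y)\<bar>) (at_right x)"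
          by (intro tendsto_intros lim)
        moreover have "\<forall>\<^sub>F b in at_right x. 0 \<le> e * (b - y) - \<bar>f b - f y - L * (b - y)\<bar>"
          by (rule eventually_mono[OF eventually_at_right_real[of x "x + d/2"]]) (use y 3 d in \<open>auto simp: abs_if\<close>)
        ultimately have "0 \<le> e * (x - y) - \<bar>f x - f y - L * (x - y)\<bar>"
          by (rule tendsto_lowerbound) auto
        moreover have "\<bar>f y - f x - L * (y - x)\<bar> = \<bar>f x - f y - L * (x - y)\<bar>"
          by (simp add: abs_if algebra_simps)
        ultimately show ?thesis using 3 by simp
      qed auto
    qed (use d in auto)
  qed (rule bounded_linear_mult_right)
  then show ?thesis unfolding differentiable_def by blast
qed

text \<open>The one-dimensional Rademacher theorem, from which the limit of the Euler polygons gets its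
  derivative.\<close>

theorem lipschitz_differentiable_ae:
  fixes f :: "real \<Rightarrow> 'a::euclidean_space"
  assumes lip: "\<And>x y. norm (f x - f y) \<le> M * \<bar>x - y\<bar>"
  shows "negligible {x. \<not> f differentiable (at x)}"
proof -
  define R where "R = {(p, q). p \<in> (\<rat>::real set) \<and> q \<in> \<rat> \<and> p < q}"
  have cR: "countable R"
    by (rule countable_subset[of _ "\<rat> \<times> \<rat>"]) (auto simp: R_def countable_rat)
  have lip1: "\<bar>f x \<bullet> i - f y \<bullet> i\<bar> \<le> M * \<bar>x - y\<bar>" if "i \<in> Basis" for i x y
    using order_trans[OF Basis_le_norm[OF that, of "f x - f y"] lip[of x y]] by (simp add: inner_diff_left)
  have "negligible (\<Union>i\<in>Basis. \<Union>r\<in>R. secant_gap (\<lambda>x. f x \<bullet> i) (fst r) (snd r))"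
  proof (rule negligible_Union)
    fix T assume "T \<in> (\<lambda>i. \<Union>r\<in>R. secant_gap (\<lambda>x. f x \<bullet> i) (fst r) (snd r)) ` Basis"
    then obtain i where i: "i \<in> Basis" and T: "T = (\<Union>r\<in>R. secant_gap (\<lambda>x. f x \<bullet> i) (fst r) (snd r))"
      by blast
    show "negligible T" unfolding T
    proof (rule negligible_countable_Union)
      show "countable ((\<lambda>r. secant_gap (\<lambda>x. f x \<bullet> i) (fst r) (snd r)) ` R)" using cR by simp
      fix Q assume "Q \<in> (\<lambda>r. secant_gap (\<lambda>x. f x \<bullet> i) (fst r) (snd r)) ` R"
      then show "negligible Q" using secant_gap_negligible[OF lip1[OF i]] by (auto simp: R_def)
    qed
  qed simp
  moreover have "{x. \<not> f differentiable (at x)} \<subseteq> (\<Union>i\<in>Basis. \<Union>r\<in>R. secant_gap (\<lambda>x. f x \<bullet> i) (fst r) (snd r))"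
  proof (rule subsetI, rule ccontr)
    fix x assume x: "x \<in> {x. \<not> f differentiable (at x)}"
      and "x \<notin> (\<Union>i\<in>Basis. \<Union>r\<in>R. secant_gap (\<lambda>x. f x \<bullet> i) (fst r) (snd r))"
    then have "(\<lambda>x. f x \<bullet> i) differentiable (at x)" if "i \<in> Basis" for i
      using that by (intro real_differentiable_outside_gaps[OF lip1]) (auto simp: R_def)
    then show False using x by (simp add: differentiable_componentwise_within[of f])
  qed
  ultimately show ?thesis by (rule negligible_subset)
qed

section \<open>Existence for differential inclusions\<close>

text \<open>The time spent in the \<open>j\<close>-th step of length \<open>h\<close> up to time \<open>t\<close>. Writing an Euler polygon as a sum of
  ramps times velocities exhibits its increments as weighted sums of velocities.\<close>

definition ramp :: "real \<Rightarrow> nat \<Rightarrow> real \<Rightarrow> real" where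
  "ramp h j t = max 0 (min h (t - real j * h))"

lemma sum_ramp:
  assumes "0 \<le> h" "0 \<le> t"
  shows "(\<Sum>j<n. ramp h j t) = min (real n * h) t"
proof (induction n)
  case (Suc n)
  then show ?case using assms by (auto simp: ramp_def min_def max_def algebra_simps)
qed (use assms in auto)

lemma ramp_at_node:
  assumes "0 \<le> h"
  shows "ramp h i (real j * h) = (if i < j then h else 0)"
proof -
  have eq: "real j * h - real i * h = (real j - real i) * h" by (simp add: algebra_simps)
  show ?thesis
  proof (cases "i < j")
    case True
    then have "1 * h \<le> (real j - real i) * h" using assms by (intro mult_right_mono) auto
    then show ?thesis using True assms by (auto simp: ramp_def eq min_def max_def)
  next
    case False
    then have "(real j - real i) * h \<le> 0" using assms by (intro mult_nonpos_nonneg) auto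
    then show ?thesis using False assms by (auto simp: ramp_def eq min_def max_def)
  qed
qed

definition polygon :: "'a::real_vector \<Rightarrow> nat \<Rightarrow> real \<Rightarrow> (nat \<Rightarrow> 'a) \<Rightarrow> real \<Rightarrow> 'a" where
  "polygon x n h v t = x + (\<Sum>j<n. ramp h j t *\<^sub>R v j)"

text \<open>The slope of a secant is a convex combination of the velocities of the steps that meet the time
  interval: the weights are the increments of the ramps, which add up to \<open>t - s\<close>.\<close>

lemma polygon_secant_in_convex:
  assumes C: "convex C" and h: "0 < h" and st: "0 \<le> s" "s < t" "t \<le> real n * h"
    and v: "\<And>j. j < n \<Longrightarrow> s < real (Suc j) * h \<Longrightarrow> real j * h < t \<Longrightarrow> v j \<in> C"
  shows "(1 / (t - s)) *\<^sub>R (polygon x n h v t - polygon x n h v s) \<in> C"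
proof -
  define w where "w j = ramp h j t - ramp h j s" for j
  define J where "J = {j. j < n \<and> w j \<noteq> 0}"
  have w0: "0 \<le> w j" for j using st by (auto simp: w_def ramp_def min_def max_def)
  have fin: "finite J" by (auto simp: J_def)
  have "(\<Sum>j<n. w j) = t - s"
    using st h by (simp add: w_def sum_subtractf sum_ramp)
  moreover have sJ: "(\<Sum>j<n. w j) = (\<Sum>j\<in>J. w j)"
    by (intro sum.mono_neutral_right) (auto simp: J_def)
  ultimately have sum1: "(\<Sum>j\<in>J. w j / (t - s)) = 1"
    using st by (simp flip: sum_divide_distrib)
  have vJ: "v j \<in> C" if "j \<in> J" for j
  proof (rule v)
    show "j < n" using that by (auto simp: J_def)
    have wj: "w j \<noteq> 0" using that by (auto simp: J_def)
    show "s < real (Suc j) * h"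
    proof (rule ccontr)
      assume "\<not> ?thesis"
      then have "h \<le> s - real j * h" "h \<le> t - real j * h" using st by (auto simp: algebra_simps)
      then show False using wj h by (auto simp: w_def ramp_def)
    qed
    show "real j * h < t"
    proof (rule ccontr)
      assume "\<not> ?thesis"
      then have "t - real j * h \<le> 0" "s - real j * h \<le> 0" using st by auto
      then show False using wj h by (auto simp: w_def ramp_def)
    qed
  qed
  have "(\<Sum>j\<in>J. (w j / (t - s)) *\<^sub>R v j) \<in> C"
    using fin C sum1 w0 st vJ by (intro convex_sum) auto
  also have "(\<Sum>j\<in>J. (w j / (t - s)) *\<^sub>R v j) = (\<Sum>j<n. (w j / (t - s)) *\<^sub>R v j)"
    by (intro sum.mono_neutral_left) (auto simp: J_def)
  also have "\<dots> = (1 / (t - s)) *\<^sub>R (polygon x n h v t - polygon x n h v s)"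
    by (simp add: polygon_def w_def scaleR_sum_right sum_subtractf[symmetric] scaleR_left_diff_distrib[symmetric])
  finally show ?thesis .
qed

text \<open>All velocities lie in the ball of radius \<open>M\<close>, so all slopes of secants do.\<close>

lemma polygon_lipschitz:
  fixes v :: "nat \<Rightarrow> 'a::real_normed_vector"
  assumes h: "0 < h" and s: "s \<in> {0..real n * h}" and t: "t \<in> {0..real n * h}"
    and v: "\<And>j. j < n \<Longrightarrow> norm (v j) \<le> M"
  shows "norm (polygon x n h v s - polygon x n h v t) \<le> M * \<bar>s - t\<bar>"
proof -
  have *: "norm (polygon x n h v t - polygon x n h v s) \<le> M * (t - s)"
    if "0 \<le> s" "s < t" "t \<le> real n * h" for s t
  proof -
    have "(1 / (t - s)) *\<^sub>R (polygon x n h v t - polygon x n h v s) \<in> cball 0 M"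
      using that v by (intro polygon_secant_in_convex h) auto
    then show ?thesis using that by (simp add: pos_divide_le_eq)
  qed
  consider "s < t" | "s = t" | "t < s" by linarith
  then show ?thesis
    using *[of s t] *[of t s] s t by cases (auto simp: norm_minus_commute)
qed

lemma polygon_at_node:
  assumes "0 \<le> h" "j \<le> n"
  shows "polygon x n h v (real j * h) = x + (\<Sum>i<j. h *\<^sub>R v i)"
proof -
  have "(\<Sum>i<n. ramp h i (real j * h) *\<^sub>R v i) = (\<Sum>i<n. if i \<in> {..<j} then h *\<^sub>R v i else 0)"
    using assms by (intro sum.cong) (auto simp: ramp_at_node)
  also have "\<dots> = (\<Sum>i\<in>{..<n} \<inter> {..<j}. h *\<^sub>R v i)"
    by (simp add: sum.inter_restrict)
  also have "{..<n} \<inter> {..<j} = {..<j}" using assms by auto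
  finally show ?thesis by (simp add: polygon_def)
qed

text \<open>The time horizon \<open>n * h\<close> is short enough for the nodes not to leave the ball, so that a velocity can be
  selected at each of them.\<close>

lemma euler_polygon_exists:
  fixes S :: "'a::real_normed_vector \<Rightarrow> 'a set"
  assumes ne: "\<And>x. x \<in> cball x0 r \<Longrightarrow> S x \<noteq> {}"
    and bd: "\<And>x v. x \<in> cball x0 r \<Longrightarrow> v \<in> S x \<Longrightarrow> norm v \<le> M"
    and h: "0 < h" "M * (real n * h) \<le> r" and M: "0 < M"
  obtains v where "\<And>j. j \<le> n \<Longrightarrow> polygon x0 n h v (real j * h) \<in> cball x0 r"
    "\<And>j. j < n \<Longrightarrow> v j \<in> S (polygon x0 n h v (real j * h))"
proof -
  define s where "s x = (SOME v. v \<in> S x)" for x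
  have s: "s x \<in> S x" if "x \<in> cball x0 r" for x
    using ne[OF that] unfolding s_def by (simp add: some_in_eq)
  define p where "p j = ((\<lambda>x. x + h *\<^sub>R s x) ^^ j) x0" for j
  have p_Suc: "p (Suc j) = p j + h *\<^sub>R s (p j)" for j by (simp add: p_def)
  have p_in: "norm (p j - x0) \<le> M * (real j * h)" if "j \<le> n" for j
    using that
  proof (induction j)
    case (Suc j)
    have "M * (real j * h) \<le> M * (real n * h)"
      using Suc.prems h M by (intro mult_left_mono mult_right_mono) auto
    then have "p j \<in> cball x0 r" using Suc h by (auto simp: dist_norm norm_minus_commute)
    then have sM: "norm (s (p j)) \<le> M" using s bd by blast
    have "norm (p (Suc j) - x0) = norm ((p j - x0) + h *\<^sub>R s (p j))" by (simp add: p_Suc algebra_simps)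
    also have "\<dots> \<le> M * (real j * h) + h * M"
      using Suc sM h by (intro order_trans[OF norm_triangle_ineq] add_mono) auto
    finally show ?case by (simp add: algebra_simps)
  qed (simp add: p_def)
  have cb: "p j \<in> cball x0 r" if "j \<le> n" for j
  proof -
    have "M * (real j * h) \<le> M * (real n * h)"
      using that h M by (intro mult_left_mono mult_right_mono) auto
    then show ?thesis using p_in[OF that] h by (auto simp: dist_norm norm_minus_commute)
  qed
  have p_sum: "p j = x0 + (\<Sum>i<j. h *\<^sub>R s (p i))" for j
    by (induction j) (simp_all add: p_Suc, simp add: p_def)
  have node: "polygon x0 n h (\<lambda>i. s (p i)) (real j * h) = p j" if "j \<le> n" for j
    using polygon_at_node[of h j n x0 "\<lambda>i. s (p i)"] that h p_sum[of j] by simp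
  show ?thesis
    by (rule that[of "\<lambda>i. s (p i)"]) (use node cb s in auto)
qed

theorem differential_inclusion_exists:
  fixes S :: "'a::euclidean_space \<Rightarrow> 'a set"
  assumes r: "0 < r" and M: "0 < M"
    and ne: "\<And>x. x \<in> cball x0 r \<Longrightarrow> S x \<noteq> {}"
    and cpt: "\<And>x. x \<in> cball x0 r \<Longrightarrow> compact (S x)"
    and bd: "\<And>x v. x \<in> cball x0 r \<Longrightarrow> v \<in> S x \<Longrightarrow> norm v \<le> M"
    and usc: "\<And>x e. x \<in> cball x0 r \<Longrightarrow> 0 < e \<Longrightarrow>
       \<exists>d>0. \<forall>y\<in>cball x0 r. dist y x < d \<longrightarrow> (\<forall>w\<in>S y. \<exists>v\<in>S x. dist v w \<le> e)"
  obtains X where "X 0 = x0" "\<And>s t. norm (X s - X t) \<le> M * \<bar>s - t\<bar>"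
    "\<And>t. X t \<in> cball x0 r"
    "negligible {t \<in> {0..r / M}. \<not> (\<exists>v\<in>convex hull S (X t). (X has_vector_derivative v) (at t))}"
proof -
  define T where "T = r / M"
  have T: "0 < T" using r M by (simp add: T_def)
  define h where "h n = T / real (Suc n)" for n
  have h: "0 < h n" "real (Suc n) * h n = T" for n using T by (auto simp: h_def)
  have "\<exists>v. (\<forall>j\<le>Suc n. polygon x0 (Suc n) (h n) v (real j * h n) \<in> cball x0 r) \<and>
      (\<forall>j<Suc n. v j \<in> S (polygon x0 (Suc n) (h n) v (real j * h n)))" for n
  proof -
    have "M * (real (Suc n) * h n) \<le> r" using h M by (simp add: T_def)
    then obtain v where "\<And>j. j \<le> Suc n \<Longrightarrow> polygon x0 (Suc n) (h n) v (real j * h n) \<in> cball x0 r"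
      "\<And>j. j < Suc n \<Longrightarrow> v j \<in> S (polygon x0 (Suc n) (h n) v (real j * h n))"
      using euler_polygon_exists[of x0 r S M "h n" "Suc n"] ne bd h(1) M by blast
    then show ?thesis by blast
  qed
  then obtain v where
    v1: "\<And>n j. j \<le> Suc n \<Longrightarrow> polygon x0 (Suc n) (h n) (v n) (real j * h n) \<in> cball x0 r" and
    v2: "\<And>n j. j < Suc n \<Longrightarrow> v n j \<in> S (polygon x0 (Suc n) (h n) (v n) (real j * h n))"
    by (metis (no_types))
  define P where "P n = polygon x0 (Suc n) (h n) (v n)" for n
  have vM: "norm (v n j) \<le> M" if "j < Suc n" for n j
    using bd[OF v1 v2[OF that]] that by simp
  have Plip: "norm (P n s - P n t) \<le> M * \<bar>s - t\<bar>" if "s \<in> {0..T}" "t \<in> {0..T}" for n s t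
    unfolding P_def using that vM by (intro polygon_lipschitz) (auto simp only: h)
  have P0: "P n 0 = x0" for n using polygon_at_node[of "h n" 0 "Suc n" x0 "v n"] h(1)[of n] by (simp add: P_def)
  have Pin: "P n t \<in> cball x0 r" if "t \<in> {0..T}" for n t
  proof -
    have "norm (P n t - P n 0) \<le> M * \<bar>t - 0\<bar>" using that T by (intro Plip) auto
    also have "\<dots> \<le> M * T" using that M by (intro mult_left_mono) auto
    also have "M * T = r" using M by (simp add: T_def)
    finally show ?thesis by (simp add: P0 dist_norm norm_minus_commute)
  qed
  obtain g k where k: "strict_mono (k :: nat \<Rightarrow> nat)"
    and conv: "\<And>e. 0 < e \<Longrightarrow> \<exists>N. \<forall>n x. n \<ge> N \<and> x \<in> {0..T} \<longrightarrow> norm (P (k n) x - g x) < e"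
  proof (rule Arzela_Ascoli[of "{0..T}" P "norm x0 + r"])
    show "norm (P n t) \<le> norm x0 + r" if "t \<in> {0..T}" for n t
      using Pin[OF that, of n] norm_triangle_ineq2[of "P n t" x0] by (simp add: dist_norm norm_minus_commute)
    fix t e :: real assume t: "t \<in> {0..T}" and e: "0 < e"
    show "\<exists>d>0. \<forall>n s. s \<in> {0..T} \<and> norm (t - s) < d \<longrightarrow> norm (P n t - P n s) < e"
    proof (intro exI[of _ "e / M"] conjI allI impI)
      fix n s assume s: "s \<in> {0..T} \<and> norm (t - s) < e / M"
      have "norm (P n t - P n s) \<le> M * \<bar>t - s\<bar>" using t s by (intro Plip) auto
      also have "\<dots> < e" using s M by (simp add: field_simps)
      finally show "norm (P n t - P n s) < e" .
    qed (use e M in auto)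
  qed auto
  have lim: "(\<lambda>n. P (k n) t) \<longlonglongrightarrow> g t" if "t \<in> {0..T}" for t
    unfolding LIMSEQ_iff using conv that by meson
  have glip: "norm (g s - g t) \<le> M * \<bar>s - t\<bar>" if "s \<in> {0..T}" "t \<in> {0..T}" for s t
    by (rule Lim_bounded[OF tendsto_norm[OF tendsto_diff[OF lim[OF that(1)] lim[OF that(2)]]]])
      (use Plip[OF that] in auto)
  have gin: "g t \<in> cball x0 r" if "t \<in> {0..T}" for t
    by (rule closed_sequentially[OF closed_cball _ lim[OF that]]) (use Pin[OF that] in auto)
  have g0: "g 0 = x0" using lim[of 0] T P0 by (simp add: LIMSEQ_const_iff)
  \<comment> \<open>freezing \<open>g\<close> outside \<open>{0..T}\<close> gives a globally Lipschitz curve\<close>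
  define cl where "cl t = max 0 (min T t)" for t
  have cl: "cl t \<in> {0..T}" for t using T by (auto simp: cl_def)
  define X where "X t = g (cl t)" for t
  have XT: "X t = g t" if "t \<in> {0..T}" for t using that by (auto simp: X_def cl_def)
  have Xlip: "norm (X s - X t) \<le> M * \<bar>s - t\<bar>" for s t
  proof -
    have "\<bar>cl s - cl t\<bar> \<le> \<bar>s - t\<bar>" using T by (auto simp: cl_def min_def max_def)
    then show ?thesis unfolding X_def using M by (intro order_trans[OF glip[OF cl cl]] mult_left_mono) auto
  qed
  have hull: "V \<in> convex hull S (X t)" if t: "t \<in> {0<..<T}" and V: "(X has_vector_derivative V) (at t)" for t V
  proof -
    have t': "t \<in> {0..T}" using t by auto
    define H where "H = convex hull S (g t)"
    have H: "compact H" "convex H" using cpt[OF gin[OF t']] by (auto simp: H_def compact_convex_hull)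
    have "\<exists>a\<in>H. dist a V \<le> e" if e: "0 < e" for e
    proof -
      \<comment> \<open>the closed \<open>e\<close>-neighbourhood of \<open>H\<close>, convex as a Minkowski sum\<close>
      define C where "C = (\<Union>x\<in>H. \<Union>y\<in>cball 0 e. {x + y})"
      have C: "convex C" "closed C"
        unfolding C_def using H by (auto intro!: convex_sums compact_imp_closed compact_sums')
      obtain d where d: "0 < d" and dS: "\<And>y w. y \<in> cball x0 r \<Longrightarrow> dist y (g t) < d \<Longrightarrow> w \<in> S y \<Longrightarrow> \<exists>v\<in>S (g t). dist v w \<le> e"
        using usc[OF gin[OF t'] e] by blast
      \<comment> \<open>the distance \<open>d\<close> is split in three: step size, time increment, and distance to the limit\<close>
      define \<delta> where "\<delta> = min (T - t) (d / (3 * M))"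
      have \<delta>: "0 < \<delta>" using t d M by (auto simp: \<delta>_def)
      have sec: "(1 / (s - t)) *\<^sub>R (g s - g t) \<in> C" if s: "t < s" "s < t + \<delta>" for s
      proof -
        have sT: "s \<in> {0..T}" using s t by (auto simp: \<delta>_def)
        have hl: "(\<lambda>n. h (k n)) \<longlonglongrightarrow> 0"
        proof -
          have "h \<longlonglongrightarrow> 0" unfolding h_def by (rule LIMSEQ_Suc[OF lim_const_over_n])
          then show ?thesis using LIMSEQ_subseq_LIMSEQ[OF _ k, of h 0] by (simp add: o_def)
        qed
        then have e1: "\<forall>\<^sub>F n in sequentially. h (k n) < d / (3 * M)"
          using d M by (intro order_tendstoD) auto
        have e2: "\<forall>\<^sub>F n in sequentially. dist (P (k n) t) (g t) < d / 3"
          using lim[OF t'] d by (intro tendstoD) auto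
        have ev: "\<forall>\<^sub>F n in sequentially. (1 / (s - t)) *\<^sub>R (P (k n) s - P (k n) t) \<in> C"
          using e1 e2
        proof eventually_elim
          case (elim n)
          show ?case unfolding P_def
          proof (rule polygon_secant_in_convex[OF C(1) h(1)])
            show "0 \<le> t" "t < s" using t s by auto
            show "s \<le> real (Suc (k n)) * h (k n)" using sT by (simp only: h) simp
            fix j assume j: "j < Suc (k n)" "t < real (Suc j) * h (k n)" "real j * h (k n) < s"
            have "real j * h (k n) \<le> real (Suc (k n)) * h (k n)"
              using j h(1)[of "k n"] by (intro mult_right_mono) auto
            then have jT: "real j * h (k n) \<in> {0..T}" using h[of "k n"] by auto
            have "\<bar>real j * h (k n) - t\<bar> \<le> h (k n) + (s - t)"
              using j s h(1)[of "k n"] by (auto simp: abs_if algebra_simps)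
            also have "\<dots> < d / (3 * M) + d / (3 * M)" using elim s by (auto simp: \<delta>_def)
            finally have jt: "\<bar>real j * h (k n) - t\<bar> < 2 * d / (3 * M)" by simp
            have "norm (P (k n) (real j * h (k n)) - P (k n) t) \<le> M * \<bar>real j * h (k n) - t\<bar>"
              by (rule Plip[OF jT t'])
            also have "\<dots> < M * (2 * d / (3 * M))" using jt M by (intro mult_strict_left_mono) auto
            also have "\<dots> = 2 * d / 3" using M by simp
            finally have "dist (P (k n) (real j * h (k n))) (P (k n) t) < 2 * d / 3" by (simp add: dist_norm)
            then have close: "dist (P (k n) (real j * h (k n))) (g t) < d"
              using elim(2) dist_triangle[of "P (k n) (real j * h (k n))" "g t" "P (k n) t"] by linarith
            obtain u where u: "u \<in> S (g t)" "dist u (v (k n) j) \<le> e"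
              using dS[OF _ close] v1[of j "k n"] v2[OF j(1)] j(1) unfolding P_def by auto
            have "u \<in> H" using u(1) unfolding H_def by (rule hull_inc)
            moreover have "v (k n) j - u \<in> cball 0 e" using u(2) by (simp add: dist_norm norm_minus_commute)
            ultimately show "v (k n) j \<in> C" unfolding C_def by force
          qed
        qed
        have "(\<lambda>n. (1 / (s - t)) *\<^sub>R (P (k n) s - P (k n) t)) \<longlonglongrightarrow> (1 / (s - t)) *\<^sub>R (g s - g t)"
          by (intro tendsto_intros lim sT t')
        then show ?thesis using Lim_in_closed_set[OF C(2) ev] by simp
      qed
      have "((\<lambda>s. (1 / (s - t)) *\<^sub>R (X s - X t)) \<longlongrightarrow> V) (at_right t)"
      proof (rule filterlim_mono[OF _ order_refl at_le])
        have "((\<lambda>s. (1 / norm (s - t)) *\<^sub>R (X s - X t)) \<longlongrightarrow> V) (at_right t)"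
        proof -
          have "(X has_vector_derivative V) (at t within {t<..})" using V has_vector_derivative_at_within by blast
          then have "((\<lambda>s. (1 / norm (s - t)) *\<^sub>R (X s - (X t + (s - t) *\<^sub>R V))) \<longlongrightarrow> 0) (at_right t)"
            unfolding has_vector_derivative_def has_derivative_within by simp
          then have "((\<lambda>s. (1 / norm (s - t)) *\<^sub>R (X s - (X t + (s - t) *\<^sub>R V)) + V) \<longlongrightarrow> 0 + V) (at_right t)"
            by (intro tendsto_add tendsto_const)
          moreover have "\<forall>\<^sub>F s in at_right t. (1 / norm (s - t)) *\<^sub>R (X s - (X t + (s - t) *\<^sub>R V)) + V = (1 / norm (s - t)) *\<^sub>R (X s - X t)"
            using eventually_at_right_less[of t]
            by eventually_elim (simp add: scaleR_diff_right scaleR_add_right)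
          ultimately show ?thesis by (simp add: tendsto_cong)
        qed
        then show "((\<lambda>s. (1 / (s - t)) *\<^sub>R (X s - X t)) \<longlongrightarrow> V) (at_right t)"
          by (rule Lim_transform_eventually) (use eventually_at_right_less[of t] in \<open>eventually_elim, simp\<close>)
      qed auto
      moreover have "\<forall>\<^sub>F s in at_right t. (1 / (s - t)) *\<^sub>R (X s - X t) \<in> C"
      proof (rule eventually_mono[OF eventually_at_right_real[of t "t + \<delta>"]])
        fix s assume "s \<in> {t<..<t + \<delta>}"
        then show "(1 / (s - t)) *\<^sub>R (X s - X t) \<in> C" using sec[of s] t by (auto simp: XT \<delta>_def)
      qed (use \<delta> in auto)
      ultimately have "V \<in> C" using Lim_in_closed_set[OF C(2)] by fastforce
      then obtain a y where "a \<in> H" "y \<in> cball 0 e" "V = a + y" unfolding C_def by blast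
      then show ?thesis by (intro bexI[of _ a]) (auto simp: dist_norm)
    qed
    then have "V \<in> closure H"
      unfolding closure_approachable by (meson dense le_less_trans)
    then show ?thesis using H(1) XT[OF t'] by (simp add: H_def compact_imp_closed)
  qed
  have "negligible ({0, T} \<union> {t. \<not> X differentiable (at t)})"
    using lipschitz_differentiable_ae[OF Xlip] by auto
  moreover have "{t \<in> {0..T}. \<not> (\<exists>v\<in>convex hull S (X t). (X has_vector_derivative v) (at t))} \<subseteq> {0, T} \<union> {t. \<not> X differentiable (at t)}"
  proof
    fix t assume t: "t \<in> {t \<in> {0..T}. \<not> (\<exists>v\<in>convex hull S (X t). (X has_vector_derivative v) (at t))}"
    show "t \<in> {0, T} \<union> {t. \<not> X differentiable (at t)}"
    proof (rule ccontr)
      assume n: "t \<notin> {0, T} \<union> {t. \<not> X differentiable (at t)}"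
      then have "(X has_vector_derivative vector_derivative X (at t)) (at t)"
        by (simp add: vector_derivative_works)
      then show False using hull[of t "vector_derivative X (at t)"] n t by auto
    qed
  qed
  ultimately have neg: "negligible {t \<in> {0..T}. \<not> (\<exists>v\<in>convex hull S (X t). (X has_vector_derivative v) (at t))}"
    by (rule negligible_subset)
  show ?thesis
  proof (rule that)
    show "X 0 = x0" using XT[of 0] T g0 by simp
    show "X t \<in> cball x0 r" for t using gin[OF cl] by (simp add: X_def)
  qed (use Xlip neg in \<open>auto simp: T_def\<close>)
qed

text \<open>Backward solutions are forward solutions of the inclusion with the opposite velocities, run in
  reverse; the two halves are glued at time \<open>0\<close>.\<close>

lemma two_sided_inclusion_exists:
  fixes S :: "'a::euclidean_space \<Rightarrow> 'a set"
  assumes r: "0 < r" and M: "0 < M"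
    and ne: "\<And>x. x \<in> cball x0 r \<Longrightarrow> S x \<noteq> {}"
    and cpt: "\<And>x. x \<in> cball x0 r \<Longrightarrow> compact (S x)"
    and bd: "\<And>x v. x \<in> cball x0 r \<Longrightarrow> v \<in> S x \<Longrightarrow> norm v \<le> M"
    and usc: "\<And>x e. x \<in> cball x0 r \<Longrightarrow> 0 < e \<Longrightarrow>
       \<exists>d>0. \<forall>y\<in>cball x0 r. dist y x < d \<longrightarrow> (\<forall>w\<in>S y. \<exists>v\<in>S x. dist v w \<le> e)"
  obtains X where "X 0 = x0" "\<And>s t. norm (X s - X t) \<le> M * \<bar>s - t\<bar>"
    "\<And>t. X t \<in> cball x0 r"
    "negligible {t \<in> {- (r / M)..r / M}. \<not> (\<exists>v\<in>convex hull S (X t). (X has_vector_derivative v) (at t))}"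
proof -
  obtain X where X: "X 0 = x0" "\<And>s t. norm (X s - X t) \<le> M * \<bar>s - t\<bar>" "\<And>t. X t \<in> cball x0 r"
    "negligible {t \<in> {0..r / M}. \<not> (\<exists>v\<in>convex hull S (X t). (X has_vector_derivative v) (at t))}"
    by (rule differential_inclusion_exists[OF r M, of x0 S]) ((rule ne cpt bd usc; assumption) | blast)+
  have usc': "\<exists>d>0. \<forall>y\<in>cball x0 r. dist y x < d \<longrightarrow> (\<forall>w\<in>uminus ` S y. \<exists>v\<in>uminus ` S x. dist v w \<le> e)"
    if x: "x \<in> cball x0 r" and e: "0 < e" for x e
    using usc[OF x e] by (simp add: dist_minus)
  have ne': "uminus ` S x \<noteq> {}" and cpt': "compact (uminus ` S x)" if "x \<in> cball x0 r" for x
    using ne[OF that] cpt[OF that] by (auto intro: compact_negations)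
  have bd': "norm v \<le> M" if "x \<in> cball x0 r" "v \<in> uminus ` S x" for x v
    using bd[OF that(1)] that(2) by auto
  obtain Y where Y: "Y 0 = x0" "\<And>s t. norm (Y s - Y t) \<le> M * \<bar>s - t\<bar>" "\<And>t. Y t \<in> cball x0 r"
    "negligible {t \<in> {0..r / M}. \<not> (\<exists>v\<in>convex hull (uminus ` S (Y t)). (Y has_vector_derivative v) (at t))}"
    by (rule differential_inclusion_exists[OF r M, of x0 "\<lambda>x. uminus ` S x"]) ((rule ne' cpt' bd' usc'; assumption) | blast)+
  define Z where "Z t = (if 0 \<le> t then X t else Y (- t))" for t
  let ?NX = "{t \<in> {0..r / M}. \<not> (\<exists>v\<in>convex hull S (X t). (X has_vector_derivative v) (at t))}"
  let ?NY = "{t \<in> {0..r / M}. \<not> (\<exists>v\<in>convex hull (uminus ` S (Y t)). (Y has_vector_derivative v) (at t))}"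
  have lip: "norm (Z s - Z t) \<le> M * \<bar>s - t\<bar>" for s t
  proof -
    have mixed: "norm (X s - Y (- t)) \<le> M * \<bar>s - t\<bar>" if "0 \<le> s" "t < 0" for s t
    proof -
      have "norm (X s - Y (- t)) \<le> norm (X s - X 0) + norm (Y 0 - Y (- t))"
        using norm_triangle_ineq[of "X s - X 0" "Y 0 - Y (- t)"] by (simp add: X(1) Y(1))
      also have "\<dots> \<le> M * \<bar>s - 0\<bar> + M * \<bar>0 - - t\<bar>" by (intro add_mono X(2) Y(2))
      also have "\<dots> = M * \<bar>s - t\<bar>" using that by (simp add: algebra_simps)
      finally show ?thesis .
    qed
    show ?thesis
      using X(2)[of s t] Y(2)[of "- s" "- t"] mixed[of s t] mixed[of t s]
      by (auto simp: Z_def norm_minus_commute abs_minus_commute)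
  qed
  have "negligible (uminus ` ?NY)"
  proof (rule negligible_locally_Lipschitz_image[OF _ Y(4)])
    show "\<exists>T B. open T \<and> t \<in> T \<and> (\<forall>s\<in>?NY \<inter> T. norm (- s - - t) \<le> B * norm (s - t))" for t
      by (intro exI[of _ UNIV] exI[of _ 1]) auto
  qed simp
  then have "negligible (?NX \<union> uminus ` ?NY \<union> {0})" using X(4) by simp
  moreover have "{t \<in> {- (r / M)..r / M}. \<not> (\<exists>v\<in>convex hull S (Z t). (Z has_vector_derivative v) (at t))} \<subseteq> ?NX \<union> uminus ` ?NY \<union> {0}"
  proof (rule subsetI, rule ccontr)
    fix t assume t: "t \<in> {t \<in> {- (r / M)..r / M}. \<not> (\<exists>v\<in>convex hull S (Z t). (Z has_vector_derivative v) (at t))}"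
      and n: "t \<notin> ?NX \<union> uminus ` ?NY \<union> {0}"
    have "\<exists>v\<in>convex hull S (Z t). (Z has_vector_derivative v) (at t)"
    proof (cases "0 < t")
      case True
      then obtain v where v: "v \<in> convex hull S (X t)" "(X has_vector_derivative v) (at t)"
        using t n by auto
      have "(Z has_vector_derivative v) (at t)"
        by (rule has_vector_derivative_transform_within_open[OF v(2), of "{0<..}"]) (use True in \<open>auto simp: Z_def\<close>)
      then show ?thesis using v(1) True by (auto simp: Z_def)
    next
      case False
      then have t0: "t < 0" using n by auto
      have "- t \<notin> ?NY" using n by (metis (no_types, lifting) UnI1 UnI2 add.inverse_inverse imageI)
      then obtain v where v: "v \<in> convex hull (uminus ` S (Y (- t)))" "(Y has_vector_derivative v) (at (- t))"
        using t t0 by auto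
      have "(uminus has_vector_derivative - 1) (at t)" by (auto intro!: derivative_eq_intros)
      then have "((\<lambda>s. Y (- s)) has_vector_derivative - v) (at t)"
        using vector_diff_chain_at[of uminus "- 1" t Y v] v(2) by (simp add: o_def)
      then have "(Z has_vector_derivative - v) (at t)"
        by (rule has_vector_derivative_transform_within_open[of _ _ _ "{..<0}"]) (use t0 in \<open>auto simp: Z_def\<close>)
      moreover have "- v \<in> convex hull S (Z t)"
      proof -
        have "convex hull (uminus ` S (Y (- t))) = uminus ` (convex hull S (Y (- t)))"
          by (rule convex_hull_linear_image[symmetric]) (simp add: linear_uminus)
        then show ?thesis using v(1) t0 by (auto simp: Z_def)
      qed
      ultimately show ?thesis by blast
    qed
    then show False using t by blast
  qed
  ultimately have neg: "negligible {t \<in> {- (r / M)..r / M}. \<not> (\<exists>v\<in>convex hull S (Z t). (Z has_vector_derivative v) (at t))}"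
    by (rule negligible_subset)
  show ?thesis
  proof (rule that[OF _ lip _ neg])
    show "Z 0 = x0" by (simp add: Z_def X(1))
    show "Z t \<in> cball x0 r" for t using X(3) Y(3) by (simp add: Z_def del: mem_cball)
  qed
qed

lemma lipschitz_absolutely_continuous:
  fixes f :: "real \<Rightarrow> 'a::real_normed_vector"
  assumes lip: "\<And>s t. norm (f s - f t) \<le> M * \<bar>s - t\<bar>"
  shows "absolutely_continuous_fun_on I f"
  unfolding absolutely_continuous_fun_on_def
proof (intro allI impI)
  fix \<epsilon> :: real assume \<epsilon>: "0 < \<epsilon>"
  have M: "0 \<le> M" using order_trans[OF norm_ge_zero lip[of 1 0]] by simp
  show "\<exists>\<delta>>0. \<forall>P. P division_of \<Union>P \<and> \<Union>P \<subseteq> I \<and> (\<Sum>K\<in>P. Sup K - Inf K) < \<delta> \<longrightarrow>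
      (\<Sum>K\<in>P. norm (f (Sup K) - f (Inf K))) < \<epsilon>"
  proof (rule exI[of _ "\<epsilon> / (M + 1)"], intro conjI allI impI)
    show "0 < \<epsilon> / (M + 1)" using \<epsilon> M by simp
    fix P :: "real set set"
    assume P: "P division_of \<Union>P \<and> \<Union>P \<subseteq> I \<and> (\<Sum>K\<in>P. Sup K - Inf K) < \<epsilon> / (M + 1)"
    have ord: "Inf K \<le> Sup K" if K: "K \<in> P" for K
    proof -
      obtain a b where "K = cbox a b" "K \<noteq> {}" using division_ofD(3,4)[of P "\<Union>P" K] P K by meson
      then show ?thesis by auto
    qed
    have "(\<Sum>K\<in>P. norm (f (Sup K) - f (Inf K))) \<le> (\<Sum>K\<in>P. M * (Sup K - Inf K))"
    proof (rule sum_mono)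
      fix K assume "K \<in> P"
      then show "norm (f (Sup K) - f (Inf K)) \<le> M * (Sup K - Inf K)"
        using lip[of "Sup K" "Inf K"] ord[of K] by simp
    qed
    also have "\<dots> = M * (\<Sum>K\<in>P. Sup K - Inf K)" by (simp add: sum_distrib_left)
    also have "\<dots> \<le> (M + 1) * (\<Sum>K\<in>P. Sup K - Inf K)"
      using ord by (intro mult_right_mono sum_nonneg) auto
    also have "\<dots> < (M + 1) * (\<epsilon> / (M + 1))" using P M by (intro mult_strict_left_mono) auto
    also have "\<dots> = \<epsilon>" using M by simp
    finally show "(\<Sum>K\<in>P. norm (f (Sup K) - f (Inf K))) < \<epsilon>" .
  qed
qed

lemma inclusion_solution_intro:
  fixes X :: "real \<Rightarrow> 'a::euclidean_space"
  assumes lip: "\<And>s t. norm (X s - X t) \<le> M * \<bar>s - t\<bar>"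
    and D: "\<And>t. t \<in> {a..b} \<Longrightarrow> X t \<in> D"
    and neg: "negligible {t \<in> {a..b}. \<not> (\<exists>v\<in>\<Phi> (X t). (X has_vector_derivative v) (at t))}"
  shows "inclusion_solution D \<Phi> {a..b} X"
  unfolding inclusion_solution_def
proof (intro conjI ballI)
  show "absolutely_continuous_fun_on {a..b} X" using lip by (rule lipschitz_absolutely_continuous)
  show "X t \<in> D" if "t \<in> {a..b}" for t using that by (rule D)
  have "AE t in lebesgue. t \<in> {a..b} \<longrightarrow> (\<exists>v\<in>\<Phi> (X t). (X has_vector_derivative v) (at t within {a..b}))"
    by (rule AE_I'[OF neg[unfolded negligible_iff_null_sets]])
      (auto intro: has_vector_derivative_at_within)
  then show "AE t in lebesgue_on {a..b}. \<exists>v\<in>\<Phi> (X t). (X has_vector_derivative v) (at t within {a..b})"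
    by (subst AE_restrict_space_iff) auto
qed

section \<open>Gradients and second derivatives\<close>

text \<open>In a Euclidean space every derivative is represented by a vector, so that the description in the
  definition of \<open>grad\<close> is proper.\<close>

lemma GDERIV_grad:
  fixes u :: "'a::euclidean_space \<Rightarrow> real"
  assumes "u differentiable (at x)"
  shows "GDERIV u x :> grad u x"
proof -
  obtain u' where u': "(u has_derivative u') (at x)" using assms by (auto simp: differentiable_def)
  define D where "D = (\<Sum>b\<in>Basis. u' b *\<^sub>R b)"
  have "u' v = v \<bullet> D" for v
  proof -
    have "u' v = u' (\<Sum>b\<in>Basis. (v \<bullet> b) *\<^sub>R b)" by (simp add: euclidean_representation)
    also have "\<dots> = (\<Sum>b\<in>Basis. (v \<bullet> b) * u' b)"
      using has_derivative_linear[OF u'] by (simp add: linear_sum linear_scale)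
    finally show ?thesis by (simp add: D_def inner_sum_right mult.commute)
  qed
  then have "(\<lambda>h. h \<bullet> D) = u'" by auto
  then have D: "GDERIV u x :> D" using u' by (simp add: gderiv_def)
  have "D' = D" if "GDERIV u x :> D'" for D'
  proof -
    have "(\<lambda>h. h \<bullet> D') = (\<lambda>h. h \<bullet> D)"
      using that D has_derivative_unique unfolding gderiv_def by blast
    then have "(D' - D) \<bullet> (D' - D) = 0" by (metis inner_diff_right right_minus_eq)
    then show ?thesis by simp
  qed
  then show ?thesis unfolding grad_def using D by (metis theI)
qed

text \<open>The mean value theorem in direction \<open>w\<close>, followed by the first order expansion of the gradient at \<open>x\<close>.
  The second difference does not change when \<open>v\<close> and \<open>w\<close> are swapped, which yields the symmetry of the
  Hessian.\<close>

lemma second_difference: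
  fixes u :: "'a::euclidean_space \<Rightarrow> real"
  assumes S: "open S" "x \<in> S" and du: "\<And>y. y \<in> S \<Longrightarrow> u differentiable (at y)"
    and A: "(grad u has_derivative A) (at x)" and e: "0 < e"
  shows "\<exists>d>0. \<forall>t. 0 < t \<and> t < d \<longrightarrow>
    \<bar>u (x + t *\<^sub>R v + t *\<^sub>R w) - u (x + t *\<^sub>R v) - u (x + t *\<^sub>R w) + u x - t\<^sup>2 * (A v \<bullet> w)\<bar> \<le> e * t\<^sup>2"
proof -
  define k where "k = norm v + norm w + 1"
  have k: "0 < k" by (simp add: k_def add_nonneg_pos)
  define e' where "e' = e / (2 * k * k)"
  have e': "0 < e'" using e k by (simp add: e'_def)
  obtain d1 where d1: "0 < d1" "ball x d1 \<subseteq> S" using S open_contains_ball by blast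
  obtain d2 where d2: "0 < d2" "\<And>y. norm (y - x) < d2 \<Longrightarrow> norm (grad u y - grad u x - A (y - x)) \<le> e' * norm (y - x)"
    using A e' unfolding has_derivative_at_alt by blast
  have linA: "linear A" using A by (rule has_derivative_linear)
  define d where "d = min d1 d2 / k"
  have main: "\<bar>u (x + t *\<^sub>R v + t *\<^sub>R w) - u (x + t *\<^sub>R v) - u (x + t *\<^sub>R w) + u x - t\<^sup>2 * (A v \<bullet> w)\<bar> \<le> e * t\<^sup>2"
    if t: "0 < t" "t < d" for t
  proof -
    have tk: "t * k < min d1 d2" using t k by (simp add: d_def field_simps)
    have small: "norm (a *\<^sub>R v + s *\<^sub>R w) \<le> t * k" if "0 \<le> s" "s \<le> t" "a = 0 \<or> a = t" for a s
    proof -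
      have "norm (a *\<^sub>R v + s *\<^sub>R w) \<le> \<bar>a\<bar> * norm v + \<bar>s\<bar> * norm w"
        by (metis norm_triangle_ineq norm_scaleR)
      also have "\<dots> \<le> t * norm v + t * norm w" using that t by (intro add_mono mult_right_mono) auto
      also have "\<dots> \<le> t * k" using t by (simp add: k_def algebra_simps)
      finally show ?thesis .
    qed
    define \<phi> where "\<phi> s = u (x + (t *\<^sub>R v + s *\<^sub>R w)) - u (x + (0 *\<^sub>R v + s *\<^sub>R w))" for s
    have d\<phi>: "(\<phi> has_real_derivative (grad u (x + (t *\<^sub>R v + s *\<^sub>R w)) - grad u (x + (0 *\<^sub>R v + s *\<^sub>R w))) \<bullet> w) (at s)"
      if s: "0 \<le> s" "s \<le> t" for s
    proof -
      have *: "((\<lambda>s. u (x + (a *\<^sub>R v + s *\<^sub>R w))) has_real_derivative grad u (x + (a *\<^sub>R v + s *\<^sub>R w)) \<bullet> w) (at s)"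
        if a: "a = 0 \<or> a = t" for a
      proof -
        have "x + (a *\<^sub>R v + s *\<^sub>R w) \<in> S"
        proof -
          have "dist x (x + z) = norm z" for z by (simp add: dist_norm)
          then have "dist x (x + (a *\<^sub>R v + s *\<^sub>R w)) < d1" using small[OF s a] tk by simp
          then show ?thesis using d1(2) by (simp add: subset_iff)
        qed
        then have 2: "(u has_derivative (\<lambda>h. h \<bullet> grad u (x + (a *\<^sub>R v + s *\<^sub>R w)))) (at (x + (a *\<^sub>R v + s *\<^sub>R w)))"
          using GDERIV_grad[OF du] unfolding gderiv_def by blast
        have 1: "((\<lambda>s. x + (a *\<^sub>R v + s *\<^sub>R w)) has_derivative (\<lambda>h. 0 + (0 + h *\<^sub>R w))) (at s)"
          by (intro has_derivative_add has_derivative_const has_derivative_scaleR_left has_derivative_ident)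
        have "((\<lambda>s. u (x + (a *\<^sub>R v + s *\<^sub>R w))) has_derivative (\<lambda>h. (0 + (0 + h *\<^sub>R w)) \<bullet> grad u (x + (a *\<^sub>R v + s *\<^sub>R w)))) (at s)"
          by (rule has_derivative_compose[OF 1 2])
        then show ?thesis by (simp add: has_field_derivative_def inner_commute mult_commute_abs)
      qed
      show ?thesis unfolding \<phi>_def inner_diff_left by (intro DERIV_diff *) auto
    qed
    obtain s where s: "0 < s" "s < t"
      and mvt: "\<phi> t - \<phi> 0 = (t - 0) * ((grad u (x + (t *\<^sub>R v + s *\<^sub>R w)) - grad u (x + (0 *\<^sub>R v + s *\<^sub>R w))) \<bullet> w)"
      using MVT2[OF t(1) d\<phi>] by blast
    define R where "R a = grad u (x + (a *\<^sub>R v + s *\<^sub>R w)) - grad u x - A (a *\<^sub>R v + s *\<^sub>R w)" for a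
    have R: "norm (R a) \<le> e' * (t * k)" if a: "a = 0 \<or> a = t" for a
    proof -
      have "norm (a *\<^sub>R v + s *\<^sub>R w) \<le> t * k" using small[OF _ _ a] s by auto
      then show ?thesis
        using d2(2)[of "x + (a *\<^sub>R v + s *\<^sub>R w)"] tk e' unfolding R_def
        by (smt (verit, best) add_diff_cancel_left' mult_left_mono)
    qed
    have eq: "grad u (x + (t *\<^sub>R v + s *\<^sub>R w)) - grad u (x + (0 *\<^sub>R v + s *\<^sub>R w)) = t *\<^sub>R A v + (R t - R 0)"
      unfolding R_def by (simp add: linear_add[OF linA] linear_scale[OF linA] linear_0[OF linA])
    have "\<bar>\<phi> t - \<phi> 0 - t\<^sup>2 * (A v \<bullet> w)\<bar> = t * \<bar>(R t - R 0) \<bullet> w\<bar>"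
    proof -
      have "\<phi> t - \<phi> 0 - t\<^sup>2 * (A v \<bullet> w) = t * ((R t - R 0) \<bullet> w)"
        unfolding mvt eq by (simp add: inner_add_left power2_eq_square algebra_simps)
      then show ?thesis using t by (simp add: abs_mult)
    qed
    also have "\<dots> \<le> t * (norm (R t - R 0) * norm w)" using t by (intro mult_left_mono Cauchy_Schwarz_ineq2) auto
    also have "\<dots> \<le> t * ((e' * (t * k) + e' * (t * k)) * k)"
      using t k R[of t] R[of 0] e' norm_triangle_ineq4[of "R t" "R 0"]
      by (intro mult_left_mono mult_mono) (auto simp: k_def)
    also have "\<dots> = e * t\<^sup>2" using k by (simp add: e'_def power2_eq_square field_simps)
    finally show ?thesis by (simp add: \<phi>_def algebra_simps)
  qed
  show ?thesis using main d1 d2 k by (intro exI[of _ d]) (auto simp: d_def)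
qed

lemma hessian_symmetric:
  fixes u :: "'a::euclidean_space \<Rightarrow> real"
  assumes "open S" "x \<in> S" and "\<And>y. y \<in> S \<Longrightarrow> u differentiable (at y)"
    and "(grad u has_derivative A) (at x)"
  shows "A v \<bullet> w = A w \<bullet> v"
proof -
  have "\<bar>A v \<bullet> w - A w \<bullet> v\<bar> \<le> 0 + e" if "0 < e" for e
  proof -
    have e2: "0 < e / 2" using that by simp
    obtain d1 where d1: "0 < d1" "\<And>t. 0 < t \<and> t < d1 \<Longrightarrow> \<bar>u (x + t *\<^sub>R v + t *\<^sub>R w) - u (x + t *\<^sub>R v) - u (x + t *\<^sub>R w) + u x - t\<^sup>2 * (A v \<bullet> w)\<bar> \<le> e/2 * t\<^sup>2"
      using second_difference[OF assms e2, of v w] by blast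
    obtain d2 where d2: "0 < d2" "\<And>t. 0 < t \<and> t < d2 \<Longrightarrow> \<bar>u (x + t *\<^sub>R w + t *\<^sub>R v) - u (x + t *\<^sub>R w) - u (x + t *\<^sub>R v) + u x - t\<^sup>2 * (A w \<bullet> v)\<bar> \<le> e/2 * t\<^sup>2"
      using second_difference[OF assms e2, of w v] by blast
    define t where "t = min d1 d2 / 2"
    have t: "0 < t" "t < d1" "t < d2" using d1 d2 by (auto simp: t_def)
    have "x + t *\<^sub>R w + t *\<^sub>R v = x + t *\<^sub>R v + t *\<^sub>R w" by simp
    then have "\<bar>t\<^sup>2 * (A v \<bullet> w) - t\<^sup>2 * (A w \<bullet> v)\<bar> \<le> e * t\<^sup>2"
      using d1(2)[of t] d2(2)[of t] t by (smt (verit) field_sum_of_halves distrib_right)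
    moreover have "t\<^sup>2 * (A v \<bullet> w) - t\<^sup>2 * (A w \<bullet> v) = t\<^sup>2 * (A v \<bullet> w - A w \<bullet> v)"
      by (simp add: right_diff_distrib)
    ultimately have "t\<^sup>2 * \<bar>A v \<bullet> w - A w \<bullet> v\<bar> \<le> t\<^sup>2 * e"
      by (simp only: abs_mult abs_power2 mult.commute[of e])
    then show ?thesis using t by simp
  qed
  then have "\<bar>A v \<bullet> w - A w \<bullet> v\<bar> \<le> 0" by (rule field_le_epsilon)
  then show ?thesis by simp
qed

section \<open>Stretched complex coordinates\<close>

text \<open>In this coordinate the operator with matrix \<open>L_mat \<mu> lam\<close> becomes a multiple of the Laplacian, and the
  anisotropic norm in \<open>strain_kernel\<close> becomes the modulus.\<close>

definition cplx :: "real \<Rightarrow> real^2 \<Rightarrow> complex" where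
  "cplx lam x = Complex (lam * x $ 1) (x $ 2)"

definition uncplx :: "real \<Rightarrow> complex \<Rightarrow> real^2" where
  "uncplx lam w = vector [Re w / lam, Im w]"

lemma bounded_linear_cplx: "bounded_linear (cplx lam)"
  unfolding linear_conv_bounded_linear[symmetric]
  by (rule linearI) (simp_all add: cplx_def complex_eq_iff algebra_simps)

lemma bounded_linear_uncplx: "bounded_linear (uncplx lam)"
  unfolding linear_conv_bounded_linear[symmetric]
  by (rule linearI) (simp_all add: uncplx_def vec_eq_iff forall_2 add_divide_distrib)

lemma uncplx_cplx: "lam \<noteq> 0 \<Longrightarrow> uncplx lam (cplx lam x) = x"
  by (simp add: cplx_def uncplx_def vec_eq_iff forall_2)

lemma cplx_uncplx: "lam \<noteq> 0 \<Longrightarrow> cplx lam (uncplx lam w) = w"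
  by (simp add: cplx_def uncplx_def complex_eq_iff)

lemma norm_cplx_pos: "lam \<noteq> 0 \<Longrightarrow> x \<noteq> y \<Longrightarrow> 0 < norm (cplx lam (x - y))"
  by (simp add: cplx_def complex_eq_iff vec_eq_iff forall_2)

lemma norm_Lambda: "norm (Lambda_mat lam *v d) = norm (cplx lam d)"
  by (simp add: Lambda_mat_def cplx_def norm_vec_def L2_set_def sum_2 matrix_vector_mult_def cmod_def)

lemma cplx_image_eq_vimage: "lam \<noteq> 0 \<Longrightarrow> cplx lam ` S = uncplx lam -` S"
  by (auto simp: uncplx_cplx intro!: image_eqI[where f = "cplx lam", OF cplx_uncplx[symmetric]])

lemma open_cplx_image:
  assumes "lam \<noteq> 0" "open S" shows "open (cplx lam ` S)"
  unfolding cplx_image_eq_vimage[OF assms(1)]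
  by (rule continuous_open_vimage[OF assms(2)]) (rule linear_continuous_at[OF bounded_linear_uncplx])

lemma inj_cplx: "lam \<noteq> 0 \<Longrightarrow> inj (cplx lam)"
  by (rule inj_on_inverseI[of _ "uncplx lam"]) (simp add: uncplx_cplx)

lemma frontier_cplx_image:
  assumes lam: "lam \<noteq> 0" and S: "open S"
  shows "frontier (cplx lam ` S) = cplx lam ` frontier S"
proof -
  have "closure (cplx lam ` S) = cplx lam ` closure S"
    by (rule closure_injective_linear_image[symmetric, OF bounded_linear.linear[OF bounded_linear_cplx] inj_cplx[OF lam]])
  then show ?thesis
    using S open_cplx_image[OF lam S] inj_cplx[OF lam]
    by (simp add: frontier_def interior_open image_set_diff)
qed

lemma simply_connected_cplx_image:
  assumes lam: "lam \<noteq> 0" and S: "simply_connected S"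
  shows "simply_connected (cplx lam ` S)"
proof -
  have "homeomorphism S (cplx lam ` S) (cplx lam) (uncplx lam)"
    unfolding homeomorphism_def
    using lam by (auto simp: uncplx_cplx image_image intro!: linear_continuous_on bounded_linear_cplx bounded_linear_uncplx)
  then have "S homeomorphic cplx lam ` S" by (auto simp: homeomorphic_def)
  then show ?thesis using S homeomorphic_simply_connected by blast
qed

text \<open>The characterisation of simple connectedness by the frontier, moved from the complex plane.\<close>

lemma connected_frontier_planar:
  fixes S :: "(real^2) set"
  assumes S: "open S" "bounded S" "simply_connected S"
  shows "connected (frontier S)"
proof -
  let ?T = "cplx 1 ` S"
  have "bounded ?T" using S(2) bounded_linear_cplx by (rule bounded_linear_image)
  then have "connected (frontier ?T)"
    using simply_connected_eq_frontier_properties[OF open_cplx_image[of 1, OF _ S(1)]] simply_connected_cplx_image[of 1, OF _ S(3)] by simp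
  then have "connected (cplx 1 ` frontier S)"
    using frontier_cplx_image[of 1 S] S(1) by simp
  then have "connected (uncplx 1 ` cplx 1 ` frontier S)"
    by (rule connected_continuous_image[OF linear_continuous_on[OF bounded_linear_uncplx]])
  then show ?thesis by (simp add: image_image uncplx_cplx)
qed

lemma tendsto_cplx_image:
  assumes lam: "lam \<noteq> 0" and f: "(f \<longlongrightarrow> c) (at p within S)"
  shows "((\<lambda>w. f (uncplx lam w)) \<longlongrightarrow> c) (at (cplx lam p) within cplx lam ` S)"
proof (rule filterlim_compose[OF f])
  have "continuous (at (cplx lam p) within cplx lam ` S) (uncplx lam)"
    by (rule continuous_at_imp_continuous_within[OF linear_continuous_at[OF bounded_linear_uncplx]])
  then have "(uncplx lam \<longlongrightarrow> p) (at (cplx lam p) within cplx lam ` S)"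
    unfolding continuous_within by (simp add: uncplx_cplx lam)
  moreover have "\<forall>\<^sub>F w in at (cplx lam p) within cplx lam ` S. uncplx lam w \<in> S \<and> uncplx lam w \<noteq> p"
    unfolding eventually_at by (intro exI[of _ 1]) (auto simp: uncplx_cplx lam)
  ultimately show "filterlim (uncplx lam) (at p within S) (at (cplx lam p) within cplx lam ` S)"
    by (simp add: filterlim_at)
qed

text \<open>If \<open>U\<close> is \<open>u\<close> in the coordinate \<open>w\<close>, this is \<open>\<partial>U/\<partial>x - \<i> * \<partial>U/\<partial>y\<close>; for harmonic \<open>U\<close> it is the
  derivative of any local holomorphic function with real part \<open>U\<close>.\<close>

definition cgrad :: "real \<Rightarrow> (real^2 \<Rightarrow> real) \<Rightarrow> complex \<Rightarrow> complex" where
  "cgrad lam u w = Complex (grad u (uncplx lam w) $ 1 / lam) (- (grad u (uncplx lam w) $ 2))"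

lemma divergence_L_grad:
  assumes "(grad u has_derivative A) (at x)"
  shows "divergence (\<lambda>y. L_mat \<mu> lam *v grad u y) x = \<mu> * (A (axis 1 1) $ 1) + \<mu> * lam\<^sup>2 * (A (axis 2 1) $ 2)"
proof -
  have "bounded_linear ((*v) (L_mat \<mu> lam))" by (rule matrix_vector_mul_bounded_linear)
  then have "((\<lambda>y. L_mat \<mu> lam *v grad u y) has_derivative (\<lambda>h. L_mat \<mu> lam *v A h)) (at x)"
    using assms by (rule bounded_linear.has_derivative)
  then have "frechet_derivative (\<lambda>y. L_mat \<mu> lam *v grad u y) (at x) = (\<lambda>h. L_mat \<mu> lam *v A h)"
    by (rule frechet_derivative_at[symmetric])
  then show ?thesis
    by (simp add: divergence_def jacobian_def trace_def sum_2 matrix_def L_mat_def matrix_vector_mult_def)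
qed

text \<open>The Cauchy-Riemann equations for \<open>cgrad\<close> are the equation for \<open>u\<close> and the symmetry of its Hessian.\<close>

lemma cgrad_holomorphic:
  assumes \<Omega>: "open \<Omega>" and par: "\<mu> > 0" "lam \<noteq> 0" and u: "C2_on u \<Omega>"
    and eq: "\<And>x. x \<in> \<Omega> \<Longrightarrow> divergence (\<lambda>y. L_mat \<mu> lam *v grad u y) x = 0"
  shows "cgrad lam u holomorphic_on cplx lam ` \<Omega>"
proof -
  have "cgrad lam u field_differentiable (at (cplx lam x))" if x: "x \<in> \<Omega>" for x
  proof -
    have "grad u differentiable (at x)" using u x by (auto simp: C2_on_def)
    then obtain A where A: "(grad u has_derivative A) (at x)" by (auto simp: differentiable_def)
    have linA: "linear A" using A by (rule has_derivative_linear)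
    define a where "a i j = A (axis j 1) $ i" for i j :: 2
    have Ah: "A h $ i = a i 1 * h $ 1 + a i 2 * h $ 2" for h i
    proof -
      have eq: "h $ 1 *\<^sub>R axis 1 1 + h $ 2 *\<^sub>R axis 2 1 = h" by (simp add: vec_eq_iff forall_2 axis_def)
      have "A (h $ 1 *\<^sub>R axis 1 1 + h $ 2 *\<^sub>R axis 2 1) = h $ 1 *\<^sub>R A (axis 1 1) + h $ 2 *\<^sub>R A (axis 2 1)"
        by (simp only: linear_add[OF linA] linear_scale[OF linA])
      then have "A h = h $ 1 *\<^sub>R A (axis 1 1) + h $ 2 *\<^sub>R A (axis 2 1)" by (simp only: eq)
      then show ?thesis by (simp add: a_def)
    qed
    have sym: "a 2 1 = a 1 2"
      using hessian_symmetric[OF \<Omega> x _ A, of "axis 1 1" "axis 2 1"] u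
      by (simp add: C2_on_def a_def inner_axis)
    have lap: "a 1 1 + lam\<^sup>2 * a 2 2 = 0"
    proof -
      have "\<mu> * (a 1 1 + lam\<^sup>2 * a 2 2) = 0"
        using eq[OF x] divergence_L_grad[OF A, of \<mu> lam] by (simp add: a_def algebra_simps)
      then show ?thesis using par by simp
    qed
    let ?w = "cplx lam x"
    have 0: "(uncplx lam has_derivative uncplx lam) (at ?w)"
      by (rule bounded_linear_imp_has_derivative[OF bounded_linear_uncplx])
    have A': "(grad u has_derivative A) (at (uncplx lam ?w))" using A par by (simp add: uncplx_cplx)
    have 1: "((\<lambda>w. grad u (uncplx lam w)) has_derivative (\<lambda>h. A (uncplx lam h))) (at ?w)"
      by (rule has_derivative_compose[OF 0 A'])
    have bl: "bounded_linear (\<lambda>g::real^2. Complex (g $ 1 / lam) (- (g $ 2)))"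
      unfolding linear_conv_bounded_linear[symmetric]
      by (rule linearI) (simp_all add: complex_eq_iff add_divide_distrib)
    have "(cgrad lam u has_derivative (\<lambda>h. Complex (A (uncplx lam h) $ 1 / lam) (- (A (uncplx lam h) $ 2)))) (at ?w)"
      unfolding cgrad_def[abs_def] by (rule bounded_linear.has_derivative[OF bl 1])
    also have "(\<lambda>h. Complex (A (uncplx lam h) $ 1 / lam) (- (A (uncplx lam h) $ 2))) = (*) (Complex (a 1 1 / lam\<^sup>2) (- (a 1 2 / lam)))"
    proof
      fix h
      have "a 1 1 = - (lam\<^sup>2 * a 2 2)" using lap by simp
      then show "Complex (A (uncplx lam h) $ 1 / lam) (- (A (uncplx lam h) $ 2)) = Complex (a 1 1 / lam\<^sup>2) (- (a 1 2 / lam)) * h"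
        using par sym by (simp add: complex_eq_iff Ah uncplx_def field_simps power2_eq_square)
    qed
    finally show ?thesis
      unfolding field_differentiable_def has_field_derivative_def by blast
  qed
  then show ?thesis
    unfolding holomorphic_on_def using field_differentiable_at_within by blast
qed

section \<open>Two estimates for holomorphic functions\<close>

text \<open>Only the imaginary part of \<open>g\<close> is bounded. The function \<open>exp (- \<i> * (g - \<i> * c) / e)\<close> has modulus
  between \<open>exp (-1)\<close> and \<open>exp 1\<close>, and Cauchy's inequality for it bounds the logarithmic derivative
  \<open>- \<i> * g' / e\<close>.\<close>

lemma deriv_bound_by_Im:
  assumes S: "open S" and g: "g holomorphic_on S" and R: "0 < R" "cball w R \<subseteq> S" and e: "0 < e"
    and Im: "\<And>z. z \<in> S \<Longrightarrow> \<bar>Im (g z) - c\<bar> \<le> e"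
  shows "norm (deriv g w) \<le> exp 2 * e / R"
proof -
  define a where "a = - \<i> / complex_of_real e"
  define G where "G z = exp (a * (g z - \<i> * complex_of_real c))" for z
  have w: "w \<in> S" using R by auto
  have Re: "Re (a * (g z - \<i> * complex_of_real c)) = (Im (g z) - c) / e" for z
    using e by (simp add: a_def field_simps)
  have up: "norm (G z) \<le> exp 1" and low: "exp (-1) \<le> norm (G z)" if "z \<in> S" for z
  proof -
    have "(Im (g z) - c) / e \<le> 1" "-1 \<le> (Im (g z) - c) / e"
      using Im[OF that] e by (auto simp: divide_le_eq le_divide_eq abs_le_iff)
    then show "norm (G z) \<le> exp 1" "exp (-1) \<le> norm (G z)"
      unfolding G_def norm_exp_eq_Re Re by auto
  qed
  have G: "G holomorphic_on S" unfolding G_def by (intro holomorphic_intros g)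
  have "(g has_field_derivative deriv g w) (at w)" using g S w by (rule holomorphic_derivI)
  then have "(G has_field_derivative G w * (a * deriv g w)) (at w)"
    unfolding G_def by (auto intro!: derivative_eq_intros)
  then have dG: "deriv G w = G w * (a * deriv g w)" by (rule DERIV_imp_deriv)
  have "norm ((deriv ^^ 1) G w) \<le> fact 1 * exp 1 / R ^ 1"
  proof (rule Cauchy_inequality)
    show "G holomorphic_on ball w R" using G R by (meson ball_subset_cball holomorphic_on_subset order_trans)
    show "continuous_on (cball w R) G" using G R by (meson holomorphic_on_imp_continuous_on continuous_on_subset)
    show "norm (G z) \<le> exp 1" if "norm (w - z) = R" for z
      using that R by (intro up) (auto simp: dist_norm subset_iff)
  qed (use R in auto)
  then have "norm (G w) * (norm (deriv g w) / e) \<le> exp 1 / R"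
    using e by (simp add: dG norm_mult norm_divide a_def)
  moreover have "exp (-1) * (norm (deriv g w) / e) \<le> norm (G w) * (norm (deriv g w) / e)"
    using low[OF w] e by (intro mult_right_mono) auto
  ultimately have "exp (-1) * (norm (deriv g w) / e) \<le> exp 1 / R" by linarith
  then have "exp 1 * (exp (-1) * (norm (deriv g w) / e)) \<le> exp 1 * (exp 1 / R)"
    by (intro mult_left_mono) auto
  moreover have "exp 1 * (exp (-1) * (norm (deriv g w) / e)) = norm (deriv g w) / e"
    using exp_minus_inverse[of "1::real"] by (simp only: mult.assoc[symmetric])
  ultimately have "norm (deriv g w) / e \<le> exp 1 * exp 1 / R" by (simp only: times_divide_eq_right)
  then have "norm (deriv g w) \<le> exp 1 * exp 1 / R * e" using e by (simp only: pos_divide_le_eq)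
  then have "norm (deriv g w) \<le> exp 1 * exp 1 * e / R" by simp
  also have "exp 1 * exp 1 = exp (2::real)" by (simp flip: exp_add)
  finally show ?thesis .
qed

text \<open>The maximum principle for harmonic functions that need not extend continuously to the boundary: the
  set \<open>U\<close> where the bound fails stays away from the frontier, so that the classical principle on \<open>U\<close>
  shows \<open>U\<close> to be empty.\<close>

lemma Im_le_boundary_bound:
  assumes S: "open S" "bounded S" and g: "g holomorphic_on S"
    and ev: "\<And>p. p \<in> frontier S \<Longrightarrow> \<forall>\<^sub>F z in at p within S. Im (g z) < M"
    and z: "z \<in> S"
  shows "Im (g z) \<le> M"
proof (rule ccontr)
  assume "\<not> Im (g z) \<le> M"
  define U where "U = {z \<in> S. M < Im (g z)}"
  have zU: "z \<in> U" using z \<open>\<not> Im (g z) \<le> M\<close> by (simp add: U_def)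
  have contg: "continuous_on S g" using g by (rule holomorphic_on_imp_continuous_on)
  have opU: "open U"
  proof -
    have "open (S \<inter> (\<lambda>z. Im (g z)) -` {M<..})"
      by (rule continuous_open_preimage[OF _ S(1)]) (auto intro!: continuous_intros contg)
    also have "S \<inter> (\<lambda>z. Im (g z)) -` {M<..} = U" by (auto simp: U_def)
    finally show ?thesis .
  qed
  have cl: "closure U \<subseteq> S"
  proof (rule subsetI, rule ccontr)
    fix p assume p: "p \<in> closure U" "p \<notin> S"
    have "p \<in> closure S" using p(1) closure_mono[of U S] by (auto simp: U_def)
    then have "p \<in> frontier S" using p(2) S(1) by (simp add: frontier_def interior_open)
    then have "\<forall>\<^sub>F z in at p within S. Im (g z) < M" by (rule ev)
    then obtain d where d: "0 < d" "\<And>y. y \<in> S \<Longrightarrow> y \<noteq> p \<Longrightarrow> dist y p < d \<Longrightarrow> Im (g y) < M"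
      unfolding eventually_at by blast
    obtain y where "y \<in> U" "dist y p < d" using p(1) d(1) unfolding closure_approachable by blast
    then show False using d(2)[of y] p(2) by (auto simp: U_def)
  qed
  have "Re (- \<i> * g z) \<le> M"
  proof (rule maximum_real_frontier[where S = U and f = "\<lambda>z. - \<i> * g z" and \<xi> = z])
    show "(\<lambda>z. - \<i> * g z) holomorphic_on interior U"
      using opU holomorphic_on_subset[OF g, of U] by (auto simp: interior_open U_def intro!: holomorphic_intros)
    show "continuous_on (closure U) (\<lambda>z. - \<i> * g z)"
      by (intro continuous_intros continuous_on_subset[OF contg cl])
    show "bounded U" using S(2) by (rule bounded_subset) (auto simp: U_def)
    show "Re (- \<i> * g y) \<le> M" if "y \<in> frontier U" for y
    proof -
      have "y \<in> S - U" using that cl opU by (auto simp: frontier_def interior_open)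
      then show ?thesis by (auto simp: U_def)
    qed
  qed (rule zU)
  then show False using \<open>\<not> Im (g z) \<le> M\<close> by simp
qed

section \<open>The Neumann condition along a boundary chart\<close>

text \<open>In the plane \<open>\<nu>\<close> is \<open>\<tau>\<close> turned by a right angle, in the direction given by the sign \<open>k\<close>.\<close>

lemma orthonormal_frame:
  fixes \<tau> \<nu> :: "real^2"
  assumes "norm \<tau> = 1" "norm \<nu> = 1" "\<tau> \<bullet> \<nu> = 0"
  obtains k where "k * k = 1" "\<nu> $ 1 = - k * \<tau> $ 2" "\<nu> $ 2 = k * \<tau> $ 1"
    and "\<tau> $ 1 * \<tau> $ 1 + \<tau> $ 2 * \<tau> $ 2 = 1"
proof -
  have "\<tau> \<bullet> \<tau> = 1" "\<nu> \<bullet> \<nu> = 1" using assms by (simp_all add: dot_square_norm)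
  then have 1: "\<tau>$1 * \<tau>$1 + \<tau>$2 * \<tau>$2 = 1" "\<nu>$1 * \<nu>$1 + \<nu>$2 * \<nu>$2 = 1" "\<tau>$1 * \<nu>$1 + \<tau>$2 * \<nu>$2 = 0"
    using assms(3) by (simp_all add: inner_vec_def sum_2)
  define k where "k = \<tau>$1 * \<nu>$2 - \<tau>$2 * \<nu>$1"
  have "\<nu>$1 = - k * \<tau>$2" "\<nu>$2 = k * \<tau>$1" unfolding k_def using 1 by algebra+
  moreover have "k * k = 1" using 1 unfolding k_def by algebra
  ultimately show ?thesis using that 1(1) by blast
qed

lemma frame_expansion:
  fixes \<tau> \<nu> v :: "real^2"
  assumes "norm \<tau> = 1" "norm \<nu> = 1" "\<tau> \<bullet> \<nu> = 0"
  shows "v = (v \<bullet> \<tau>) *\<^sub>R \<tau> + (v \<bullet> \<nu>) *\<^sub>R \<nu>"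
proof -
  obtain k where k: "k * k = 1" "\<nu> $ 1 = - k * \<tau> $ 2" "\<nu> $ 2 = k * \<tau> $ 1"
    and 1: "\<tau> $ 1 * \<tau> $ 1 + \<tau> $ 2 * \<tau> $ 2 = 1"
    using orthonormal_frame[OF assms] by blast
  have "v$1 = (v$1 * \<tau>$1 + v$2 * \<tau>$2) * \<tau>$1 + (v$1 * \<nu>$1 + v$2 * \<nu>$2) * \<nu>$1"
    "v$2 = (v$1 * \<tau>$1 + v$2 * \<tau>$2) * \<tau>$2 + (v$1 * \<nu>$1 + v$2 * \<nu>$2) * \<nu>$2"
    unfolding k(2,3) using k(1) 1 by algebra+
  then show ?thesis by (simp add: vec_eq_iff forall_2 inner_vec_def sum_2)
qed

text \<open>The boundary condition is stated through normals at centres of charts; recentring makes it available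
  at all points of the graph.\<close>

lemma local_epigraph_recentre:
  assumes e: "local_epigraph \<Omega> p \<tau> \<nu> \<phi> r h" and s: "\<bar>s\<bar> < r"
    and cont: "continuous_on {-r<..<r} \<phi>"
  shows "\<exists>r' h'. local_epigraph \<Omega> (p + s *\<^sub>R \<tau> + \<phi> s *\<^sub>R \<nu>) \<tau> \<nu> (\<lambda>s'. \<phi> (s + s') - \<phi> s) r' h'"
proof -
  have e': "norm \<tau> = 1" "norm \<nu> = 1" "\<tau> \<bullet> \<nu> = 0" "0 < r" "0 < h"
    "\<And>s. \<bar>s\<bar> < r \<Longrightarrow> \<bar>\<phi> s\<bar> < h"
    "\<And>s t. \<bar>s\<bar> < r \<Longrightarrow> \<bar>t\<bar> < h \<Longrightarrow> p + s *\<^sub>R \<tau> + t *\<^sub>R \<nu> \<in> \<Omega> \<longleftrightarrow> \<phi> s < t"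
    using e by (auto simp: local_epigraph_def)
  define h' where "h' = h - \<bar>\<phi> s\<bar>"
  have h': "0 < h'" using e'(6)[OF s] by (simp add: h'_def)
  have "isCont \<phi> s" using cont s by (simp add: continuous_on_eq_continuous_at abs_less_iff)
  then obtain d where d: "0 < d" "\<And>y. dist y s < d \<Longrightarrow> dist (\<phi> y) (\<phi> s) < h'"
    using h' unfolding continuous_at_eps_delta by blast
  define r' where "r' = min d (r - \<bar>s\<bar>)"
  have "local_epigraph \<Omega> (p + s *\<^sub>R \<tau> + \<phi> s *\<^sub>R \<nu>) \<tau> \<nu> (\<lambda>s'. \<phi> (s + s') - \<phi> s) r' h'"
    unfolding local_epigraph_def
  proof (intro conjI allI impI)
    show "0 < r'" using d s by (simp add: r'_def)
    show "\<bar>\<phi> (s + x) - \<phi> s\<bar> < h'" if "\<bar>x\<bar> < r'" for x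
      using d(2)[of "s + x"] that by (simp add: r'_def dist_real_def)
    fix x t assume xt: "\<bar>x\<bar> < r' \<and> \<bar>t\<bar> < h'"
    have eq: "p + s *\<^sub>R \<tau> + \<phi> s *\<^sub>R \<nu> + x *\<^sub>R \<tau> + t *\<^sub>R \<nu> = p + (s + x) *\<^sub>R \<tau> + (\<phi> s + t) *\<^sub>R \<nu>"
      by (simp add: algebra_simps)
    show "(p + s *\<^sub>R \<tau> + \<phi> s *\<^sub>R \<nu> + x *\<^sub>R \<tau> + t *\<^sub>R \<nu> \<in> \<Omega>) = (\<phi> (s + x) - \<phi> s < t)"
    proof -
      have "\<bar>s + x\<bar> < r" "\<bar>\<phi> s + t\<bar> < h" using xt unfolding r'_def h'_def by linarith+
      then show ?thesis unfolding eq by (subst e'(7)) auto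
    qed
  qed (use e' h' in auto)
  then show ?thesis by blast
qed

lemma epigraph_centre_in_frontier:
  assumes e: "local_epigraph \<Omega> p \<tau> \<nu> \<phi> r h" and op: "open \<Omega>"
  shows "p \<in> frontier \<Omega>"
proof -
  have e': "0 < r" "0 < h" "\<phi> 0 = 0"
    "\<And>s t. \<bar>s\<bar> < r \<Longrightarrow> \<bar>t\<bar> < h \<Longrightarrow> p + s *\<^sub>R \<tau> + t *\<^sub>R \<nu> \<in> \<Omega> \<longleftrightarrow> \<phi> s < t"
    using e by (auto simp: local_epigraph_def)
  have "p \<notin> \<Omega>" using e'(4)[of 0 0] e' by simp
  moreover have "p \<in> closure \<Omega>"
    unfolding closure_approachable
  proof (intro allI impI)
    fix \<epsilon> :: real assume \<epsilon>: "0 < \<epsilon>"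
    define t where "t = min (h / 2) (\<epsilon> / 2)"
    have t: "0 < t" "t < h" "t < \<epsilon>" using \<epsilon> e'(2) by (auto simp: t_def)
    have "p + 0 *\<^sub>R \<tau> + t *\<^sub>R \<nu> \<in> \<Omega>" using e'(4)[of 0 t] e'(1-3) t by simp
    moreover have "dist (p + 0 *\<^sub>R \<tau> + t *\<^sub>R \<nu>) p < \<epsilon>" using t e by (simp add: dist_norm local_epigraph_def)
    ultimately show "\<exists>y\<in>\<Omega>. dist y p < \<epsilon>" by blast
  qed
  ultimately show ?thesis using op by (simp add: frontier_def interior_open)
qed

text \<open>The normal at a graph point is a multiple of \<open>\<phi>' s *\<^sub>R \<tau> - \<nu>\<close>, which is perpendicular to the tangent
  \<open>\<tau> + \<phi>' s *\<^sub>R \<nu>\<close>. Hence a field \<open>W\<close> without normal component, turned by a right angle, has no tangential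
  component.\<close>

lemma normal_condition_on_graph:
  assumes e: "local_epigraph \<Omega> p \<tau> \<nu> \<phi> r h" and op: "open \<Omega>"
    and d: "\<And>s. \<bar>s\<bar> < r \<Longrightarrow> (\<phi> has_real_derivative \<phi>' s) (at s)"
    and s: "\<bar>s\<bar> < r"
  shows "p + s *\<^sub>R \<tau> + \<phi> s *\<^sub>R \<nu> \<in> frontier \<Omega>"
    and "W \<bullet> outer_unit_normal \<Omega> (p + s *\<^sub>R \<tau> + \<phi> s *\<^sub>R \<nu>) = 0 \<Longrightarrow>
      vector [- (W $ 2), W $ 1] \<bullet> (\<tau> + \<phi>' s *\<^sub>R \<nu>) = 0"
proof -
  let ?y = "p + s *\<^sub>R \<tau> + \<phi> s *\<^sub>R \<nu>"
  have "continuous_on {-r<..<r} \<phi>"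
    by (intro continuous_at_imp_continuous_on ballI DERIV_isCont[OF d]) auto
  then obtain r' h' where e': "local_epigraph \<Omega> ?y \<tau> \<nu> (\<lambda>s'. \<phi> (s + s') - \<phi> s) r' h'"
    using local_epigraph_recentre[OF e s] by blast
  show "?y \<in> frontier \<Omega>" by (rule epigraph_centre_in_frontier[OF e' op])
  assume W: "W \<bullet> outer_unit_normal \<Omega> ?y = 0"
  have "((\<lambda>s'. \<phi> (s + s') - \<phi> s) has_real_derivative \<phi>' s * 1 - 0) (at 0)"
    by (intro DERIV_diff DERIV_const DERIV_chain2[of \<phi>]) (use d[OF s] in \<open>auto intro!: derivative_eq_intros\<close>)
  then have n: "outer_unit_normal \<Omega> ?y = (1 / sqrt (1 + (\<phi>' s)\<^sup>2)) *\<^sub>R (\<phi>' s *\<^sub>R \<tau> - \<nu>)"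
    using outer_unit_normal_eq[OF e'] by simp
  have "0 < 1 + (\<phi>' s)\<^sup>2" by (simp add: add_pos_nonneg)
  then have W': "W \<bullet> (\<phi>' s *\<^sub>R \<tau> - \<nu>) = 0" using W unfolding n by simp
  obtain k where k: "k * k = 1" "\<nu> $ 1 = - k * \<tau> $ 2" "\<nu> $ 2 = k * \<tau> $ 1"
    using orthonormal_frame[of \<tau> \<nu>] e by (metis local_epigraph_def)
  have "vector [- (W $ 2), W $ 1] \<bullet> (\<tau> + \<phi>' s *\<^sub>R \<nu>) = k * (W \<bullet> (\<phi>' s *\<^sub>R \<tau> - \<nu>))"
    unfolding inner_vec_def sum_2 using k(1) by (simp add: k(2,3) algebra_simps) algebra
  then show "vector [- (W $ 2), W $ 1] \<bullet> (\<tau> + \<phi>' s *\<^sub>R \<nu>) = 0" using W' by simp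
qed

text \<open>\<open>H s t\<close> is the point at height \<open>t\<close> above the graph point with parameter \<open>s\<close>. The derivative of
  \<open>q (H s t)\<close> in \<open>t\<close> is bounded, so that \<open>q\<close> has a limit on the vertical line \<open>s = 0\<close> as \<open>t\<close> tends to \<open>0\<close>.
  The derivative in \<open>s\<close> is continuous up to \<open>t = 0\<close> and vanishes there by tangency, hence is uniformly
  small for small \<open>t\<close>, so that \<open>q\<close> has the same limit at all nearby boundary points.\<close>

lemma locally_constant_boundary_limit:
  fixes q :: "real^2 \<Rightarrow> real" and E :: "real^2 \<Rightarrow> real^2"
  assumes op: "open \<Omega>" and e: "local_epigraph \<Omega> p \<tau> \<nu> \<phi> r h"
    and d\<phi>: "\<And>s. \<bar>s\<bar> < r \<Longrightarrow> (\<phi> has_real_derivative \<phi>' s) (at s)"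
    and c\<phi>': "continuous_on {-r<..<r} \<phi>'"
    and d: "0 < d"
    and dq: "\<And>x. x \<in> \<Omega> \<Longrightarrow> dist p x < d \<Longrightarrow> (q has_derivative (\<lambda>v. E x \<bullet> v)) (at x)"
    and cE: "continuous_on (closure \<Omega> \<inter> ball p d) E"
    and tang: "\<And>s. \<bar>s\<bar> < r \<Longrightarrow> dist p (p + s *\<^sub>R \<tau> + \<phi> s *\<^sub>R \<nu>) < d \<Longrightarrow>
        E (p + s *\<^sub>R \<tau> + \<phi> s *\<^sub>R \<nu>) \<bullet> (\<tau> + \<phi>' s *\<^sub>R \<nu>) = 0"
  shows "\<exists>c. \<exists>\<delta>>0. \<forall>y \<in> frontier \<Omega> \<inter> ball p \<delta>. (q \<longlongrightarrow> c) (at y within \<Omega>)"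
proof -
  have fr: "norm \<tau> = 1" "norm \<nu> = 1" "\<tau> \<bullet> \<nu> = 0" "0 < r" "0 < h" "\<phi> 0 = 0"
    and box: "\<And>s t. \<bar>s\<bar> < r \<Longrightarrow> \<bar>t\<bar> < h \<Longrightarrow> p + s *\<^sub>R \<tau> + t *\<^sub>R \<nu> \<in> \<Omega> \<longleftrightarrow> \<phi> s < t"
    using e by (auto simp: local_epigraph_def)
  have c\<phi>: "continuous_on {-r<..<r} \<phi>"
    by (intro continuous_at_imp_continuous_on ballI DERIV_isCont[OF d\<phi>]) auto
  define H where "H s t = p + s *\<^sub>R \<tau> + (\<phi> s + t) *\<^sub>R \<nu>" for s t
  \<comment> \<open>inside the rectangle \<open>\<bar>s\<bar> \<le> \<rho>\<close>, \<open>0 \<le> t \<le> \<kappa>\<close> the points \<open>H s t\<close> stay in the box of the chart and in the ball\<close>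
  define \<kappa> where "\<kappa> = min (d / 4) (h / 2)"
  have \<kappa>: "0 < \<kappa>" "4 * \<kappa> \<le> d" "2 * \<kappa> \<le> h" using d fr by (auto simp: \<kappa>_def)
  have "isCont \<phi> 0" using d\<phi>[of 0] fr by (auto intro: DERIV_isCont)
  then obtain \<rho>0 where \<rho>0: "0 < \<rho>0" "\<And>s. dist s 0 < \<rho>0 \<Longrightarrow> dist (\<phi> s) (\<phi> 0) < \<kappa>"
    using \<kappa> unfolding continuous_at_eps_delta by blast
  define \<rho> where "\<rho> = min (min (\<rho>0 / 2) (r / 2)) \<kappa>"
  have \<rho>: "0 < \<rho>" "\<rho> < r" "\<rho> \<le> \<kappa>" using \<rho>0 fr \<kappa> by (auto simp: \<rho>_def)
  have \<phi>\<kappa>: "\<bar>\<phi> s\<bar> < \<kappa>" if "\<bar>s\<bar> \<le> \<rho>" for s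
    using \<rho>0(2)[of s] that \<rho>0(1) fr by (auto simp: \<rho>_def dist_real_def)
  let ?R = "{-\<rho>..\<rho>} \<times> {0..\<kappa>}"
  have Hball: "dist p (H s t) < d" if "\<bar>s\<bar> \<le> \<rho>" "0 \<le> t" "t \<le> \<kappa>" for s t
  proof -
    have "dist p (H s t) = norm (s *\<^sub>R \<tau> + (\<phi> s + t) *\<^sub>R \<nu>)"
      unfolding dist_commute[of p] by (simp add: H_def dist_norm add.assoc)
    also have "\<dots> \<le> \<bar>s\<bar> * 1 + \<bar>\<phi> s + t\<bar> * 1"
      using fr by (intro order_trans[OF norm_triangle_ineq]) simp
    also have "\<dots> < 4 * \<kappa>" using that \<phi>\<kappa>[OF that(1)] \<rho> by auto
    finally show ?thesis using \<kappa> by simp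
  qed
  have H\<Omega>: "H s t \<in> \<Omega>" if "\<bar>s\<bar> \<le> \<rho>" "0 < t" "t \<le> \<kappa>" for s t
    unfolding H_def using that \<phi>\<kappa>[OF that(1)] \<rho> \<kappa> by (subst box) auto
  have Hfr: "H s 0 \<in> frontier \<Omega>" if "\<bar>s\<bar> \<le> \<rho>" for s
    using normal_condition_on_graph(1)[OF e op d\<phi>, of s] that \<rho> by (simp add: H_def)
  have Hcl: "H s t \<in> closure \<Omega> \<inter> ball p d" if "\<bar>s\<bar> \<le> \<rho>" "0 \<le> t" "t \<le> \<kappa>" for s t
  proof (cases "t = 0")
    case True
    then show ?thesis using Hfr[OF that(1)] Hball[OF that] by (simp add: frontier_def)
  next
    case False
    then have "H s t \<in> \<Omega>" using H\<Omega>[OF that(1)] that by simp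
    then show ?thesis using Hball[OF that] subsetD[OF closure_subset] by simp
  qed
  have sub: "{-\<rho>..\<rho>} \<subseteq> {-r<..<r}" using \<rho> by auto
  have fst_cont: "continuous_on ?R (\<lambda>z. \<psi> (fst z))" if "continuous_on {-r<..<r} \<psi>" for \<psi> :: "real \<Rightarrow> real"
    by (rule continuous_on_compose2[OF that]) (use sub continuous_on_fst[OF continuous_on_id] in \<open>auto simp: id_def\<close>)
  have cH: "continuous_on ?R (\<lambda>z. H (fst z) (snd z))"
    unfolding H_def by (intro continuous_intros fst_cont c\<phi>)
  have cEH: "continuous_on ?R (\<lambda>z. E (H (fst z) (snd z)))"
    by (rule continuous_on_compose2[OF cE cH]) (use Hcl in \<open>auto simp: abs_le_iff\<close>)
  define m where "m s t = E (H s t) \<bullet> (\<tau> + \<phi>' s *\<^sub>R \<nu>)" for s t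
  define n where "n s t = E (H s t) \<bullet> \<nu>" for s t
  have cm: "continuous_on ?R (\<lambda>z. m (fst z) (snd z))"
    unfolding m_def by (intro continuous_intros fst_cont c\<phi>' cEH)
  have cn: "continuous_on ?R (\<lambda>z. n (fst z) (snd z))"
    unfolding n_def by (intro continuous_intros cEH)
  have cR: "compact ?R" by (intro compact_Times) auto
  obtain B where B: "0 < B" "\<And>s t. \<bar>s\<bar> \<le> \<rho> \<Longrightarrow> 0 \<le> t \<Longrightarrow> t \<le> \<kappa> \<Longrightarrow> \<bar>n s t\<bar> \<le> B"
  proof -
    have "bounded ((\<lambda>z. n (fst z) (snd z)) ` ?R)"
      using compact_continuous_image[OF cn cR] by (rule compact_imp_bounded)
    then obtain B where "0 < B" "\<And>z. z \<in> ?R \<Longrightarrow> norm (n (fst z) (snd z)) \<le> B"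
      unfolding bounded_pos by blast
    then show thesis using that[of B] by (auto simp: abs_le_iff)
  qed
  have m0: "m s 0 = 0" if "\<bar>s\<bar> \<le> \<rho>" for s
    using tang[of s] Hball[OF that, of 0] that \<rho> \<kappa> by (simp add: m_def H_def)
  have msmall: "\<exists>t0>0. \<forall>s t. \<bar>s\<bar> \<le> \<rho> \<and> 0 \<le> t \<and> t < t0 \<and> t \<le> \<kappa> \<longrightarrow> \<bar>m s t\<bar> < \<epsilon>" if \<epsilon>: "0 < \<epsilon>" for \<epsilon>
  proof -
    obtain t0 where t0: "0 < t0" "\<forall>z\<in>?R. \<forall>z'\<in>?R. dist z' z < t0 \<longrightarrow> dist (m (fst z') (snd z')) (m (fst z) (snd z)) < \<epsilon>"
      using compact_uniformly_continuous[OF cm cR] \<epsilon> unfolding uniformly_continuous_on_def by blast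
    have "\<bar>m s t\<bar> < \<epsilon>" if "\<bar>s\<bar> \<le> \<rho>" "0 \<le> t" "t < t0" "t \<le> \<kappa>" for s t
    proof -
      have R: "(s, 0) \<in> ?R" "(s, t) \<in> ?R" using that \<kappa>(1) by (simp_all add: abs_le_iff)
      have "dist (s, t) (s, 0) < t0" using that by (simp add: dist_Pair_Pair dist_real_def)
      then have "dist (m s t) (m s 0) < \<epsilon>" using t0(2) R by fastforce
      then show ?thesis using m0[OF that(1)] by (simp add: dist_real_def)
    qed
    then show ?thesis using t0(1) by blast
  qed
  have qder: "(q has_derivative (\<lambda>v. E (H s t) \<bullet> v)) (at (H s t))" if "\<bar>s\<bar> \<le> \<rho>" "0 < t" "t \<le> \<kappa>" for s t
    using dq[OF H\<Omega>[OF that]] Hball[of s t] that by auto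
  have ds: "((\<lambda>s. q (H s t)) has_real_derivative m s t) (at s)" if "\<bar>s\<bar> \<le> \<rho>" "0 < t" "t \<le> \<kappa>" for s t
  proof -
    have "(\<phi> has_real_derivative \<phi>' s) (at s)" using d\<phi>[of s] that \<rho> by simp
    then have "((\<lambda>s. H s t) has_vector_derivative (\<tau> + \<phi>' s *\<^sub>R \<nu>)) (at s)"
      unfolding H_def by (auto intro!: derivative_eq_intros)
    then have "((\<lambda>s. q (H s t)) has_derivative (\<lambda>x. E (H s t) \<bullet> (x *\<^sub>R (\<tau> + \<phi>' s *\<^sub>R \<nu>)))) (at s)"
      unfolding has_vector_derivative_def
      by (rule has_derivative_compose[where f = "\<lambda>s. H s t" and g = q]) (rule qder[OF that])
    then show ?thesis by (simp add: has_field_derivative_def m_def mult_commute_abs)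
  qed
  have dt: "((\<lambda>t. q (H s t)) has_real_derivative n s t) (at t)" if "\<bar>s\<bar> \<le> \<rho>" "0 < t" "t \<le> \<kappa>" for s t
  proof -
    have "((\<lambda>t. H s t) has_derivative (\<lambda>x. x *\<^sub>R \<nu>)) (at t)"
      unfolding H_def by (auto intro!: derivative_eq_intros)
    then have "((\<lambda>t. q (H s t)) has_derivative (\<lambda>x. E (H s t) \<bullet> (x *\<^sub>R \<nu>))) (at t)"
      by (rule has_derivative_compose[where f = "H s" and g = q]) (rule qder[OF that])
    then show ?thesis by (simp add: has_field_derivative_def n_def mult_commute_abs)
  qed
  have vert: "\<bar>q (H 0 t) - q (H 0 t')\<bar> \<le> B * \<bar>t - t'\<bar>" if "t \<in> {0<..\<kappa>}" "t' \<in> {0<..\<kappa>}" for t t'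
    unfolding real_norm_def[symmetric]
    by (rule field_differentiable_bound[of "{0<..\<kappa>}" _ "n 0"])
      (use that dt[of 0] B(2)[of 0] \<rho> in \<open>auto intro: has_field_derivative_at_within\<close>)
  have hor: "\<bar>q (H s t) - q (H 0 t)\<bar> \<le> \<epsilon> * \<bar>s\<bar>"
    if "\<bar>s\<bar> \<le> \<rho>" "0 < t" "t \<le> \<kappa>" "\<And>s. \<bar>s\<bar> \<le> \<rho> \<Longrightarrow> \<bar>m s t\<bar> < \<epsilon>" for s t \<epsilon>
  proof -
    have "norm (q (H s t) - q (H 0 t)) \<le> \<epsilon> * norm (s - 0)"
    proof (rule field_differentiable_bound[of "{-\<rho>..\<rho>}" _ "\<lambda>s. m s t"])
      fix z assume "z \<in> {-\<rho>..\<rho>}"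
      then have z: "\<bar>z\<bar> \<le> \<rho>" by auto
      show "((\<lambda>s. q (H s t)) has_field_derivative m z t) (at z within {-\<rho>..\<rho>})"
        by (rule has_field_derivative_at_within[OF ds[OF z that(2,3)]])
      show "norm (m z t) \<le> \<epsilon>" using that(4)[OF z] by simp
    qed (use that(1) \<rho> in auto)
    then show ?thesis by simp
  qed
  define tt where "tt k = \<kappa> / real (Suc k)" for k
  have tt: "tt k \<in> {0<..\<kappa>}" for k using \<kappa> by (auto simp: tt_def field_simps)
  have tt0: "tt \<longlonglongrightarrow> 0" unfolding tt_def by (rule LIMSEQ_Suc[OF lim_const_over_n])
  have "Cauchy (\<lambda>k. q (H 0 (tt k)))"
  proof (rule metric_CauchyI)
    fix \<epsilon> :: real assume \<epsilon>: "0 < \<epsilon>"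
    then obtain N where N: "\<And>i j. i \<ge> N \<Longrightarrow> j \<ge> N \<Longrightarrow> dist (tt i) (tt j) < \<epsilon> / B"
      using metric_CauchyD[OF LIMSEQ_imp_Cauchy[OF tt0], of "\<epsilon> / B"] B(1) by auto
    have "dist (q (H 0 (tt i))) (q (H 0 (tt j))) < \<epsilon>" if "i \<ge> N" "j \<ge> N" for i j
    proof -
      have "dist (q (H 0 (tt i))) (q (H 0 (tt j))) \<le> B * dist (tt i) (tt j)"
        using vert[OF tt tt] by (simp add: dist_real_def)
      also have "\<dots> < \<epsilon>" using N[OF that] B(1) by (simp add: field_simps)
      finally show ?thesis .
    qed
    then show "\<exists>N. \<forall>i\<ge>N. \<forall>j\<ge>N. dist (q (H 0 (tt i))) (q (H 0 (tt j))) < \<epsilon>" by blast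
  qed
  then obtain c where c: "(\<lambda>k. q (H 0 (tt k))) \<longlonglongrightarrow> c"
    using Cauchy_convergent convergent_def by blast
  have vc: "\<bar>q (H 0 t) - c\<bar> \<le> B * t" if "t \<in> {0<..\<kappa>}" for t
  proof (rule tendsto_le[OF sequentially_bot])
    show "(\<lambda>k. \<bar>q (H 0 t) - q (H 0 (tt k))\<bar>) \<longlonglongrightarrow> \<bar>q (H 0 t) - c\<bar>" by (intro tendsto_intros c)
    have "(\<lambda>k. B * \<bar>t - tt k\<bar>) \<longlonglongrightarrow> B * \<bar>t - 0\<bar>" by (intro tendsto_intros tt0)
    then show "(\<lambda>k. B * \<bar>t - tt k\<bar>) \<longlonglongrightarrow> B * t" using that by simp
  qed (use vert[OF that tt] in auto)
  have near: "\<exists>t0>0. \<forall>s t. \<bar>s\<bar> \<le> \<rho> \<and> 0 < t \<and> t < t0 \<longrightarrow> \<bar>q (H s t) - c\<bar> < \<epsilon>" if \<epsilon>: "0 < \<epsilon>" for \<epsilon>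
  proof -
    obtain t1 where t1: "0 < t1" "\<And>s t. \<bar>s\<bar> \<le> \<rho> \<Longrightarrow> 0 \<le> t \<Longrightarrow> t < t1 \<Longrightarrow> t \<le> \<kappa> \<Longrightarrow> \<bar>m s t\<bar> < \<epsilon> / (2 * \<rho>)"
      using msmall[of "\<epsilon> / (2 * \<rho>)"] \<epsilon> \<rho> by auto
    define t0 where "t0 = min (min t1 \<kappa>) (\<epsilon> / (2 * B))"
    have "\<bar>q (H s t) - c\<bar> < \<epsilon>" if st: "\<bar>s\<bar> \<le> \<rho>" "0 < t" "t < t0" for s t
    proof -
      have t: "t < t1" "t \<le> \<kappa>" "t < \<epsilon> / (2 * B)" using st by (auto simp: t0_def)
      have "\<bar>q (H s t) - q (H 0 t)\<bar> \<le> \<epsilon> / (2 * \<rho>) * \<bar>s\<bar>"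
        using st t t1(2) by (intro hor) auto
      also have "\<dots> \<le> \<epsilon> / (2 * \<rho>) * \<rho>" using st \<epsilon> \<rho> by (intro mult_left_mono) auto
      finally have "\<bar>q (H s t) - q (H 0 t)\<bar> \<le> \<epsilon> / 2" using \<rho> by simp
      moreover have "\<bar>q (H 0 t) - c\<bar> \<le> B * t" using vc[of t] st t by simp
      moreover have "B * t < \<epsilon> / 2" using t(3) B(1) by (simp add: field_simps)
      ultimately show ?thesis by linarith
    qed
    moreover have "0 < t0" using t1(1) \<kappa>(1) \<epsilon> B(1) by (simp add: t0_def)
    ultimately show ?thesis by blast
  qed
  have "(q \<longlongrightarrow> c) (at y within \<Omega>)" if y: "y \<in> frontier \<Omega>" "dist p y < \<rho>" for y
  proof (rule tendstoI)
    fix \<epsilon> :: real assume \<epsilon>: "0 < \<epsilon>"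
    from near[OF \<epsilon>] obtain t0 where t0: "0 < t0"
        "\<forall>s t. \<bar>s\<bar> \<le> \<rho> \<and> 0 < t \<and> t < t0 \<longrightarrow> \<bar>q (H s t) - c\<bar> < \<epsilon>"
      by (elim exE conjE)
    define \<sigma> \<theta> where "\<sigma> z = (z - p) \<bullet> \<tau>" and "\<theta> z = (z - p) \<bullet> \<nu>" for z
    have coord: "z = p + \<sigma> z *\<^sub>R \<tau> + \<theta> z *\<^sub>R \<nu>" for z
      using frame_expansion[OF fr(1-3), of "z - p"] by (simp add: \<sigma>_def \<theta>_def algebra_simps)
    have small: "\<bar>\<sigma> z\<bar> < \<rho>" "\<bar>\<theta> z\<bar> < h" if "dist p z < \<rho>" for z
    proof -
      have "\<bar>\<sigma> z\<bar> \<le> norm (z - p) * norm \<tau>" "\<bar>\<theta> z\<bar> \<le> norm (z - p) * norm \<nu>"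
        unfolding \<sigma>_def \<theta>_def by (rule Cauchy_Schwarz_ineq2)+
      then show "\<bar>\<sigma> z\<bar> < \<rho>" "\<bar>\<theta> z\<bar> < h" using that fr \<rho> \<kappa> by (auto simp: dist_norm norm_minus_commute)
    qed
    have in\<Omega>: "z \<in> \<Omega> \<longleftrightarrow> \<phi> (\<sigma> z) < \<theta> z" if "dist p z < \<rho>" for z
      using box[of "\<sigma> z" "\<theta> z"] small[OF that] \<rho> coord[of z] by auto
    have "y \<notin> \<Omega>" using y op by (simp add: frontier_def interior_open)
    then have y0: "\<theta> y - \<phi> (\<sigma> y) \<le> 0" using in\<Omega>[OF y(2)] by simp
    have "isCont \<phi> (\<sigma> y)" using d\<phi>[of "\<sigma> y"] small[OF y(2)] \<rho> by (auto intro: DERIV_isCont)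
    moreover have "(\<sigma> \<longlongrightarrow> \<sigma> y) (at y within \<Omega>)" "(\<theta> \<longlongrightarrow> \<theta> y) (at y within \<Omega>)"
      unfolding \<sigma>_def \<theta>_def by (intro tendsto_intros)+
    ultimately have "((\<lambda>z. \<theta> z - \<phi> (\<sigma> z)) \<longlongrightarrow> \<theta> y - \<phi> (\<sigma> y)) (at y within \<Omega>)"
      by (intro tendsto_diff isCont_tendsto_compose[of _ \<phi>])
    then have ev1: "\<forall>\<^sub>F z in at y within \<Omega>. \<theta> z - \<phi> (\<sigma> z) < t0"
      by (rule order_tendstoD(2)) (use y0 t0(1) in auto)
    have ev2: "\<forall>\<^sub>F z in at y within \<Omega>. dist p z < \<rho>"
    proof -
      have "((\<lambda>z. dist p z) \<longlongrightarrow> dist p y) (at y within \<Omega>)" by (intro tendsto_intros)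
      then show ?thesis using y(2) by (rule order_tendstoD)
    qed
    have ev3: "\<forall>\<^sub>F z in at y within \<Omega>. z \<in> \<Omega>" by (simp add: eventually_at_filter)
    from ev1 ev2 ev3 show "\<forall>\<^sub>F z in at y within \<Omega>. dist (q z) c < \<epsilon>"
    proof eventually_elim
      case (elim z)
      have "H (\<sigma> z) (\<theta> z - \<phi> (\<sigma> z)) = z" using coord[of z] by (simp add: H_def)
      then show ?case
        using t0(2)[rule_format, of "\<sigma> z" "\<theta> z - \<phi> (\<sigma> z)"] in\<Omega>[OF elim(2)] small[OF elim(2)] elim
        by (simp add: dist_real_def less_imp_le)
    qed
  qed
  then show ?thesis using \<rho>(1) by (intro exI[of _ c] exI[of _ \<rho>]) auto
qed

section \<open>Stream functions\<close>

text \<open>The strain kernel is the gradient of a multiple of an angle function; the logarithm is its harmonic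
  conjugate. Unlike the angle it is single-valued, so that no branch has to be chosen.\<close>

definition vortex :: "real \<Rightarrow> real^'n \<Rightarrow> real^2^'n \<Rightarrow> real^2 \<Rightarrow> real" where
  "vortex lam b Z x = (\<Sum>i\<in>UNIV. b $ i / (2 * pi) * ln (norm (cplx lam (x - Z $ i))))"

lemma strain_kernel_components:
  "strain_kernel lam \<beta> x z $ 1 = - (\<beta> / (2 * pi) * (lam * (x - z) $ 2) / (norm (cplx lam (x - z)))\<^sup>2)"
  "strain_kernel lam \<beta> x z $ 2 = \<beta> / (2 * pi) * (lam * (x - z) $ 1) / (norm (cplx lam (x - z)))\<^sup>2"
  unfolding strain_kernel_def norm_Lambda
  by (simp_all add: J_mat_def transpose_def matrix_vector_mult_def sum_2 del: vector_minus_component)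

lemma continuous_on_strain_kernel:
  assumes "lam \<noteq> 0" "continuous_on S f" "continuous_on S g" "\<And>s. s \<in> S \<Longrightarrow> f s \<noteq> g s"
  shows "continuous_on S (\<lambda>s. strain_kernel lam \<beta> (f s) (g s))"
proof -
  have cc: "continuous_on S (\<lambda>s. cplx lam (f s - g s))"
    using assms by (intro bounded_linear.continuous_on[OF bounded_linear_cplx] continuous_on_diff)
  have cj: "continuous_on S (\<lambda>s. transpose J_mat *v (f s - g s))"
    using assms by (intro bounded_linear.continuous_on[OF matrix_vector_mul_bounded_linear] continuous_on_diff)
  have "norm (cplx lam (f s - g s)) \<noteq> 0" if "s \<in> S" for s
    using norm_cplx_pos[OF assms(1) assms(4)[OF that]] by simp
  then show ?thesis
    unfolding strain_kernel_def norm_Lambda by (intro continuous_intros cc cj) auto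
qed

text \<open>The derivative of the logarithm is the strain kernel turned by a right angle, in stretched
  coordinates.\<close>

lemma vortex_term_derivative:
  assumes lam: "lam \<noteq> 0" and xz: "x \<noteq> z"
  shows "((\<lambda>x. \<beta> / (2 * pi) * ln (norm (cplx lam (x - z)))) has_derivative
    (\<lambda>v. vector [lam * (strain_kernel lam \<beta> x z $ 2), - (strain_kernel lam \<beta> x z $ 1) / lam] \<bullet> v)) (at x)"
proof -
  define P where "P y = (lam * (y $ 1 - z $ 1))\<^sup>2 + (y $ 2 - z $ 2)\<^sup>2" for y :: "real^2"
  have nP: "norm (cplx lam (y - z)) = sqrt (P y)" for y
    by (simp add: cplx_def cmod_def P_def)
  have P0: "0 < P x" using norm_cplx_pos[OF lam xz] by (simp add: nP)
  have comp: "((\<lambda>y. y $ i) has_derivative (\<lambda>v. v $ i)) (at x)" for i :: 2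
    by (rule bounded_linear_imp_has_derivative[OF bounded_linear_vec_nth])
  have "((\<lambda>y. P y) has_derivative (\<lambda>v. 2 * lam\<^sup>2 * (x $ 1 - z $ 1) * v $ 1 + 2 * (x $ 2 - z $ 2) * v $ 2)) (at x)"
    unfolding P_def by (rule derivative_eq_intros comp refl)+ (simp add: power2_eq_square algebra_simps)
  then have "((\<lambda>y. ln (P y)) has_derivative (\<lambda>v. (2 * lam\<^sup>2 * (x $ 1 - z $ 1) * v $ 1 + 2 * (x $ 2 - z $ 2) * v $ 2) * inverse (P x))) (at x)"
    using P0 by (auto intro!: derivative_eq_intros simp: divide_inverse)
  then have "((\<lambda>y. \<beta> / (4 * pi) * ln (P y)) has_derivative (\<lambda>v. \<beta> / (4 * pi) * ((2 * lam\<^sup>2 * (x $ 1 - z $ 1) * v $ 1 + 2 * (x $ 2 - z $ 2) * v $ 2) * inverse (P x)))) (at x)"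
    by (rule has_derivative_mult_right)
  moreover have "(\<lambda>y. \<beta> / (2 * pi) * ln (norm (cplx lam (y - z)))) = (\<lambda>y. \<beta> / (4 * pi) * ln (P y))"
  proof
    fix y
    have "0 \<le> P y" by (simp add: P_def)
    then have ls: "ln (sqrt (P y)) = ln (P y) / 2" by (cases "P y = 0") (auto simp: ln_sqrt)
    show "\<beta> / (2 * pi) * ln (norm (cplx lam (y - z))) = \<beta> / (4 * pi) * ln (P y)"
      unfolding nP ls by simp
  qed
  moreover have "(\<lambda>v :: real^2. vector [lam * (strain_kernel lam \<beta> x z $ 2), - (strain_kernel lam \<beta> x z $ 1) / lam] \<bullet> v) =
      (\<lambda>v. \<beta> / (4 * pi) * ((2 * lam\<^sup>2 * (x $ 1 - z $ 1) * v $ 1 + 2 * (x $ 2 - z $ 2) * v $ 2) * inverse (P x)))"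
  proof
    fix v :: "real^2"
    have "(norm (cplx lam (x - z)))\<^sup>2 = P x" using P0 by (simp add: nP)
    then show "vector [lam * (strain_kernel lam \<beta> x z $ 2), - (strain_kernel lam \<beta> x z $ 1) / lam] \<bullet> v =
        \<beta> / (4 * pi) * ((2 * lam\<^sup>2 * (x $ 1 - z $ 1) * v $ 1 + 2 * (x $ 2 - z $ 2) * v $ 2) * inverse (P x))"
      using lam P0 by (simp add: inner_vec_def sum_2 strain_kernel_components field_simps power2_eq_square)
  qed
  ultimately show ?thesis by simp
qed

lemma vortex_derivative:
  assumes lam: "lam \<noteq> 0" and xz: "\<And>i. x \<noteq> Z $ i"
    and K: "K = (\<Sum>i\<in>UNIV. strain_kernel lam (b $ i) x (Z $ i))"
  shows "(vortex lam b Z has_derivative (\<lambda>v. vector [lam * K $ 2, - (K $ 1) / lam] \<bullet> v)) (at x)"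
proof -
  have "(vortex lam b Z has_derivative (\<lambda>v. \<Sum>i\<in>UNIV. vector [lam * (strain_kernel lam (b $ i) x (Z $ i) $ 2), - (strain_kernel lam (b $ i) x (Z $ i) $ 1) / lam] \<bullet> v)) (at x)"
    unfolding vortex_def[abs_def] by (intro has_derivative_sum vortex_term_derivative lam xz)
  also have "(\<lambda>v :: real^2. \<Sum>i\<in>UNIV. vector [lam * (strain_kernel lam (b $ i) x (Z $ i) $ 2), - (strain_kernel lam (b $ i) x (Z $ i) $ 1) / lam] \<bullet> v) =
    (\<lambda>v. vector [lam * K $ 2, - (K $ 1) / lam] \<bullet> v)"
  proof
    fix v :: "real^2"
    have inner2: "vector [p, q] \<bullet> v = p * v $ 1 + q * v $ 2" for p q
      by (simp add: inner_vec_def sum_2)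
    show "(\<Sum>i\<in>UNIV. vector [lam * (strain_kernel lam (b $ i) x (Z $ i) $ 2), - (strain_kernel lam (b $ i) x (Z $ i) $ 1) / lam] \<bullet> v) =
        vector [lam * K $ 2, - (K $ 1) / lam] \<bullet> v"
      unfolding inner2 K
      by (simp add: sum.distrib sum_distrib_left sum_distrib_right sum_divide_distrib sum_negf sum_subtractf)
  qed
  finally show ?thesis .
qed

lemma frontier_at_within_nontrivial:
  assumes "open \<Omega>" "p \<in> frontier \<Omega>"
  shows "at p within \<Omega> \<noteq> bot"
proof -
  have "p \<in> closure \<Omega>" "p \<notin> \<Omega>" using assms by (auto simp: frontier_def interior_open)
  then have "p islimpt \<Omega>" by (simp add: closure_def)
  then show ?thesis by (simp add: trivial_limit_within)
qed

text \<open>The gradient of \<open>q = Im F - vortex\<close> is the rotated flux \<open>L (\<nabla>u + K)\<close> up to a constant factor, hence normal to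
  the boundary there by the Neumann condition. So \<open>q\<close> has locally constant boundary values, and they
  are constant because the frontier is connected.\<close>

lemma stream_function:
  fixes b :: "real^'n"
  assumes \<Omega>: "open \<Omega>" "bounded \<Omega>" "simply_connected \<Omega>" "C2_holder_boundary \<gamma> \<Omega>"
    and par: "\<mu> > 0" "lam \<noteq> 0" and Z: "\<And>i. Z $ i \<in> \<Omega>"
    and u: "neumann_solution \<Omega> (L_mat \<mu> lam) (\<lambda>x. \<Sum>i\<in>UNIV. strain_kernel lam (b $ i) x (Z $ i)) u"
  obtains F where "\<And>w. w \<in> cplx lam ` \<Omega> \<Longrightarrow> (F has_field_derivative cgrad lam u w) (at w)"
    "\<And>p. p \<in> frontier \<Omega> \<Longrightarrow> ((\<lambda>x. Im (F (cplx lam x)) - vortex lam b Z x) \<longlongrightarrow> 0) (at p within \<Omega>)"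
proof -
  define K where "K x = (\<Sum>i\<in>UNIV. strain_kernel lam (b $ i) x (Z $ i))" for x
  have C2: "C2_on u \<Omega>" and div0: "\<And>x. x \<in> \<Omega> \<Longrightarrow> divergence (\<lambda>y. L_mat \<mu> lam *v grad u y) x = 0"
    using u by (auto simp: neumann_solution_def)
  obtain G where G: "continuous_on (closure \<Omega>) G" "\<And>x. x \<in> \<Omega> \<Longrightarrow> G x = grad u x"
    and bc: "\<And>x. x \<in> frontier \<Omega> \<Longrightarrow> (L_mat \<mu> lam *v (G x + K x)) \<bullet> outer_unit_normal \<Omega> x = 0"
    using u unfolding neumann_solution_def K_def by blast
  let ?S = "cplx lam ` \<Omega>"
  have opS: "open ?S" by (rule open_cplx_image[OF par(2) \<Omega>(1)])
  have "cgrad lam u holomorphic_on ?S" by (rule cgrad_holomorphic[OF \<Omega>(1) par C2 div0])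
  then obtain F where F: "\<And>w. w \<in> ?S \<Longrightarrow> (F has_field_derivative cgrad lam u w) (at w)"
    using simply_connected_eq_global_primitive[OF opS] simply_connected_cplx_image[OF par(2) \<Omega>(3)] by meson
  define q where "q x = Im (F (cplx lam x)) - vortex lam b Z x" for x
  \<comment> \<open>the flux turned by a right angle, scaled to be the gradient of \<open>q\<close>\<close>
  define E where "E x = (1 / (lam * \<mu>)) *\<^sub>R (vector [- ((L_mat \<mu> lam *v (G x + K x)) $ 2), (L_mat \<mu> lam *v (G x + K x)) $ 1] :: real^2)" for x
  have Ecomp: "E x $ 1 = - (lam * (G x $ 2 + K x $ 2))" "E x $ 2 = (G x $ 1 + K x $ 1) / lam" for x
    using par by (simp_all add: E_def L_mat_def matrix_vector_mult_def sum_2 field_simps power2_eq_square)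
  have dq: "(q has_derivative (\<lambda>v. E x \<bullet> v)) (at x)" if x: "x \<in> \<Omega>" "\<And>i. x \<noteq> Z $ i" for x
  proof -
    have 0: "(cplx lam has_derivative cplx lam) (at x)"
      by (rule bounded_linear_imp_has_derivative[OF bounded_linear_cplx])
    have 1: "(F has_derivative (*) (cgrad lam u (cplx lam x))) (at (cplx lam x))"
      using F[of "cplx lam x"] x by (simp add: has_field_derivative_def)
    have 2: "((\<lambda>x. Im (F (cplx lam x))) has_derivative (\<lambda>v. Im (cgrad lam u (cplx lam x) * cplx lam v))) (at x)"
      by (rule bounded_linear.has_derivative[OF bounded_linear_Im has_derivative_compose[OF 0 1]])
    have dq0: "(q has_derivative (\<lambda>v. Im (cgrad lam u (cplx lam x) * cplx lam v) - vector [lam * K x $ 2, - (K x $ 1) / lam] \<bullet> v)) (at x)"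
      unfolding q_def[abs_def] by (intro has_derivative_diff 2 vortex_derivative par x K_def)
    have c: "cgrad lam u (cplx lam x) = Complex (G x $ 1 / lam) (- (G x $ 2))"
      using par by (simp add: cgrad_def uncplx_cplx G(2)[OF x(1)])
    have "(\<lambda>v. Im (cgrad lam u (cplx lam x) * cplx lam v) - vector [lam * K x $ 2, - (K x $ 1) / lam] \<bullet> v) = (\<lambda>v. E x \<bullet> v)"
      unfolding c using par by (simp add: fun_eq_iff inner_vec_def sum_2 Ecomp cplx_def field_simps)
    then show ?thesis using dq0 by simp
  qed
  have local: "\<exists>c. \<exists>\<delta>>0. \<forall>y \<in> frontier \<Omega> \<inter> ball p \<delta>. (q \<longlongrightarrow> c) (at y within \<Omega>)" if p: "p \<in> frontier \<Omega>" for p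
  proof -
    obtain \<tau> \<nu> \<phi> r h where e: "local_epigraph \<Omega> p \<tau> \<nu> \<phi> r h" and hol: "holder_C2_on \<gamma> \<phi> {-r<..<r}"
      using \<Omega>(4) p unfolding C2_holder_boundary_def by meson
    obtain \<phi>' \<phi>'' where d\<phi>: "\<forall>s\<in>{-r<..<r}. (\<phi> has_real_derivative \<phi>' s) (at s)"
      and d\<phi>': "\<forall>s\<in>{-r<..<r}. (\<phi>' has_real_derivative \<phi>'' s) (at s)"
      using hol unfolding holder_C2_on_def by blast
    have d\<phi>1: "(\<phi> has_real_derivative \<phi>' s) (at s)" if "\<bar>s\<bar> < r" for s using bspec[OF d\<phi>, of s] that by (simp add: abs_less_iff)
    have pZ: "p \<notin> range (\<lambda>i. Z $ i)" using p Z \<Omega>(1) by (auto simp: frontier_def interior_open)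
    have "open (- range (\<lambda>i. Z $ i))" by (simp add: finite_imp_closed open_Compl)
    then obtain d where d: "0 < d" "ball p d \<subseteq> - range (\<lambda>i. Z $ i)"
      using pZ open_contains_ball by blast
    have dZ: "x \<noteq> Z $ i" if "dist p x < d" for x i using d(2) that by auto
    show ?thesis
    proof (rule locally_constant_boundary_limit[OF \<Omega>(1) e d\<phi>1 _ d(1), where E = E])
      show "continuous_on {-r<..<r} \<phi>'"
        by (intro continuous_at_imp_continuous_on ballI DERIV_isCont[OF bspec[OF d\<phi>']])
      show "(q has_derivative (\<lambda>v. E x \<bullet> v)) (at x)" if "x \<in> \<Omega>" "dist p x < d" for x
        using dq that dZ by blast
      have cK: "continuous_on (closure \<Omega> \<inter> ball p d) K"
        unfolding K_def using dZ
        by (intro continuous_on_sum continuous_on_strain_kernel[OF par(2)] continuous_intros) auto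
      have cW: "continuous_on (closure \<Omega> \<inter> ball p d) (\<lambda>x. L_mat \<mu> lam *v (G x + K x))"
        by (intro linear_continuous_on_compose[of _ _ "(*v) (L_mat \<mu> lam)"] matrix_vector_mul_linear continuous_on_add cK continuous_on_subset[OF G(1)]) auto
      have "continuous_on (closure \<Omega> \<inter> ball p d) (\<lambda>x. vector [- ((L_mat \<mu> lam *v (G x + K x)) $ 2), (L_mat \<mu> lam *v (G x + K x)) $ 1] :: real^2)"
        unfolding continuous_on_componentwise[where 'b = "real^2"] Basis_vec_def
        by (auto simp: inner_axis forall_2 intro!: continuous_intros cW)
      then show "continuous_on (closure \<Omega> \<inter> ball p d) E"
        unfolding E_def by (intro continuous_intros)
      fix s assume s: "\<bar>s\<bar> < r" and ds: "dist p (p + s *\<^sub>R \<tau> + \<phi> s *\<^sub>R \<nu>) < d"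
      show "E (p + s *\<^sub>R \<tau> + \<phi> s *\<^sub>R \<nu>) \<bullet> (\<tau> + \<phi>' s *\<^sub>R \<nu>) = 0"
        unfolding E_def inner_scaleR_left
        using normal_condition_on_graph(2)[OF e \<Omega>(1) d\<phi>1 s bc[OF normal_condition_on_graph(1)[OF e \<Omega>(1) d\<phi>1 s]]]
        by simp
    qed
  qed
  define bv where "bv p = Lim (at p within \<Omega>) q" for p
  have lc: "\<exists>T. openin (top_of_set (frontier \<Omega>)) T \<and> p \<in> T \<and> (\<forall>x\<in>T. bv x = bv p \<and> (q \<longlongrightarrow> bv p) (at x within \<Omega>))"
    if p: "p \<in> frontier \<Omega>" for p
  proof -
    obtain c \<delta> where \<delta>: "0 < \<delta>" "\<And>y. y \<in> frontier \<Omega> \<inter> ball p \<delta> \<Longrightarrow> (q \<longlongrightarrow> c) (at y within \<Omega>)"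
      using local[OF p] by blast
    have "bv y = c" if "y \<in> frontier \<Omega> \<inter> ball p \<delta>" for y
      unfolding bv_def using that frontier_at_within_nontrivial[OF \<Omega>(1)]
      by (intro tendsto_Lim \<delta>(2)) auto
    then show ?thesis using p \<delta> by (intro exI[of _ "frontier \<Omega> \<inter> ball p \<delta>"]) (auto simp: openin_open_Int)
  qed
  have "bv constant_on frontier \<Omega>"
  proof (rule locally_constant_imp_constant[OF connected_frontier_planar[OF \<Omega>(1-3)]])
    fix p assume "p \<in> frontier \<Omega>"
    from lc[OF this] obtain T where T: "openin (top_of_set (frontier \<Omega>)) T" "p \<in> T"
        "\<forall>x\<in>T. bv x = bv p \<and> (q \<longlongrightarrow> bv p) (at x within \<Omega>)"
      by (elim exE conjE)
    show "\<exists>T. openin (top_of_set (frontier \<Omega>)) T \<and> p \<in> T \<and> (\<forall>x\<in>T. bv x = bv p)"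
    proof (rule exI[of _ T], intro conjI ballI)
      show "bv x = bv p" if "x \<in> T" for x using bspec[OF T(3) that] by (rule conjunct1)
    qed (rule T(1), rule T(2))
  qed
  then obtain c where c: "\<And>p. p \<in> frontier \<Omega> \<Longrightarrow> bv p = c" by (auto simp: constant_on_def)
  have lim: "(q \<longlongrightarrow> c) (at p within \<Omega>)" if "p \<in> frontier \<Omega>" for p
    using lc[OF that] unfolding c[OF that] by blast
  show ?thesis
  proof (rule that[of "\<lambda>w. F w - \<i> * complex_of_real c"])
    show "((\<lambda>w. F w - \<i> * complex_of_real c) has_field_derivative cgrad lam u w) (at w)" if "w \<in> ?S" for w
      using DERIV_diff[OF F[OF that] DERIV_const] by simp
    show "((\<lambda>x. Im (F (cplx lam x) - \<i> * complex_of_real c) - vortex lam b Z x) \<longlongrightarrow> 0) (at p within \<Omega>)"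
      if "p \<in> frontier \<Omega>" for p
      using tendsto_diff[OF lim[OF that] tendsto_const[of c]] by (simp add: q_def algebra_simps)
  qed
qed

text \<open>The difference \<open>g\<close> of the two primitives is holomorphic in all of \<open>\<Omega>\<close>, and the boundary values of \<open>Im g\<close>
  are the difference of the two explicit potentials.\<close>

lemma cgrad_stability:
  fixes b :: "real^'n"
  assumes \<Omega>: "open \<Omega>" "bounded \<Omega>" "simply_connected \<Omega>" "C2_holder_boundary \<gamma> \<Omega>"
    and par: "\<mu> > 0" "lam \<noteq> 0" and Z: "\<And>i. Z $ i \<in> \<Omega>" "\<And>i. Z' $ i \<in> \<Omega>"
    and u: "neumann_solution \<Omega> (L_mat \<mu> lam) (\<lambda>x. \<Sum>i\<in>UNIV. strain_kernel lam (b $ i) x (Z $ i)) u"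
    and u': "neumann_solution \<Omega> (L_mat \<mu> lam) (\<lambda>x. \<Sum>i\<in>UNIV. strain_kernel lam (b $ i) x (Z' $ i)) u'"
    and e: "0 < e" "\<And>p. p \<in> frontier \<Omega> \<Longrightarrow> \<bar>vortex lam b Z p - vortex lam b Z' p\<bar> < e"
    and R: "0 < R" "cball w R \<subseteq> cplx lam ` \<Omega>"
  shows "norm (cgrad lam u w - cgrad lam u' w) \<le> exp 2 * e / R"
proof -
  let ?S = "cplx lam ` \<Omega>"
  have opS: "open ?S" by (rule open_cplx_image[OF par(2) \<Omega>(1)])
  have bS: "bounded ?S" using \<Omega>(2) by (intro bounded_linear_image bounded_linear_cplx)
  obtain F where F: "\<And>w. w \<in> ?S \<Longrightarrow> (F has_field_derivative cgrad lam u w) (at w)"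
    "\<And>p. p \<in> frontier \<Omega> \<Longrightarrow> ((\<lambda>x. Im (F (cplx lam x)) - vortex lam b Z x) \<longlongrightarrow> 0) (at p within \<Omega>)"
    using stream_function[OF \<Omega> par Z(1) u] by blast
  obtain F' where F': "\<And>w. w \<in> ?S \<Longrightarrow> (F' has_field_derivative cgrad lam u' w) (at w)"
    "\<And>p. p \<in> frontier \<Omega> \<Longrightarrow> ((\<lambda>x. Im (F' (cplx lam x)) - vortex lam b Z' x) \<longlongrightarrow> 0) (at p within \<Omega>)"
    using stream_function[OF \<Omega> par Z(2) u'] by blast
  define g where "g w = F w - F' w" for w
  have dg: "(g has_field_derivative (cgrad lam u w - cgrad lam u' w)) (at w)" if "w \<in> ?S" for w
    unfolding g_def by (intro DERIV_diff F F' that)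
  have hol: "g holomorphic_on ?S" using dg opS by (metis holomorphic_on_open)
  have ev: "\<forall>\<^sub>F w in at p within ?S. \<bar>Im (g w)\<bar> < e" if p: "p \<in> frontier ?S" for p
  proof -
    obtain p' where p': "p' \<in> frontier \<Omega>" "p = cplx lam p'"
      using p frontier_cplx_image[OF par(2) \<Omega>(1)] by auto
    have cont: "(vortex lam b Y \<longlongrightarrow> vortex lam b Y p') (at p' within \<Omega>)" if "\<And>i. Y $ i \<in> \<Omega>" for Y :: "real^2^'n"
    proof -
      have "p' \<noteq> Y $ i" for i using p' that \<Omega>(1) by (auto simp: frontier_def interior_open)
      then have "isCont (vortex lam b Y) p'"
        using vortex_derivative[OF par(2) _ refl] has_derivative_continuous by blast
      then show ?thesis by (meson continuous_at_imp_continuous_at_within continuous_within)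
    qed
    have "((\<lambda>x. (Im (F (cplx lam x)) - vortex lam b Z x) - (Im (F' (cplx lam x)) - vortex lam b Z' x) + (vortex lam b Z x - vortex lam b Z' x))
       \<longlongrightarrow> 0 - 0 + (vortex lam b Z p' - vortex lam b Z' p')) (at p' within \<Omega>)"
      by (intro tendsto_add tendsto_diff F(2) F'(2) p' cont Z)
    then have "((\<lambda>x. \<bar>Im (g (cplx lam x))\<bar>) \<longlongrightarrow> \<bar>vortex lam b Z p' - vortex lam b Z' p'\<bar>) (at p' within \<Omega>)"
      by (intro tendsto_rabs) (simp add: g_def)
    from tendsto_cplx_image[OF par(2) this]
    have "((\<lambda>w. \<bar>Im (g w)\<bar>) \<longlongrightarrow> \<bar>vortex lam b Z p' - vortex lam b Z' p'\<bar>) (at p within ?S)"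
      by (simp add: cplx_uncplx par p'(2))
    then show ?thesis using e(2)[OF p'(1)] by (rule order_tendstoD)
  qed
  have bd: "\<bar>Im (g w) - 0\<bar> \<le> e" if w: "w \<in> ?S" for w
  proof -
    have "Im (g w) \<le> e"
      by (rule Im_le_boundary_bound[OF opS bS hol _ w]) (rule eventually_mono[OF ev], auto)
    moreover have "Im (- g w) \<le> e"
      by (rule Im_le_boundary_bound[OF opS bS _ _ w]) (auto intro: holomorphic_intros hol eventually_mono[OF ev])
    ultimately show ?thesis by simp
  qed
  have "w \<in> ?S" using R by auto
  then have "deriv g w = cgrad lam u w - cgrad lam u' w" using dg DERIV_imp_deriv by blast
  then show ?thesis using deriv_bound_by_Im[OF opS hol R e(1) bd] by simp
qed

section \<open>Continuity of the Peach-Koehler force\<close>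

lemma open_configurations:
  assumes "open \<Omega>"
  shows "open (configurations \<Omega> :: (real^2^'n) set)"
proof -
  have "open {Z :: real^2^'n. Z $ i \<in> \<Omega>}" for i
    using open_vimage[OF assms, of "\<lambda>Z :: real^2^'n. Z $ i"] by (simp add: vimage_def continuous_intros)
  moreover have "open {Z :: real^2^'n. j \<noteq> k \<longrightarrow> Z $ j \<noteq> Z $ k}" for j k
    by (cases "j = k") (auto intro!: open_Collect_neq continuous_intros)
  moreover have "configurations \<Omega> = (\<Inter>i. {Z :: real^2^'n. Z $ i \<in> \<Omega>}) \<inter> (\<Inter>j. \<Inter>k. {Z. j \<noteq> k \<longrightarrow> Z $ j \<noteq> Z $ k})"
    by (auto simp: configurations_def)
  ultimately show ?thesis by (auto intro!: open_Int open_INT)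
qed

text \<open>The potential is jointly continuous in the configuration and the point, because configurations stay
  inside \<open>\<Omega>\<close>; on a compact ball of configurations times the compact frontier it is uniformly
  continuous.\<close>

lemma vortex_uniformly_close:
  fixes Z :: "real^2^'n" and b :: "real^'n"
  assumes lam: "lam \<noteq> 0" and \<Omega>: "open \<Omega>" "bounded \<Omega>" and Z: "Z \<in> configurations \<Omega>" and e: "0 < e"
  shows "\<exists>d>0. \<forall>Z'. dist Z' Z < d \<longrightarrow> Z' \<in> configurations \<Omega> \<and>
    (\<forall>p\<in>frontier \<Omega>. \<bar>vortex lam b Z p - vortex lam b Z' p\<bar> < e)"
proof -
  obtain d0 where d0: "0 < d0" "cball Z d0 \<subseteq> configurations \<Omega>"
    using open_configurations[OF \<Omega>(1)] Z open_contains_cball by blast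
  let ?S = "cball Z d0 \<times> frontier \<Omega>"
  have ne: "norm (cplx lam (snd s - fst s $ i)) \<noteq> 0" if "s \<in> ?S" for s i
  proof -
    have "fst s $ i \<in> \<Omega>" using that d0 by (auto simp: configurations_def)
    moreover have "snd s \<notin> \<Omega>" using that \<Omega>(1) by (auto simp: frontier_def interior_open)
    ultimately show ?thesis using norm_cplx_pos[OF lam, of "snd s" "fst s $ i"] by force
  qed
  have "continuous_on ?S (\<lambda>s. vortex lam b (fst s) (snd s))"
    unfolding vortex_def
    by (intro continuous_intros bounded_linear.continuous_on[OF bounded_linear_cplx] ballI ne)
  moreover have "compact ?S"
    using \<Omega>(2) by (intro compact_Times compact_frontier_bounded) auto
  ultimately have "uniformly_continuous_on ?S (\<lambda>s. vortex lam b (fst s) (snd s))"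
    by (rule compact_uniformly_continuous)
  then obtain d1 where d1: "0 < d1"
    "\<forall>s\<in>?S. \<forall>s'\<in>?S. dist s' s < d1 \<longrightarrow> dist (vortex lam b (fst s') (snd s')) (vortex lam b (fst s) (snd s)) < e"
    using e unfolding uniformly_continuous_on_def by blast
  show ?thesis
  proof (rule exI[of _ "min d0 d1"], intro conjI allI impI ballI)
    show "0 < min d0 d1" using d0 d1 by simp
    fix Z' assume Z': "dist Z' Z < min d0 d1"
    then have in0: "Z' \<in> cball Z d0" by (simp add: dist_commute)
    then show "Z' \<in> configurations \<Omega>" using d0 by blast
    fix p assume p: "p \<in> frontier \<Omega>"
    have "(Z, p) \<in> ?S" "(Z', p) \<in> ?S" using p in0 d0 by auto
    moreover have "dist (Z, p) (Z', p) < d1" using Z' by (simp add: dist_Pair_Pair dist_commute)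
    ultimately have "dist (vortex lam b (fst (Z, p)) (snd (Z, p))) (vortex lam b (fst (Z', p)) (snd (Z', p))) < e"
      using d1(2) by blast
    then show "\<bar>vortex lam b Z p - vortex lam b Z' p\<bar> < e" by (simp add: dist_real_def)
  qed
qed

text \<open>Both the function \<open>cgrad lam (u0 Z)\<close> and the point of evaluation vary with \<open>Z\<close>. The first variation is
  controlled by stability, uniformly near \<open>Z $ l\<close>, the second by continuity of one holomorphic function.\<close>

lemma continuous_on_cgrad_response:
  fixes b :: "real^'n"
  assumes \<Omega>: "open \<Omega>" "bounded \<Omega>" "simply_connected \<Omega>" "C2_holder_boundary \<gamma> \<Omega>"
    and par: "\<mu> > 0" "lam \<noteq> 0" and u0: "is_boundary_response \<Omega> \<mu> lam b u0"
  shows "continuous_on (configurations \<Omega>) (\<lambda>Z. cgrad lam (u0 Z) (cplx lam (Z $ l)))"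
  unfolding continuous_on_iff
proof (intro ballI allI impI)
  fix Z :: "real^2^'n" and e :: real
  assume Z: "Z \<in> configurations \<Omega>" and e: "0 < e"
  have sol: "neumann_solution \<Omega> (L_mat \<mu> lam) (\<lambda>x. \<Sum>i\<in>UNIV. strain_kernel lam (b $ i) x (Y $ i)) (u0 Y)"
    and inO: "Y $ i \<in> \<Omega>" if "Y \<in> configurations \<Omega>" for Y i
    using u0 that by (auto simp: is_boundary_response_def configurations_def)
  let ?S = "cplx lam ` \<Omega>"
  define w where "w Y = cplx lam (Y $ l)" for Y :: "real^2^'n"
  have opS: "open ?S" by (rule open_cplx_image[OF par(2) \<Omega>(1)])
  have wS: "w Z \<in> ?S" using inO[OF Z] by (simp add: w_def)
  obtain R where R: "0 < R" "ball (w Z) (2 * R) \<subseteq> ?S"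
  proof -
    obtain r where "0 < r" "ball (w Z) r \<subseteq> ?S" using opS wS open_contains_ball by blast
    then show thesis using that[of "r / 2"] by simp
  qed
  have "cgrad lam (u0 Z) holomorphic_on ?S"
    using sol[OF Z] by (intro cgrad_holomorphic[OF \<Omega>(1) par]) (auto simp: neumann_solution_def)
  then have "isCont (cgrad lam (u0 Z)) (w Z)"
    using opS wS holomorphic_on_imp_continuous_on continuous_on_eq_continuous_at by blast
  then obtain d1 where d1: "0 < d1" "\<And>y. dist y (w Z) < d1 \<Longrightarrow> dist (cgrad lam (u0 Z) y) (cgrad lam (u0 Z) (w Z)) < e / 2"
    using e unfolding continuous_at_eps_delta by (metis half_gt_zero)
  \<comment> \<open>makes the bound \<open>exp 2 * \<eta> / R\<close> of \<open>cgrad_stability\<close> equal to \<open>e / 4\<close>\<close>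
  define \<eta> where "\<eta> = e * R / (4 * exp 2)"
  have \<eta>: "0 < \<eta>" using e R by (simp add: \<eta>_def)
  obtain d2 where d2: "0 < d2" "\<And>Z'. dist Z' Z < d2 \<Longrightarrow> Z' \<in> configurations \<Omega> \<and>
      (\<forall>p\<in>frontier \<Omega>. \<bar>vortex lam b Z p - vortex lam b Z' p\<bar> < \<eta>)"
    using vortex_uniformly_close[OF par(2) \<Omega>(1,2) Z \<eta>] by blast
  have "isCont w Z"
    unfolding w_def by (intro bounded_linear.isCont[OF bounded_linear_cplx] continuous_intros)
  then obtain d3 where d3: "0 < d3" "\<And>Z'. dist Z' Z < d3 \<Longrightarrow> dist (w Z') (w Z) < min R d1"
    using R d1 unfolding continuous_at_eps_delta by (metis min_less_iff_conj)
  show "\<exists>d>0. \<forall>Z'\<in>configurations \<Omega>. dist Z' Z < d \<longrightarrow>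
      dist (cgrad lam (u0 Z') (cplx lam (Z' $ l))) (cgrad lam (u0 Z) (cplx lam (Z $ l))) < e"
  proof (rule exI[of _ "min d2 d3"], intro conjI ballI impI)
    show "0 < min d2 d3" using d2 d3 by simp
    fix Z' :: "real^2^'n" assume Z': "Z' \<in> configurations \<Omega>" "dist Z' Z < min d2 d3"
    have near: "dist (w Z') (w Z) < min R d1" using d3 Z' by simp
    have sub: "cball (w Z') R \<subseteq> ?S"
    proof -
      have "cball (w Z') R \<subseteq> ball (w Z) (2 * R)"
        using near by (auto simp: subset_iff) (smt (verit) dist_commute dist_triangle)
      then show ?thesis using R(2) by blast
    qed
    have "norm (cgrad lam (u0 Z) (w Z') - cgrad lam (u0 Z') (w Z')) \<le> exp 2 * \<eta> / R"
      by (rule cgrad_stability[OF \<Omega> par inO[OF Z] inO[OF Z'(1)] sol[OF Z] sol[OF Z'(1)] \<eta> _ R(1) sub])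
        (use d2(2)[of Z'] Z' in auto)
    also have "\<dots> < e / 2" using e R by (simp add: \<eta>_def)
    finally have "dist (cgrad lam (u0 Z') (w Z')) (cgrad lam (u0 Z) (w Z')) < e / 2"
      by (simp add: dist_norm norm_minus_commute)
    moreover have "dist (cgrad lam (u0 Z) (w Z')) (cgrad lam (u0 Z) (w Z)) < e / 2"
      using d1(2) near by simp
    ultimately have "dist (cgrad lam (u0 Z') (w Z')) (cgrad lam (u0 Z) (w Z)) < e"
      by (rule dist_triangle_half_l[OF _ dist_commute_lessI])
    then show "dist (cgrad lam (u0 Z') (cplx lam (Z' $ l))) (cgrad lam (u0 Z) (cplx lam (Z $ l))) < e"
      by (simp add: w_def)
  qed
qed

lemma continuous_on_peach_koehler:
  fixes b :: "real^'n"
  assumes \<Omega>: "open \<Omega>" "bounded \<Omega>" "simply_connected \<Omega>" "C2_holder_boundary \<gamma> \<Omega>"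
    and par: "\<mu> > 0" "lam \<noteq> 0" and u0: "is_boundary_response \<Omega> \<mu> lam b u0"
  shows "continuous_on (configurations \<Omega>) (peach_koehler \<mu> lam b u0 l)"
proof -
  have bl: "bounded_linear (\<lambda>c. vector [lam * Re c, - Im c] :: real^2)"
    unfolding linear_conv_bounded_linear[symmetric]
    by (rule linearI) (simp_all add: vec_eq_iff forall_2 algebra_simps)
  have "grad u x = vector [lam * Re (cgrad lam u (cplx lam x)), - Im (cgrad lam u (cplx lam x))]" for u x
    using par by (simp add: vec_eq_iff forall_2 cgrad_def uncplx_cplx)
  then have cg: "continuous_on (configurations \<Omega>) (\<lambda>Z. grad (u0 Z) (Z $ l))"
    using bounded_linear.continuous_on[OF bl continuous_on_cgrad_response[OF assms]] by simp
  have "continuous_on (configurations \<Omega>) (\<lambda>Z. strain_kernel lam (b $ i) (Z $ l) (Z $ i))" if "i \<in> UNIV - {l}" for i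
    using that by (intro continuous_on_strain_kernel par continuous_intros) (auto simp: configurations_def)
  then show ?thesis
    unfolding peach_koehler_def[abs_def]
    by (intro continuous_on_scaleR continuous_on_const bounded_linear.continuous_on[OF matrix_vector_mul_bounded_linear]
        continuous_on_add continuous_on_sum cg) auto
qed

section \<open>Glide velocities\<close>

lemma glide_velocities_iff:
  "v \<in> glide_velocities G f \<longleftrightarrow> (\<exists>g\<in>G. v = (f \<bullet> g) *\<^sub>R g \<and> (\<forall>g'\<in>G. f \<bullet> g' \<le> f \<bullet> g))"
  by (auto simp: glide_velocities_def is_arg_max_linorder)

lemma glide_velocities_nonempty:
  assumes "finite G" "G \<noteq> {}"
  shows "glide_velocities G f \<noteq> {}"
proof -
  have "Max ((\<lambda>g. f \<bullet> g) ` G) \<in> (\<lambda>g. f \<bullet> g) ` G" using assms by (intro Max_in) auto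
  then obtain g where "g \<in> G" "f \<bullet> g = Max ((\<lambda>g. f \<bullet> g) ` G)" by auto
  moreover from this have "\<forall>g'\<in>G. f \<bullet> g' \<le> f \<bullet> g" using assms by simp
  ultimately have "(f \<bullet> g) *\<^sub>R g \<in> glide_velocities G f"
    unfolding glide_velocities_iff by blast
  then show ?thesis by blast
qed

lemma finite_glide_velocities: "finite G \<Longrightarrow> finite (glide_velocities G f)"
  by (rule finite_subset[of _ "(\<lambda>g. (f \<bullet> g) *\<^sub>R g) ` G"]) (auto simp: glide_velocities_iff)

lemma norm_glide_velocity:
  assumes "\<And>g. g \<in> G \<Longrightarrow> norm g = 1" "v \<in> glide_velocities G f"
  shows "norm v \<le> norm f"
proof -
  obtain g where g: "g \<in> G" "v = (f \<bullet> g) *\<^sub>R g" using assms(2) by (auto simp: glide_velocities_iff)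
  then show ?thesis using Cauchy_Schwarz_ineq2[of f g] assms(1) by simp
qed

text \<open>\<open>G\<close> is finite, so directions that are not optimal for \<open>f\<close> miss the optimum by a definite gap. They
  remain suboptimal for forces \<open>f'\<close> closer to \<open>f\<close> than half of the smallest gap.\<close>

lemma glide_velocities_upper_semicontinuous:
  assumes fin: "finite G" and unit: "\<And>g. g \<in> G \<Longrightarrow> norm g = 1" and e: "0 < e"
  shows "\<exists>d>0. \<forall>f'. dist f' f < d \<longrightarrow> (\<forall>w\<in>glide_velocities G f'. \<exists>v\<in>glide_velocities G f. dist v w \<le> e)"
proof -
  define gaps where "gaps = insert e ((\<lambda>(g, g'). (f \<bullet> g' - f \<bullet> g) / 2) ` {(g, g') \<in> G \<times> G. f \<bullet> g < f \<bullet> g'})"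
  have "finite {(g, g') \<in> G \<times> G. f \<bullet> g < f \<bullet> g'}" using fin by (intro finite_subset[OF _ finite_cartesian_product[OF fin fin]]) auto
  then have fg: "finite gaps" by (simp add: gaps_def)
  define d where "d = Min gaps"
  have d: "0 < d" using fg e by (auto simp: d_def gaps_def)
  have de: "d \<le> e" using fg by (auto simp: d_def gaps_def)
  have dgap: "d \<le> (f \<bullet> g' - f \<bullet> g) / 2" if "g \<in> G" "g' \<in> G" "f \<bullet> g < f \<bullet> g'" for g g'
    unfolding d_def using fg that by (intro Min_le) (force simp: gaps_def)+
  have "\<exists>v\<in>glide_velocities G f. dist v w \<le> e" if f': "dist f' f < d" and w: "w \<in> glide_velocities G f'" for f' w
  proof -
    obtain g where g: "g \<in> G" "w = (f' \<bullet> g) *\<^sub>R g" and mx: "\<And>g'. g' \<in> G \<Longrightarrow> f' \<bullet> g' \<le> f' \<bullet> g"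
      using w by (auto simp: glide_velocities_iff)
    have close: "\<bar>f' \<bullet> h - f \<bullet> h\<bar> < d" if "h \<in> G" for h
      using Cauchy_Schwarz_ineq2[of "f' - f" h] f' unit[OF that] by (simp add: inner_diff_left dist_norm)
    have "f \<bullet> g' \<le> f \<bullet> g" if "g' \<in> G" for g'
    proof (rule ccontr)
      assume "\<not> ?thesis"
      then have "d \<le> (f \<bullet> g' - f \<bullet> g) / 2" using dgap[OF g(1) that] by simp
      then show False using close[OF that] close[OF g(1)] mx[OF that] by (simp add: abs_less_iff field_simps)
    qed
    then have "(f \<bullet> g) *\<^sub>R g \<in> glide_velocities G f" using g(1) by (auto simp: glide_velocities_iff)
    moreover have "dist ((f \<bullet> g) *\<^sub>R g) w = \<bar>f \<bullet> g - f' \<bullet> g\<bar>"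
      using unit[OF g(1)] by (simp add: g(2) dist_norm flip: scaleR_left_diff_distrib)
    ultimately show ?thesis using close[OF g(1)] de by (intro bexI[of _ "(f \<bullet> g) *\<^sub>R g"]) auto
  qed
  then show ?thesis using d by blast
qed

lemma norm_dislocation_velocity:
  fixes b :: "real^'n"
  assumes "glide_directions G" "V \<in> dislocation_map \<mu> lam b u0 G Z"
  shows "norm V \<le> sqrt (\<Sum>l\<in>UNIV. (norm (peach_koehler \<mu> lam b u0 l Z))\<^sup>2)"
  unfolding norm_vec_def[of V] L2_set_def
proof (intro real_sqrt_le_mono sum_mono power_mono)
  show "norm (V $ l) \<le> norm (peach_koehler \<mu> lam b u0 l Z)" for l
    using assms by (intro norm_glide_velocity[of G]) (auto simp: glide_directions_def dislocation_map_def)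
qed auto

lemma dislocation_map_nonempty:
  fixes b :: "real^'n"
  assumes G: "glide_directions G"
  shows "dislocation_map \<mu> lam b u0 G Z \<noteq> {}"
proof -
  have "axis 1 1 \<noteq> (0 :: real^2)" by (simp add: axis_eq_0_iff)
  then have "(UNIV :: (real^2) set) \<noteq> {0}" by blast
  then have "G \<noteq> {}" using G by (auto simp: glide_directions_def)
  then have "\<exists>v. v \<in> glide_velocities G f" for f
    using G glide_velocities_nonempty[of G f] by (auto simp: glide_directions_def)
  then obtain s where s: "\<And>f. s f \<in> glide_velocities G f" by metis
  have "(\<chi> l. s (peach_koehler \<mu> lam b u0 l Z)) \<in> dislocation_map \<mu> lam b u0 G Z"
    by (simp add: dislocation_map_def s)
  then show ?thesis by blast
qed

lemma compact_dislocation_map: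
  fixes b :: "real^'n"
  assumes G: "glide_directions G"
  shows "compact (dislocation_map \<mu> lam b u0 G Z)"
proof -
  have "closed (glide_velocities G f)" for f
    using G by (intro finite_imp_closed finite_glide_velocities) (simp add: glide_directions_def)
  then have "closed ((\<lambda>V :: real^2^'n. V $ l) -` glide_velocities G f)" for l f
    by (intro closed_vimage continuous_intros) auto
  moreover have "dislocation_map \<mu> lam b u0 G Z = (\<Inter>l. (\<lambda>V. V $ l) -` glide_velocities G (peach_koehler \<mu> lam b u0 l Z))"
    by (auto simp: dislocation_map_def)
  ultimately have "closed (dislocation_map \<mu> lam b u0 G Z)" by auto
  moreover have "bounded (dislocation_map \<mu> lam b u0 G Z)"
    unfolding bounded_iff using norm_dislocation_velocity[OF G] by blast
  ultimately show ?thesis by (simp add: compact_eq_bounded_closed)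
qed

text \<open>The values are products over the dislocations, so it suffices to approximate each component within
  \<open>e / CARD('n)\<close>.\<close>

lemma dislocation_map_upper_semicontinuous:
  fixes b :: "real^'n"
  assumes G: "glide_directions G"
    and cont: "\<And>l. continuous_on D (peach_koehler \<mu> lam b u0 l)"
    and Z: "Z \<in> D" and e: "0 < e"
  shows "\<exists>d>0. \<forall>Y\<in>D. dist Y Z < d \<longrightarrow>
     (\<forall>W\<in>dislocation_map \<mu> lam b u0 G Y. \<exists>V\<in>dislocation_map \<mu> lam b u0 G Z. dist V W \<le> e)"
proof -
  let ?j = "peach_koehler \<mu> lam b u0"
  define e' where "e' = e / real CARD('n)"
  have e': "0 < e'" using e by (simp add: e'_def)
  have G': "finite G" "\<And>g. g \<in> G \<Longrightarrow> norm g = 1" using G by (auto simp: glide_directions_def)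
  have "\<exists>d>0. \<forall>Y\<in>D. dist Y Z < d \<longrightarrow> (\<forall>w\<in>glide_velocities G (?j l Y). \<exists>v\<in>glide_velocities G (?j l Z). dist v w \<le> e')" for l
  proof -
    obtain a where a: "0 < a" "\<forall>f'. dist f' (?j l Z) < a \<longrightarrow> (\<forall>w\<in>glide_velocities G f'. \<exists>v\<in>glide_velocities G (?j l Z). dist v w \<le> e')"
      using glide_velocities_upper_semicontinuous[OF G' e'] by blast
    obtain d where "0 < d" "\<forall>Y\<in>D. dist Y Z < d \<longrightarrow> dist (?j l Y) (?j l Z) < a"
      using cont[of l] Z a(1) unfolding continuous_on_iff by blast
    then show ?thesis using a(2) by blast
  qed
  then obtain d where d: "\<And>l. 0 < d l"
    "\<And>l Y w. Y \<in> D \<Longrightarrow> dist Y Z < d l \<Longrightarrow> w \<in> glide_velocities G (?j l Y) \<Longrightarrow> \<exists>v\<in>glide_velocities G (?j l Z). dist v w \<le> e'"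
    by metis
  have "\<exists>V\<in>dislocation_map \<mu> lam b u0 G Z. dist V W \<le> e"
    if Y: "Y \<in> D" "dist Y Z < Min (range d)" and W: "W \<in> dislocation_map \<mu> lam b u0 G Y" for Y W
  proof -
    have "dist Y Z < d l" for l using Y(2) by simp
    then have "\<exists>v\<in>glide_velocities G (?j l Z). dist v (W $ l) \<le> e'" for l
      using d(2)[OF Y(1)] W by (auto simp: dislocation_map_def)
    then obtain v where v: "\<And>l. v l \<in> glide_velocities G (?j l Z)" "\<And>l. dist (v l) (W $ l) \<le> e'" by metis
    have "dist (\<chi> l. v l) W \<le> (\<Sum>l\<in>UNIV. dist (v l) (W $ l))"
      unfolding dist_vec_def by (rule order_trans[OF L2_set_le_sum]) auto
    also have "\<dots> \<le> real CARD('n) * e'" by (rule sum_bounded_above) (rule v(2))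
    also have "\<dots> = e" by (simp add: e'_def)
    finally show ?thesis
      by (intro bexI[of _ "\<chi> l. v l"]) (auto simp: dislocation_map_def v)
  qed
  then show ?thesis using d(1) by (intro exI[of _ "Min (range d)"]) auto
qed

section \<open>Solutions of the dislocation inclusion\<close>

lemma cball_subset_of_infdist_frontier:
  fixes x :: "'a::euclidean_space"
  assumes "x \<in> S" "0 \<le> r" "r < infdist x (frontier S)"
  shows "cball x r \<subseteq> S"
proof (rule ccontr)
  assume "\<not> cball x r \<subseteq> S"
  then have "cball x r \<inter> frontier S \<noteq> {}"
  proof (intro connected_Int_frontier)
    have "x \<in> cball x r \<inter> S" using assms by simp
    then show "cball x r \<inter> S \<noteq> {}" by blast
  qed auto
  then obtain y where "y \<in> frontier S" "dist x y \<le> r" by auto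
  then show False using infdist_le[of y "frontier S" x] assms by auto
qed

theorem theorem2p15:
  fixes \<Omega> :: "(real^2) set" and \<gamma> \<mu> lam r\<^sub>0 m\<^sub>0 :: real and b :: "real^'n"
    and u\<^sub>0 :: "real^2^'n \<Rightarrow> real^2 \<Rightarrow> real" and G :: "(real^2) set" and Z\<^sub>0 :: "real^2^'n"
  assumes "open \<Omega>" and "bounded \<Omega>" and "simply_connected \<Omega>"
    and "0 < \<gamma>" and "\<gamma> < 1" and "C2_holder_boundary \<gamma> \<Omega>"
    and "\<mu> > 0" and "lam \<noteq> 0"
    and "is_boundary_response \<Omega> \<mu> lam b u\<^sub>0"
    and "glide_directions G"
    and "Z\<^sub>0 \<in> configurations \<Omega>"
    and "0 < r\<^sub>0" and "r\<^sub>0 < infdist Z\<^sub>0 (frontier (configurations \<Omega>))"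
    and "m\<^sub>0 = (GREATEST m. \<exists>Z\<in>closure (ball Z\<^sub>0 r\<^sub>0).
                 m = sqrt (\<Sum>l\<in>UNIV. (norm (peach_koehler \<mu> lam b u\<^sub>0 l Z))\<^sup>2))"
    (* when m0 = 0 the bound r0 / m0 is +infinity, so every T is admissible *)
  shows "(m\<^sub>0 \<noteq> 0 \<longrightarrow>
            (\<exists>T Z. T \<ge> r\<^sub>0 / m\<^sub>0 \<and> Z 0 = Z\<^sub>0 \<and>
               inclusion_solution (configurations \<Omega>)
                 (\<lambda>W. convex hull (dislocation_map \<mu> lam b u\<^sub>0 G W)) {-T..T} Z)) \<and>
         (m\<^sub>0 = 0 \<longrightarrow>
            (\<forall>T>0. \<exists>Z. Z 0 = Z\<^sub>0 \<and>
               inclusion_solution (configurations \<Omega>)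
                 (\<lambda>W. convex hull (dislocation_map \<mu> lam b u\<^sub>0 G W)) {-T..T} Z))"
proof -
  let ?B = "cball Z\<^sub>0 r\<^sub>0" and ?C = "configurations \<Omega> :: (real^2^'n) set"
  let ?j = "peach_koehler \<mu> lam b u\<^sub>0" and ?F = "dislocation_map \<mu> lam b u\<^sub>0 G"
  define m where "m Z = sqrt (\<Sum>l\<in>UNIV. (norm (?j l Z))\<^sup>2)" for Z
  have BC: "?B \<subseteq> ?C" using assms(11-13) by (intro cball_subset_of_infdist_frontier) auto
  have contj: "continuous_on ?B (?j l)" for l
    using continuous_on_peach_koehler[OF assms(1-3,6-9)] BC by (rule continuous_on_subset)
  then have "continuous_on ?B m" unfolding m_def by (intro continuous_intros)
  then obtain Zm where Zm: "Zm \<in> ?B" "\<And>Z. Z \<in> ?B \<Longrightarrow> m Z \<le> m Zm"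
    using continuous_attains_sup[of ?B m] assms(12) by auto
  have "(GREATEST x. \<exists>Z\<in>?B. x = m Z) = m Zm"
    using Zm by (intro Greatest_equality) auto
  then have m0: "m\<^sub>0 = m Zm" using assms(12,14) by (simp add: m_def closure_ball)
  have mle: "m Z \<le> m\<^sub>0" if "Z \<in> ?B" for Z using Zm(2)[OF that] m0 by simp
  have bd: "norm V \<le> m\<^sub>0" if "Z \<in> ?B" "V \<in> ?F Z" for Z V
    using norm_dislocation_velocity[OF assms(10) that(2)] mle[OF that(1)] by (simp add: m_def)
  have ne: "?F Z \<noteq> {}" and cpt: "compact (?F Z)" if "Z \<in> ?B" for Z
    using dislocation_map_nonempty[OF assms(10)] compact_dislocation_map[OF assms(10)] by blast+
  have usc: "\<exists>d>0. \<forall>Y\<in>?B. dist Y Z < d \<longrightarrow> (\<forall>W\<in>?F Y. \<exists>V\<in>?F Z. dist V W \<le> e)"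
    if "Z \<in> ?B" "0 < e" for Z e
    using that by (rule dislocation_map_upper_semicontinuous[OF assms(10) contj])
  have "\<exists>T Z. T \<ge> r\<^sub>0 / m\<^sub>0 \<and> Z 0 = Z\<^sub>0 \<and> inclusion_solution ?C (\<lambda>W. convex hull ?F W) {-T..T} Z"
    if nz: "m\<^sub>0 \<noteq> 0"
  proof -
    have "0 \<le> m\<^sub>0" unfolding m0 m_def by (intro real_sqrt_ge_zero sum_nonneg) auto
    then have M: "0 < m\<^sub>0" using nz by simp
    obtain X where X: "X 0 = Z\<^sub>0" "\<And>s t. norm (X s - X t) \<le> m\<^sub>0 * \<bar>s - t\<bar>" "\<And>t. X t \<in> ?B"
      "negligible {t \<in> {- (r\<^sub>0 / m\<^sub>0)..r\<^sub>0 / m\<^sub>0}. \<not> (\<exists>v\<in>convex hull ?F (X t). (X has_vector_derivative v) (at t))}"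
      by (rule two_sided_inclusion_exists[OF assms(12) M, of Z\<^sub>0 ?F]) ((rule ne cpt bd usc; assumption) | blast)+
    have "inclusion_solution ?C (\<lambda>W. convex hull ?F W) {- (r\<^sub>0 / m\<^sub>0)..r\<^sub>0 / m\<^sub>0} X"
      using X BC by (intro inclusion_solution_intro[where M = m\<^sub>0]) blast+
    then show ?thesis using X(1) by blast
  qed
  moreover have "\<exists>Z. Z 0 = Z\<^sub>0 \<and> inclusion_solution ?C (\<lambda>W. convex hull ?F W) {-T..T} Z" if "m\<^sub>0 = 0" for T
  proof -
    obtain V where V: "V \<in> ?F Z\<^sub>0" using dislocation_map_nonempty[OF assms(10)] by blast
    then have "norm V \<le> 0" using bd[of Z\<^sub>0 V] that assms(12) by simp
    then have "0 \<in> convex hull ?F Z\<^sub>0" using V hull_inc by fastforce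
    then have "\<exists>v\<in>convex hull ?F Z\<^sub>0. ((\<lambda>_. Z\<^sub>0) has_vector_derivative v) (at t)" for t
      using has_vector_derivative_const by blast
    then have "{t \<in> {-T..T}. \<not> (\<exists>v\<in>convex hull ?F Z\<^sub>0. ((\<lambda>_. Z\<^sub>0) has_vector_derivative v) (at t))} = {}"
      by blast
    then have "inclusion_solution ?C (\<lambda>W. convex hull ?F W) {-T..T} (\<lambda>_. Z\<^sub>0)"
      using assms(11) by (intro inclusion_solution_intro[where M = 0]) (simp_all only:, simp_all)
    then show ?thesis by (intro exI[of _ "\<lambda>_. Z\<^sub>0"]) simp
  qed
  ultimately show ?thesis by blast
qed

end
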